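(* Let $H$ and $H'$ be complex Hilbert spaces of dimension not less than $3$. Let $k,m$ be natural numbers with $0<k<\dim H$ and $0<m<\dim H'$, and suppose that $L:{\mathcal F}_{s}(H)\to {\mathcal F}_{s}(H')$ is a (real) linear operator such that $L({\mathcal P}_{k}(H))\subset {\mathcal P}_{m}(H')$ and the restriction of $L$ to ${\mathcal P}_{k}(H)$ is injective. (1) If $\dim H\ge 2k$, then $k\le m$. (2) Suppose that $H$ is infinite-dimensional and that for any $P,Q\in {\mathcal P}_{k}(H)$ the dimension of the intersection of the images of $L(P)$ and $L(Q)$ is not less than $m-k$. Then $L=L_{U,W}$, where $W$ is an $(m-k)$-dimensional subspace of $H'$ and $U$ is a linear or conjugate-linear isometry of $H$ to the orthogonal complement of $W$.
   Context: For a complex Hilbert space $H$, ${\mathcal F}_{s}(H)$ is the real vector space of all self-adjoint operators of finite rank on $H$, and ${\mathcal P}_{k}(H)$ (for natural $k$ with $0<k<\dim H$) is the set of all rank $k$ projections, i.e. self-adjoint idempotents whose images are $k$-dimensional subspaces of $H$. Isometries are not assumed surjective. The operator $L_{U,W}$: let $k\le m$, let $W\subset H'$ be an $(m-k)$-dimensional subspace, let $H''=W^{\perp}$ be its orthogonal complement in $H'$, and let $U:H\to H''$ be a linear or conjugate-linear isometry with adjoint $U^{*}:H''\to H$ (in the conjugate-linear case $\langle Ux,y\rangle=\overline{\langle x,U^{*}y\rangle}$). For $A\in{\mathcal F}_{s}(H)$, $L_{U,W}(A)\in{\mathcal F}_{s}(H')$ is the operator whose restriction to $H''$ is $UAU^{*}$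 and whose restriction to $W$ is $k^{-1}{\rm tr}(A)\,{\rm Id}_{W}$, i.e. $$L_{U,W}(A)=UAU^{*}P_{H''}+k^{-1}{\rm tr}(A)P_{W},$$ where $P_{Z}$ denotes the orthogonal projection of $H'$ onto a closed subspace $Z$. If $W=0$, this is $A\mapsto UAU^{*}$. *)

theory Defs
  imports "HOL-Analysis.Analysis" "HOL-Library.Extended_Nat"
begin

text \<open>
  Complex Hilbert spaces. The inner product is linear in the first argument, and the scalar
  multiplication, norm and topology inherited from the class \<^class>\<open>banach\<close> are those
  determined by the complex structure.
\<close>

class chilbert_space = banach +
  fixes scaleC :: "complex \<Rightarrow> 'a \<Rightarrow> 'a" (infixr "*\<^sub>C" 75)
    and cinner :: "'a \<Rightarrow> 'a \<Rightarrow> complex"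
  assumes scaleC_add_right: "a *\<^sub>C (x + y) = a *\<^sub>C x + a *\<^sub>C y"
    and scaleC_add_left: "(a + b) *\<^sub>C x = a *\<^sub>C x + b *\<^sub>C x"
    and scaleC_scaleC: "a *\<^sub>C (b *\<^sub>C x) = (a * b) *\<^sub>C x"
    and scaleC_one: "1 *\<^sub>C x = x"
    and scaleR_scaleC: "r *\<^sub>R x = complex_of_real r *\<^sub>C x"
    and cinner_commute: "cinner x y = cnj (cinner y x)"
    and cinner_add_left: "cinner (x + y) z = cinner x z + cinner y z"
    and cinner_scaleC_left: "cinner (a *\<^sub>C x) y = a * cinner x y"
    and cinner_self: "cinner x x = complex_of_real ((norm x)\<^sup>2)"

global_interpretation complex_vector: vector_space "scaleC :: complex \<Rightarrow> 'a \<Rightarrow> 'a::chilbert_space"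
  defines cspan = complex_vector.span
    and csubspace = complex_vector.subspace
    and cdim = complex_vector.dim
  by unfold_locales
    (simp_all add: scaleC_add_right scaleC_add_left scaleC_scaleC scaleC_one)

abbreviation clinear :: "('a::chilbert_space \<Rightarrow> 'b::chilbert_space) \<Rightarrow> bool" where
  "clinear \<equiv> Vector_Spaces.linear scaleC scaleC"

definition conj_linear :: "('a::chilbert_space \<Rightarrow> 'b::chilbert_space) \<Rightarrow> bool" where
  "conj_linear f \<longleftrightarrow>
    (\<forall>x y. f (x + y) = f x + f y) \<and> (\<forall>c x. f (c *\<^sub>C x) = cnj c *\<^sub>C f x)"

text \<open>
  \<^term>\<open>cdim\<close> is 0 on infinite-dimensional spaces, hence the extended version. All infinite
  dimensions are identified.
\<close>

definition ecdim :: "'a::chilbert_space set \<Rightarrow> enat" where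
  "ecdim S = (if \<exists>B. finite B \<and> S \<subseteq> cspan B then enat (cdim S) else \<infinity>)"

text \<open>Elements of \<^typ>\<open>'a \<Rightarrow>\<^sub>L 'a\<close> are only real-linear, so complex linearity is part of the definition.\<close>

definition self_adjoint :: "('a::chilbert_space \<Rightarrow>\<^sub>L 'a) \<Rightarrow> bool" where
  "self_adjoint A \<longleftrightarrow>
    clinear (blinfun_apply A) \<and> (\<forall>x y. cinner (blinfun_apply A x) y = cinner x (blinfun_apply A y))"

definition fin_rank_sa :: "('a::chilbert_space \<Rightarrow>\<^sub>L 'a) set" where
  "fin_rank_sa = {A. self_adjoint A \<and> ecdim (range (blinfun_apply A)) < \<infinity>}"

definition projections :: "nat \<Rightarrow> ('a::chilbert_space \<Rightarrow>\<^sub>L 'a) set" where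
  "projections k =
    {P. self_adjoint P \<and> P o\<^sub>L P = P \<and> ecdim (range (blinfun_apply P)) = enat k}"

definition orthonormal_basis :: "'a::chilbert_space set \<Rightarrow> bool" where
  "orthonormal_basis B \<longleftrightarrow>
    (\<forall>e\<in>B. \<forall>f\<in>B. cinner e f = (if e = f then 1 else 0)) \<and> closure (cspan B) = UNIV"

text \<open>For operators of finite rank the value does not depend on the choice of the basis.\<close>

definition op_trace :: "('a::chilbert_space \<Rightarrow>\<^sub>L 'a) \<Rightarrow> complex" where
  "op_trace A =
    (\<Sum>\<^sub>\<infinity>e\<in>(SOME B. orthonormal_basis B). cinner (blinfun_apply A e) e)"

definition orth_compl :: "'a::chilbert_space set \<Rightarrow> 'a set" where
  "orth_compl W = {x. \<forall>w\<in>W. cinner x w = 0}"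

definition orth_proj :: "'a::chilbert_space set \<Rightarrow> 'a \<Rightarrow> 'a" where
  "orth_proj Z x = (THE z. z \<in> Z \<and> x - z \<in> orth_compl Z)"

text \<open>
  The adjoint of a bounded linear or conjugate-linear map. If the range of \<open>U\<close> is contained in
  a closed subspace \<open>Z\<close>, then the adjoint of \<open>U\<close> as a map into \<open>Z\<close> is the restriction to \<open>Z\<close> of
  the adjoint defined here.
\<close>

definition adj :: "('a::chilbert_space \<Rightarrow> 'b::chilbert_space) \<Rightarrow> 'b \<Rightarrow> 'a" where
  "adj U y =
    (THE z. \<forall>x. cinner (U x) y = (if clinear U then cinner x z else cnj (cinner x z)))"

definition isometry_op :: "('a::chilbert_space \<Rightarrow> 'b::chilbert_space) \<Rightarrow> bool" where
  "isometry_op U \<longleftrightarrow> (clinear U \<or> conj_linear U) \<and> (\<forall>x. norm (U x) = norm x)"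

definition L_op ::
  "nat \<Rightarrow> ('a::chilbert_space \<Rightarrow> 'b::chilbert_space) \<Rightarrow> 'b set \<Rightarrow> ('a \<Rightarrow>\<^sub>L 'a) \<Rightarrow> 'b \<Rightarrow> 'b" where
  "L_op k U W A = (\<lambda>x.
    U (blinfun_apply A (adj U (orth_proj (orth_compl W) x)))
      + (inverse (of_nat k) * op_trace A) *\<^sub>C orth_proj W x)"

end

theory Submission
  imports Defs "HOL-Computational_Algebra.Fundamental_Theorem_Algebra"
begin

text \<open>A rank \<open>k\<close> projection is a sum of operators \<open>x x\<^sup>*\<close> (\<open>dyad x\<close>) over an orthonormal family of \<open>k\<close>
  vectors. What is known about \<open>L\<close> is that \<open>p\<^sup>2 = p\<close> for the images \<open>p\<close> of these sums. Comparing such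
  identities for families that differ in one or two vectors gives linear relations between the
  Jordan products \<open>AB + BA\<close> of the operators \<open>d\<^sub>x\<^sub>y = L (x x\<^sup>* - y y\<^sup>*)\<close> for orthonormal pairs, and both
  parts of the theorem are extracted from these relations.

  First part. If \<open>k \<ge> 2\<close>, then \<open>d\<^sub>x\<^sub>y\<close> and \<open>d\<^sub>z\<^sub>w\<close> anticommute for orthonormal \<open>x, y, z, w\<close>
  (\<open>acomm_disjoint_pairs\<close>). Together with the injectivity on projections this implies that \<open>L\<close> is
  injective on the trace zero operators with a fixed further vector in their kernel
  (\<open>traceless_kernel_trivial\<close>). Within a \<open>2k\<close>-dimensional space these contain a real vector space of
  dimension \<open>(2k - 1)(2k - 2)\<close>, while their images live on the range of \<open>L(P) + L(Q)\<close> for two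
  complementary rank \<open>k\<close> projections, which has dimension at most \<open>2m\<close>. The resulting inequality
  \<open>(2k - 1)(2k - 2) \<le> (2m)\<^sup>2\<close> forces \<open>k \<le> m\<close> (\<open>rank_inequality\<close>). Orthogonality of the \<open>d\<^sub>x\<^sub>y\<close> cannot
  be expected here: representations of Clifford algebras give maps with \<open>d\<^sub>x\<^sub>y d\<^sub>z\<^sub>w \<noteq> 0\<close>.

  Second part. In infinite dimension, anticommuting operators of finite rank are mostly orthogonal,
  since nonzero anticommuting self-adjoint operators on a finite-dimensional space are linearly
  independent (\<open>finitely_many_anticommuting_overlaps\<close>). So any \<open>d\<^sub>x\<^sub>y\<close> can be completed to \<open>k\<close> orthogonal
  nonzero operators whose sum is a difference \<open>L(P) - L(Q)\<close>. By the hypothesis on intersections, such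
  a difference has at most \<open>k\<close> positive eigenvalues, and hence \<open>d\<^sub>x\<^sub>y\<close> has exactly one
  (\<open>positive_eigenvector_unique\<close>). The Jordan relations for the Pauli matrices of the plane of \<open>x\<close> and
  \<open>y\<close> then show that \<open>d\<^sub>x\<^sub>y = u u\<^sup>* - v v\<^sup>*\<close> with an orthonormal pair \<open>u, v\<close>, and that the images of
  adjacent frames commute (\<open>frame_structure\<close>). Finite rank, applied to infinitely many \<open>y\<close>, shows that
  the line of \<open>u\<close> depends only on \<open>x\<close> (\<open>common_positive_line\<close>). So \<open>L (x x\<^sup>*) = g(x) g(x)\<^sup>* + V\<close> for unit
  vectors \<open>x\<close>, where \<open>g\<close> preserves orthogonality and \<open>V\<close> is constant. Three orthogonal frames suffice to
  see that \<open>K = k V\<close> is a projection of rank \<open>m - k\<close> that annihilates all \<open>g(x)\<close> (\<open>K_frame\<close>,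
  \<open>K_projection\<close>); its range is the subspace \<open>W\<close>. Finally \<open>x x\<^sup>* \<mapsto> g(x) g(x)\<^sup>*\<close> is induced by an
  isometry: this is Wigner's theorem, and it is easy here because the map is known to be linear
  (\<open>h_orthogonal\<close>, \<open>h_linear_or_conjugate_linear\<close>, \<open>isometry_exists\<close>).\<close>

notation blinfun_apply (infixr "\<cdot>" 85)

section \<open>Inner product calculus\<close>

lemma cinner_add_right: "cinner x (y + z) = cinner x y + cinner x (z::'a::chilbert_space)"
  by (metis cinner_add_left cinner_commute complex_cnj_add)

lemma cinner_scaleC_right: "cinner x (a *\<^sub>C y) = cnj a * cinner x (y::'a::chilbert_space)"
  by (metis cinner_scaleC_left cinner_commute complex_cnj_mult)

lemma cinner_zero_left [simp]: "cinner 0 (y::'a::chilbert_space) = 0"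
  using cinner_add_left[of 0 0 y] by simp

lemma cinner_zero_right [simp]: "cinner (y::'a::chilbert_space) 0 = 0"
  using cinner_add_right[of y 0 0] by simp

lemma cinner_minus_left [simp]: "cinner (- x) (y::'a::chilbert_space) = - cinner x y"
  using cinner_add_left[of x "-x" y] by (simp add: add_eq_0_iff)

lemma cinner_minus_right [simp]: "cinner x (- y::'a::chilbert_space) = - cinner x y"
  using cinner_add_right[of x y "-y"] by (simp add: add_eq_0_iff)

lemma cinner_diff_left: "cinner (x - y) (z::'a::chilbert_space) = cinner x z - cinner y z"
  using cinner_add_left[of x "-y" z] by simp

lemma cinner_diff_right: "cinner x (y - z::'a::chilbert_space) = cinner x y - cinner x z"
  using cinner_add_right[of x y "-z"] by simp

lemma cinner_scaleR_left: "cinner (r *\<^sub>R x) (y::'a::chilbert_space) = of_real r * cinner x y"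
  by (simp add: scaleR_scaleC cinner_scaleC_left)

lemma cinner_scaleR_right: "cinner x (r *\<^sub>R y::'a::chilbert_space) = of_real r * cinner x y"
  by (simp add: scaleR_scaleC cinner_scaleC_right)

lemma cinner_sum_left: "cinner (\<Sum>i\<in>I. f i) (y::'a::chilbert_space) = (\<Sum>i\<in>I. cinner (f i) y)"
  by (induction I rule: infinite_finite_induct) (auto simp: cinner_add_left)

lemma cinner_sum_right: "cinner y (\<Sum>i\<in>I. f i::'a::chilbert_space) = (\<Sum>i\<in>I. cinner y (f i))"
  by (induction I rule: infinite_finite_induct) (auto simp: cinner_add_right)

lemmas cinner_simps = cinner_add_left cinner_add_right cinner_diff_left cinner_diff_right
  cinner_scaleC_left cinner_scaleC_right cinner_scaleR_left cinner_scaleR_right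

lemma cinner_self_eq_0 [simp]: "cinner x x = 0 \<longleftrightarrow> (x::'a::chilbert_space) = 0"
  by (simp add: cinner_self)

lemma cinner_ext: "(\<And>z. cinner x z = cinner y z) \<Longrightarrow> (x::'a::chilbert_space) = y"
proof -
  assume "\<And>z. cinner x z = cinner y z"
  then have "cinner (x - y) (x - y) = 0" by (simp add: cinner_diff_left)
  then show ?thesis by (simp only: cinner_self_eq_0) simp
qed

lemma cinner_sym_0: "cinner x y = 0 \<longleftrightarrow> cinner y (x::'a::chilbert_space) = 0"
  by (metis cinner_commute complex_cnj_zero)

lemma scaleC_zero_left [simp]: "0 *\<^sub>C x = (0::'a::chilbert_space)"
  by (rule complex_vector.scale_zero_left)

lemma scaleC_zero_right [simp]: "c *\<^sub>C (0::'a::chilbert_space) = 0"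
  by (rule complex_vector.scale_zero_right)

lemma scaleC_minus_left [simp]: "(- c) *\<^sub>C x = - (c *\<^sub>C (x::'a::chilbert_space))"
  by (rule complex_vector.scale_minus_left)

lemma scaleC_minus_right [simp]: "c *\<^sub>C (- x) = - (c *\<^sub>C (x::'a::chilbert_space))"
  by (rule complex_vector.scale_minus_right)

lemmas scaleC_simps = scaleC_add_left scaleC_add_right scaleC_scaleC scaleC_one
  complex_vector.scale_left_diff_distrib complex_vector.scale_right_diff_distrib

lemma norm_scaleC [simp]: "norm (a *\<^sub>C x) = cmod a * norm (x::'a::chilbert_space)"
proof -
  have "complex_of_real ((norm (a *\<^sub>C x))\<^sup>2) = (a * cnj a) * complex_of_real ((norm x)\<^sup>2)"
    unfolding cinner_self[symmetric] by (simp add: cinner_scaleC_left cinner_scaleC_right)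
  also have "\<dots> = complex_of_real ((cmod a * norm x)\<^sup>2)"
    unfolding complex_norm_square[symmetric] of_real_mult[symmetric] by (simp add: power_mult_distrib)
  finally have "complex_of_real ((norm (a *\<^sub>C x))\<^sup>2) = complex_of_real ((cmod a * norm x)\<^sup>2)" .
  then have "(norm (a *\<^sub>C x))\<^sup>2 = (cmod a * norm x)\<^sup>2" by (simp only: of_real_eq_iff)
  then show ?thesis by (simp add: power2_eq_iff_nonneg)
qed

lemma norm_eq_1_iff_cinner: "norm (x::'a::chilbert_space) = 1 \<longleftrightarrow> cinner x x = 1"
proof
  assume "cinner x x = 1"
  then have "(norm x)\<^sup>2 = 1" unfolding cinner_self by (metis of_real_eq_1_iff)
  then show "norm x = 1" by (simp add: power2_eq_1_iff) (smt (verit) norm_ge_zero)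
qed (simp add: cinner_self)

lemma normalize_unit:
  assumes "x \<noteq> (0::'c::chilbert_space)"
  obtains r u where "r > 0" "norm u = 1" "x = r *\<^sub>R u" "r = norm x"
proof -
  have "norm ((1 / norm x) *\<^sub>R x) = 1" "x = norm x *\<^sub>R ((1 / norm x) *\<^sub>R x)" using assms by simp_all
  then show thesis using that[of "norm x"] assms by (metis zero_less_norm_iff)
qed

lemma norm_add_sq_orth:
  "cinner x y = 0 \<Longrightarrow> (norm (x + y))\<^sup>2 = (norm x)\<^sup>2 + (norm (y::'a::chilbert_space))\<^sup>2"
proof -
  assume a: "cinner x y = 0"
  have "cinner (x + y) (x + y) = cinner x x + cinner y y"
    using a cinner_sym_0[of x y] by (simp add: cinner_simps)
  then show ?thesis unfolding cinner_self by (metis of_real_add of_real_eq_iff)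
qed

lemma parallelogram:
  "(norm (x + y))\<^sup>2 + (norm (x - y))\<^sup>2 = 2 * (norm x)\<^sup>2 + 2 * (norm (y::'a::chilbert_space))\<^sup>2"
proof -
  have "cinner (x + y) (x + y) + cinner (x - y) (x - y) = 2 * cinner x x + 2 * cinner y y"
    by (simp add: cinner_simps)
  then have "complex_of_real ((norm (x + y))\<^sup>2 + (norm (x - y))\<^sup>2) = complex_of_real (2 * (norm x)\<^sup>2 + 2 * (norm y)\<^sup>2)"
    by (simp add: cinner_self)
  then show ?thesis by (simp only: of_real_eq_iff)
qed

lemma Cauchy_Schwarz: "cmod (cinner x y) \<le> norm x * norm (y::'a::chilbert_space)"
proof (cases "y = 0")
  case False
  define c where "c = cinner x y / cinner y y"
  have n: "cinner y y \<noteq> 0" using False by simp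
  have "cinner (x - c *\<^sub>C y) (c *\<^sub>C y) = 0"
    using n by (simp add: cinner_simps c_def)
  then have "(norm x)\<^sup>2 = (norm (x - c *\<^sub>C y))\<^sup>2 + (norm (c *\<^sub>C y))\<^sup>2"
    using norm_add_sq_orth by fastforce
  then have "(norm (c *\<^sub>C y))\<^sup>2 \<le> (norm x)\<^sup>2" by simp
  then have "cmod c * norm y \<le> norm x" by (simp add: power2_le_iff_abs_le)
  moreover have "cmod c = cmod (cinner x y) / (norm y)\<^sup>2"
    by (simp add: c_def norm_divide cinner_self norm_power)
  ultimately show ?thesis using False by (simp add: field_simps power2_eq_square)
qed simp

section \<open>Self-adjoint operators\<close>

text \<open>Because the inner product separates points, a symmetric operator is complex linear.\<close>

lemma self_adjoint_iff:
  "self_adjoint A \<longleftrightarrow> (\<forall>x y. cinner (A \<cdot> x) y = cinner x (A \<cdot> y))"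
proof
  assume s: "\<forall>x y. cinner (A \<cdot> x) y = cinner x (A \<cdot> y)"
  have "A \<cdot> (c *\<^sub>C x) = c *\<^sub>C A \<cdot> x" for c x
    by (rule cinner_ext) (simp add: s cinner_scaleC_left)
  then have "clinear (blinfun_apply A)"
    by unfold_locales (auto simp: blinfun.add_right scaleC_add_right scaleC_add_left scaleC_scaleC scaleC_one)
  with s show "self_adjoint A" by (simp add: self_adjoint_def)
qed (simp add: self_adjoint_def)

lemma self_adjointD: "self_adjoint A \<Longrightarrow> cinner (A \<cdot> x) y = cinner x (A \<cdot> y)"
  by (simp add: self_adjoint_def)

lemma self_adjoint_scaleC: "self_adjoint A \<Longrightarrow> A \<cdot> (c *\<^sub>C x) = c *\<^sub>C A \<cdot> x"
  by (rule cinner_ext) (simp add: self_adjointD cinner_scaleC_left)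

lemma self_adjoint_0 [simp]: "self_adjoint 0"
  by (simp add: self_adjoint_iff)

lemma self_adjoint_add: "self_adjoint A \<Longrightarrow> self_adjoint B \<Longrightarrow> self_adjoint (A + B)"
  by (simp add: self_adjoint_iff blinfun.add_left cinner_simps)

lemma self_adjoint_diff: "self_adjoint A \<Longrightarrow> self_adjoint B \<Longrightarrow> self_adjoint (A - B)"
  by (simp add: self_adjoint_iff blinfun.diff_left cinner_simps)

lemma self_adjoint_scaleR: "self_adjoint A \<Longrightarrow> self_adjoint (r *\<^sub>R A)"
  by (simp add: self_adjoint_iff blinfun.scaleR_left cinner_simps)

lemma self_adjoint_sum: "(\<And>i. i \<in> I \<Longrightarrow> self_adjoint (f i)) \<Longrightarrow> self_adjoint (\<Sum>i\<in>I. f i)"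
  by (induction I rule: infinite_finite_induct) (auto simp: self_adjoint_add)

section \<open>Orthonormal families\<close>

text \<open>Indexed families spare the separate treatment of repeated values in dimension counts.\<close>

lemma (in vector_space) card_le_of_independent_family:
  fixes I :: "'c set"
  assumes "finite I" "finite T" "f ` I \<subseteq> span T"
    and ind: "\<And>c :: 'c \<Rightarrow> 'a. (\<Sum>i\<in>I. scale (c i) (f i)) = 0 \<Longrightarrow> \<forall>i\<in>I. c i = 0"
  shows "card I \<le> card T"
proof -
  have inj: "inj_on f I"
  proof (rule inj_onI, rule ccontr)
    fix i j assume ij: "i \<in> I" "j \<in> I" "f i = f j" "i \<noteq> j"
    define c :: "'c \<Rightarrow> 'a" where "c = (\<lambda>l. if l = i then 1 else if l = j then -1 else 0)"
    have "(\<Sum>l\<in>I. scale (c l) (f l)) = (\<Sum>l\<in>{i,j}. scale (c l) (f l))"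
      using ij assms(1) by (intro sum.mono_neutral_right) (auto simp: c_def)
    also have "\<dots> = 0" using ij by (simp add: c_def)
    finally have "c i = 0" using ind ij(1) by blast
    then show False by (simp add: c_def)
  qed
  have "independent (f ` I)"
  proof
    assume "dependent (f ` I)"
    then obtain u where u: "\<exists>v\<in>f ` I. u v \<noteq> 0" "(\<Sum>v\<in>f ` I. scale (u v) v) = 0"
      using dependent_finite[of "f ` I"] assms(1) by auto
    then have "(\<Sum>i\<in>I. scale ((u \<circ> f) i) (f i)) = 0"
      by (simp add: sum.reindex[OF inj])
    from ind[OF this] u(1) show False by auto
  qed
  then have "card (f ` I) \<le> card T"
    using independent_span_bound[OF assms(2) _ assms(3)] by blast
  then show ?thesis by (simp add: card_image[OF inj])
qed

lemma ecdim_finite_iff: "ecdim S < \<infinity> \<longleftrightarrow> (\<exists>B. finite B \<and> S \<subseteq> cspan B)"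
  by (auto simp: ecdim_def)

lemma ecdim_le_card: "finite B \<Longrightarrow> S \<subseteq> cspan B \<Longrightarrow> ecdim S \<le> enat (card B)"
  using complex_vector.dim_le_card[of S B] by (auto simp: ecdim_def)

definition orthonormal :: "'a::chilbert_space set \<Rightarrow> bool" where
  "orthonormal S \<longleftrightarrow> (\<forall>e\<in>S. \<forall>f\<in>S. cinner e f = (if e = f then 1 else 0))"

lemma orthonormalD: "orthonormal S \<Longrightarrow> x \<in> S \<Longrightarrow> y \<in> S \<Longrightarrow> cinner x y = (if x = y then 1 else 0)"
  by (simp add: orthonormal_def)

lemma orthonormal_subset: "orthonormal S \<Longrightarrow> T \<subseteq> S \<Longrightarrow> orthonormal T"
  unfolding orthonormal_def by blast

lemma orthonormal_empty [simp]: "orthonormal {}"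
  by (simp add: orthonormal_def)

lemma orthonormal_insert:
  "orthonormal S \<Longrightarrow> norm x = 1 \<Longrightarrow> (\<And>y. y \<in> S \<Longrightarrow> cinner x y = 0) \<Longrightarrow> orthonormal (insert x S)"
  unfolding orthonormal_def norm_eq_1_iff_cinner
  by (metis cinner_sym_0 insert_iff)

lemma orthonormal_pair: "norm x = 1 \<Longrightarrow> norm y = 1 \<Longrightarrow> cinner x y = 0 \<Longrightarrow> orthonormal {x, y}"
  by (intro orthonormal_insert) auto

lemma orthonormal_pair_neq: "norm x = 1 \<Longrightarrow> cinner x y = 0 \<Longrightarrow> x \<noteq> (y :: 'c::chilbert_space)"
  by (auto simp: norm_eq_1_iff_cinner)

lemma orthonormal_norm: "orthonormal S \<Longrightarrow> x \<in> S \<Longrightarrow> norm x = 1"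
  by (simp add: orthonormal_def norm_eq_1_iff_cinner)

lemma orthonormal_coeff:
  assumes "orthonormal S" "finite S" "x \<in> S"
  shows "cinner (\<Sum>y\<in>S. c y *\<^sub>C y) x = c x"
proof -
  have "cinner (\<Sum>y\<in>S. c y *\<^sub>C y) x = (\<Sum>y\<in>S. if y = x then c y else 0)"
    unfolding cinner_sum_left using assms
    by (intro sum.cong) (auto simp: cinner_scaleC_left orthonormal_def)
  then show ?thesis using assms by simp
qed

lemma orthonormal_expand:
  assumes "orthonormal S" "finite S" "x \<in> cspan S"
  shows "x = (\<Sum>y\<in>S. cinner x y *\<^sub>C y)"
proof -
  obtain c where c: "x = (\<Sum>y\<in>S. c y *\<^sub>C y)"
    using assms(3) complex_vector.span_finite[OF assms(2)] by auto
  then show ?thesis using orthonormal_coeff[OF assms(1,2)] by (simp cong: sum.cong)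
qed

lemma parseval_finite:
  assumes "orthonormal S" "finite S" "x \<in> cspan S"
  shows "cinner x x = (\<Sum>y\<in>S. cinner x y * cinner y x)"
  by (subst (2) orthonormal_expand[OF assms])
    (simp add: cinner_sum_right cinner_scaleC_right cinner_commute[symmetric] mult.commute)

lemma orthonormal_card_le:
  assumes "orthonormal S" "finite S" "finite T" "S \<subseteq> cspan T"
  shows "card S \<le> card T"
proof (rule complex_vector.card_le_of_independent_family[where f = id])
  fix c assume "(\<Sum>y\<in>S. c y *\<^sub>C id y) = 0"
  then show "\<forall>y\<in>S. c y = 0"
    using orthonormal_coeff[OF assms(1,2), of _ c] by simp
qed (use assms in auto)

lemma orthonormal_cdim_span:
  assumes "orthonormal S" "finite S"
  shows "cdim (cspan S) = card S"
proof -
  have "complex_vector.independent S"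
  proof
    assume "complex_vector.dependent S"
    then obtain u where "\<exists>v\<in>S. u v \<noteq> 0" "(\<Sum>v\<in>S. u v *\<^sub>C v) = 0"
      using complex_vector.dependent_finite[of S] assms(2) by auto
    then show False using orthonormal_coeff[OF assms, of _ u] by auto
  qed
  then show ?thesis by (metis cdim_def complex_vector.dim_span_eq_card_independent cspan_def)
qed

lemma orthonormal_finite_of_span:
  assumes "orthonormal X" "X \<subseteq> cspan B" "finite B"
  shows "finite X \<and> card X \<le> card B"
proof -
  have le: "card Y \<le> card B" if "Y \<subseteq> X" "finite Y" for Y
    using orthonormal_card_le[OF orthonormal_subset[OF assms(1) that(1)] that(2) assms(3)] that assms(2) by auto
  have "finite X"
  proof (rule ccontr)
    assume "infinite X"
    then obtain Y where "Y \<subseteq> X" "finite Y" "card Y = Suc (card B)"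
      using infinite_arbitrarily_large by metis
    then show False using le[of Y] by simp
  qed
  then show ?thesis using le by blast
qed

lemma orthogonal_remainder:
  assumes "orthonormal S" "finite S" "y \<in> S"
  shows "cinner (x - (\<Sum>z\<in>S. cinner x z *\<^sub>C z)) y = 0"
  using orthonormal_coeff[OF assms, of "cinner x"] by (simp add: cinner_diff_left)

text \<open>One step of the Gram-Schmidt process, started at a vector outside the span of \<open>F\<close>.\<close>

lemma orthonormal_extend_one:
  fixes F :: "'a::chilbert_space set"
  assumes "orthonormal F" "finite F" "enat (card F) < ecdim (UNIV :: 'a set)"
  obtains x where "x \<notin> F" "orthonormal (insert x F)"
proof -
  have "\<not> UNIV \<subseteq> cspan F"
    using ecdim_le_card[OF assms(2), of UNIV] assms(3) by auto
  then obtain z where z: "z \<notin> cspan F" by auto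
  define w where "w = z - (\<Sum>y\<in>F. cinner z y *\<^sub>C y)"
  have "(\<Sum>y\<in>F. cinner z y *\<^sub>C y) \<in> cspan F"
    by (intro complex_vector.span_sum complex_vector.span_scale complex_vector.span_base)
  then have w0: "w \<noteq> 0" using z by (auto simp: w_def)
  define x where "x = complex_of_real (1 / norm w) *\<^sub>C w"
  have "orthonormal (insert x F)"
  proof (rule orthonormal_insert[OF assms(1)])
    show "norm x = 1" using w0 by (simp add: x_def norm_divide)
    show "cinner x y = 0" if "y \<in> F" for y
      using orthogonal_remainder[OF assms(1,2) that] by (simp add: x_def w_def cinner_scaleC_left)
  qed
  moreover have "x \<notin> F"
  proof
    assume "x \<in> F"
    then have "cinner w x = 0" using orthogonal_remainder[OF assms(1,2)] by (simp add: w_def)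
    then have "cinner x x = 0" by (simp add: x_def cinner_scaleC_left)
    then show False using w0 by (simp add: x_def)
  qed
  ultimately show thesis using that by blast
qed

lemma orthonormal_extend:
  fixes F :: "'a::chilbert_space set"
  assumes "orthonormal F" "finite F" "enat (card F + n) \<le> ecdim (UNIV :: 'a set)"
  shows "\<exists>R. finite R \<and> card R = n \<and> R \<inter> F = {} \<and> orthonormal (F \<union> R)"
  using assms(3)
proof (induction n)
  case 0
  then show ?case using assms(1) by (intro exI[of _ "{}"]) simp
next
  case (Suc n)
  have "enat (card F + n) \<le> ecdim (UNIV :: 'a set)"
    by (rule order_trans[OF _ Suc.prems]) simp
  then obtain R where R: "finite R" "card R = n" "R \<inter> F = {}" "orthonormal (F \<union> R)"
    using Suc.IH by blast
  have "card (F \<union> R) = card F + n"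
    using R assms(2) by (subst card_Un_disjoint) auto
  then have "enat (card (F \<union> R)) < ecdim (UNIV :: 'a set)"
    by (intro order_less_le_trans[OF _ Suc.prems]) simp
  moreover have "finite (F \<union> R)" using R assms(2) by simp
  ultimately obtain x where x: "x \<notin> F \<union> R" "orthonormal (insert x (F \<union> R))"
    using orthonormal_extend_one[OF R(4)] by metis
  show ?case
    by (rule exI[of _ "insert x R"]) (use x R in auto)
qed

text \<open>By Zorn's lemma. Maximal families serve twice: they are infinite in an infinite-dimensional space,
  and they are orthonormal bases.\<close>

lemma maximal_orthonormal_exists:
  assumes "orthonormal F"
  obtains B where "F \<subseteq> B" "orthonormal B" "\<And>x. orthonormal (insert x B) \<Longrightarrow> x \<in> B"
proof -
  let ?A = "{B. F \<subseteq> B \<and> orthonormal B}"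
  have "\<exists>M\<in>?A. \<forall>X\<in>?A. M \<subseteq> X \<longrightarrow> X = M"
  proof (rule subset_Zorn_nonempty)
    show "?A \<noteq> {}" using assms by blast
    fix C assume C: "C \<noteq> {}" "subset.chain ?A C"
    have pair: "\<exists>Z\<in>C. e \<in> Z \<and> f \<in> Z" if ef: "e \<in> \<Union>C" "f \<in> \<Union>C" for e f
    proof -
      obtain X Y where XY: "X \<in> C" "Y \<in> C" "e \<in> X" "f \<in> Y" using ef by blast
      have "X \<subseteq> Y \<or> Y \<subseteq> X" using C(2)[unfolded subset_chain_def] XY(1,2) by blast
      then show ?thesis using XY by (metis subsetD)
    qed
    have on: "orthonormal Z" if "Z \<in> C" for Z
      using C(2) that by (auto simp: subset_chain_def)
    have "orthonormal (\<Union>C)"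
      unfolding orthonormal_def
    proof (intro ballI)
      fix e f assume "e \<in> \<Union>C" "f \<in> \<Union>C"
      then obtain Z where "Z \<in> C" "e \<in> Z" "f \<in> Z" using pair by metis
      then show "cinner e f = (if e = f then 1 else 0)"
        using orthonormalD[OF on] by metis
    qed
    moreover have "F \<subseteq> \<Union>C" using C by (fastforce simp: subset.chain_def)
    ultimately show "\<Union>C \<in> ?A" by blast
  qed
  then obtain M where M: "M \<in> ?A" "\<forall>X\<in>?A. M \<subseteq> X \<longrightarrow> X = M" by (elim bexE)
  show thesis
  proof (rule that)
    show "F \<subseteq> M" "orthonormal M" using M(1) by simp_all
    fix x assume "orthonormal (insert x M)"
    then have "insert x M = M" using M(1) by (intro M(2)[rule_format]) auto
    then show "x \<in> M" by (metis insertI1)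
  qed
qed

lemma infinite_orthonormal_sequence:
  fixes F :: "'a::chilbert_space set"
  assumes "ecdim (UNIV :: 'a set) = \<infinity>" "finite F" "orthonormal F"
  obtains e :: "nat \<Rightarrow> 'a" where "inj e" "range e \<inter> F = {}" "orthonormal (F \<union> range e)"
proof -
  obtain B where B: "F \<subseteq> B" "orthonormal B" "\<And>x. orthonormal (insert x B) \<Longrightarrow> x \<in> B"
    using maximal_orthonormal_exists[OF assms(3)] by metis
  have "infinite B"
  proof
    assume "finite B"
    then obtain x where "x \<notin> B" "orthonormal (insert x B)"
      using orthonormal_extend_one[OF B(2)] assms(1) by (metis enat_ord_code(4))
    then show False using B(3) by metis
  qed
  then have "infinite (B - F)" using assms(2) by simp
  then obtain e :: "nat \<Rightarrow> 'a" where e: "inj e" "range e \<subseteq> B - F"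
    using infinite_countable_subset by metis
  show thesis
  proof (rule that[OF e(1)])
    show "range e \<inter> F = {}" using e(2) by blast
    show "orthonormal (F \<union> range e)" by (rule orthonormal_subset[OF B(2)]) (use e(2) B(1) in blast)
  qed
qed

text \<open>Gram-Schmidt; a vector that already lies in the span is dropped.\<close>

lemma orthonormal_spanning_set:
  fixes F :: "'a::chilbert_space set"
  assumes "finite F"
  shows "\<exists>B. finite B \<and> orthonormal B \<and> F \<subseteq> cspan B"
  using assms
proof (induction F)
  case empty
  show ?case by (intro exI[of _ "{}"]) simp
next
  case (insert x F)
  then obtain B where B: "finite B" "orthonormal B" "F \<subseteq> cspan B" by blast
  define s where "s = (\<Sum>y\<in>B. cinner x y *\<^sub>C y)"
  define w where "w = x - s"
  have sB: "s \<in> cspan B" unfolding s_def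
    by (intro complex_vector.span_sum complex_vector.span_scale complex_vector.span_base)
  have wB: "cinner w y = 0" if "y \<in> B" for y
    unfolding w_def s_def by (rule orthogonal_remainder[OF B(2,1) that])
  show ?case
  proof (cases "w = 0")
    case True
    then have "x \<in> cspan B" using sB by (simp add: w_def)
    then show ?thesis using B by (intro exI[of _ B]) simp
  next
    case False
    define e where "e = complex_of_real (1 / norm w) *\<^sub>C w"
    have "orthonormal (insert e B)"
      using B(2) wB False by (intro orthonormal_insert) (simp_all add: e_def norm_divide cinner_scaleC_left)
    moreover have "cspan B \<subseteq> cspan (insert e B)" by (rule complex_vector.span_mono) blast
    moreover have "x \<in> cspan (insert e B)"
    proof -
      have "w = complex_of_real (norm w) *\<^sub>C e" using False by (simp add: e_def scaleC_simps)
      moreover have "e \<in> cspan (insert e B)" by (rule complex_vector.span_base) simp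
      ultimately have "w \<in> cspan (insert e B)" by (metis complex_vector.span_scale)
      moreover have "s \<in> cspan (insert e B)" using sB \<open>cspan B \<subseteq> cspan (insert e B)\<close> by blast
      ultimately have "w + s \<in> cspan (insert e B)" by (rule complex_vector.span_add)
      then show ?thesis by (simp add: w_def)
    qed
    ultimately show ?thesis using B by (intro exI[of _ "insert e B"]) auto
  qed
qed

lemma unit_vector_orthogonal_to_finite:
  fixes F :: "'a::chilbert_space set"
  assumes "ecdim (UNIV :: 'a set) = \<infinity>" "finite F"
  shows "\<exists>z. norm z = 1 \<and> (\<forall>x\<in>F. cinner x z = 0)"
proof -
  obtain B where B: "finite B" "orthonormal B" "F \<subseteq> cspan B" using orthonormal_spanning_set[OF assms(2)] by blast
  obtain z where z: "z \<notin> B" "orthonormal (insert z B)"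
    using orthonormal_extend_one[OF B(2,1)] assms(1) by (metis enat_ord_code(4))
  show ?thesis
  proof (intro exI[of _ z] conjI ballI)
    show "norm z = 1" using orthonormal_norm[OF z(2)] by simp
    fix x assume "x \<in> F"
    then have x: "x \<in> cspan B" using B(3) by blast
    have "cinner y z = 0" if "y \<in> B" for y using orthonormalD[OF z(2), of y z] z(1) that by auto
    then show "cinner x z = 0"
      by (subst orthonormal_expand[OF B(2,1) x]) (simp add: cinner_sum_left cinner_scaleC_left)
  qed
qed

section \<open>Rank one operators\<close>

text \<open>The operators \<open>y x\<^sup>* + x y\<^sup>*\<close> and \<open>x x\<^sup>*\<close>. The former is the polarization of the latter and,
  unlike \<open>y x\<^sup>*\<close>, is self-adjoint and real bilinear.\<close>

definition sdyad :: "'a::chilbert_space \<Rightarrow> 'a \<Rightarrow> 'a \<Rightarrow>\<^sub>L 'a" where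
  "sdyad x y = Blinfun (\<lambda>z. cinner z x *\<^sub>C y + cinner z y *\<^sub>C x)"

definition dyad :: "'a::chilbert_space \<Rightarrow> 'a \<Rightarrow>\<^sub>L 'a" where
  "dyad x = Blinfun (\<lambda>z. cinner z x *\<^sub>C x)"

lemma bounded_linear_ketbra: "bounded_linear (\<lambda>z. cinner z x *\<^sub>C (y::'a::chilbert_space))"
proof (rule bounded_linear_intro)
  show "norm (cinner z x *\<^sub>C y) \<le> norm z * (norm x * norm y)" for z
    using mult_right_mono[OF Cauchy_Schwarz[of z x], of "norm y"] by (simp add: mult.assoc)
qed (simp_all add: cinner_simps scaleC_add_left scaleR_scaleC scaleC_scaleC)

lemma dyad_apply [simp]: "dyad x \<cdot> z = cinner z x *\<^sub>C x"
  unfolding dyad_def by (simp add: bounded_linear_Blinfun_apply bounded_linear_ketbra)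

lemma sdyad_apply [simp]: "sdyad x y \<cdot> z = cinner z x *\<^sub>C y + cinner z y *\<^sub>C x"
  unfolding sdyad_def
  by (simp add: bounded_linear_Blinfun_apply bounded_linear_add bounded_linear_ketbra)

lemma self_adjoint_dyad [simp]: "self_adjoint (dyad x)"
  by (simp add: self_adjoint_iff cinner_simps cinner_commute[symmetric] mult.commute)

lemma self_adjoint_sdyad [simp]: "self_adjoint (sdyad x y)"
  by (simp add: self_adjoint_iff cinner_simps cinner_commute[symmetric] mult.commute)

lemma sdyad_commute: "sdyad x y = sdyad y x"
  by (rule blinfun_eqI) (simp add: add.commute)

lemma sdyad_add_right: "sdyad x (y + z) = sdyad x y + sdyad x z"
  by (rule blinfun_eqI) (simp add: blinfun.add_left cinner_simps scaleC_simps)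

lemma sdyad_diff_right: "sdyad x (y - z) = sdyad x y - sdyad x z"
  by (rule blinfun_eqI) (simp add: blinfun.diff_left cinner_simps scaleC_simps)

lemma sdyad_scaleR_right: "sdyad x (r *\<^sub>R y) = r *\<^sub>R sdyad x y"
  by (rule blinfun_eqI)
    (simp add: blinfun.scaleR_left cinner_simps scaleC_simps scaleR_scaleC mult.commute)

lemma sdyad_scaleC_shift: "sdyad (a *\<^sub>C x) y = sdyad x (cnj a *\<^sub>C y)"
  by (rule blinfun_eqI) (simp add: cinner_simps scaleC_simps mult.commute)

lemma sdyad_i_swap: "sdyad (\<i> *\<^sub>C x) y = - sdyad (\<i> *\<^sub>C y) x"
  by (rule blinfun_eqI) (simp add: blinfun.minus_left cinner_simps scaleC_simps mult.commute)

lemma sdyad_scaleC_left: "sdyad (a *\<^sub>C x) y = Re a *\<^sub>R sdyad x y + Im a *\<^sub>R sdyad (\<i> *\<^sub>C x) y"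
proof -
  have "a *\<^sub>C x = Re a *\<^sub>R x + Im a *\<^sub>R (\<i> *\<^sub>C x)"
    by (subst complex_eq[of a]) (simp add: scaleC_simps scaleR_scaleC mult.commute)
  then show ?thesis
    by (simp add: sdyad_commute[of _ y] sdyad_add_right sdyad_scaleR_right)
qed

lemma dyad_scaleC: "dyad (a *\<^sub>C x) = (cmod a)\<^sup>2 *\<^sub>R dyad x"
  by (rule blinfun_eqI)
    (simp add: blinfun.scaleR_left cinner_simps scaleC_simps scaleR_scaleC complex_norm_square mult.commute del: of_real_power)

lemma dyad_add: "dyad (x + y) = dyad x + dyad y + sdyad x y"
  by (rule blinfun_eqI) (simp add: blinfun.add_left cinner_simps scaleC_simps)

lemma dyad_diff: "dyad (x - y) = dyad x + dyad y - sdyad x y"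
  by (rule blinfun_eqI) (simp add: blinfun.add_left blinfun.diff_left cinner_simps scaleC_simps)

lemma dyad_eq_of_scale:
  assumes "norm u = 1" "norm u' = 1" "u = c *\<^sub>C u'"
  shows "dyad u = dyad u'"
proof -
  have "cmod c = 1" using assms by (metis mult.right_neutral norm_scaleC)
  then show ?thesis by (simp add: assms(3) dyad_scaleC)
qed

lemma dyad_eqD:
  assumes "norm u = 1" "dyad u = dyad u'"
  shows "u = cinner u u' *\<^sub>C u'"
proof -
  have "dyad u \<cdot> u = dyad u' \<cdot> u" by (simp only: assms(2))
  then show ?thesis using assms(1) by (simp add: norm_eq_1_iff_cinner scaleC_one)
qed

text \<open>Up to phases, \<open>u\<close> and \<open>v\<close> are the eigenvectors of \<open>u u\<^sup>* - v v\<^sup>*\<close> for the eigenvalues \<open>1\<close> and \<open>-1\<close>.\<close>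

lemma dyad_difference_unique:
  assumes n: "norm u = 1" "norm v = 1" "cinner u v = 0" "norm u' = 1" "norm v' = 1" "cinner u' v' = 0"
    and eq: "dyad u - dyad v = dyad u' - dyad v'"
  shows "dyad u = dyad u'" and "dyad v = dyad v'"
proof -
  have "(dyad u - dyad v) \<cdot> u = (dyad u' - dyad v') \<cdot> u" by (simp only: eq)
  then have e: "u = cinner u u' *\<^sub>C u' - cinner u v' *\<^sub>C v'"
    using n by (simp add: blinfun.diff_left norm_eq_1_iff_cinner scaleC_one)
  have "cinner u v' = cinner (cinner u u' *\<^sub>C u' - cinner u v' *\<^sub>C v') v'" using e by simp
  also have "\<dots> = - cinner u v'" using n by (simp add: cinner_simps norm_eq_1_iff_cinner)
  finally have "cinner u v' = 0" by (simp add: equal_neg_zero)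
  then show "dyad u = dyad u'" using e n by (intro dyad_eq_of_scale[of u u' "cinner u u'"]) auto
  then show "dyad v = dyad v'" using eq by simp
qed

lemma commuting_dyads:
  assumes n: "norm u = 1" "norm u' = 1"
    and c: "\<And>w. dyad u \<cdot> (dyad u' \<cdot> w) = dyad u' \<cdot> (dyad u \<cdot> w)"
  shows "cinner u u' = 0 \<or> dyad u = dyad u'"
proof (rule disjCI)
  assume ne: "dyad u \<noteq> dyad u'"
  have "cinner u' u *\<^sub>C u = cinner u' u *\<^sub>C (cinner u u' *\<^sub>C u')"
    using c[of u'] n by (simp add: norm_eq_1_iff_cinner scaleC_one cinner_simps scaleC_simps)
  moreover have "u \<noteq> cinner u u' *\<^sub>C u'" using dyad_eq_of_scale[OF n] ne by blast
  ultimately have "cinner u' u = 0" by (metis complex_vector.scale_left_imp_eq)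
  then show "cinner u u' = 0" by (simp add: cinner_sym_0[of u])
qed

text \<open>Rotating an orthonormal pair by \<open>45\<close> degrees turns the off-diagonal Pauli matrix of its plane into
  a diagonal one.\<close>

lemma rotated_pair:
  fixes u v :: "'a::chilbert_space"
  assumes "norm u = 1" "norm v = 1" "cinner u v = 0"
  defines "s \<equiv> 1 / sqrt 2"
  shows "norm (s *\<^sub>R (u + v)) = 1" "norm (s *\<^sub>R (u - v)) = 1"
    "cinner (s *\<^sub>R (u + v)) (s *\<^sub>R (u - v)) = 0"
    "dyad (s *\<^sub>R (u + v)) + dyad (s *\<^sub>R (u - v)) = dyad u + dyad v"
    "dyad (s *\<^sub>R (u + v)) - dyad (s *\<^sub>R (u - v)) = sdyad u v"
proof -
  have ss: "s * s = 1 / 2" by (simp add: s_def)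
  have uv: "cinner u u = 1" "cinner v v = 1" "cinner v u = 0"
    using assms(1-3) by (simp_all add: norm_eq_1_iff_cinner cinner_sym_0[of v])
  have sc: "complex_of_real s * complex_of_real s = 1 / 2" unfolding of_real_mult[symmetric] ss by simp
  show "norm (s *\<^sub>R (u + v)) = 1" "norm (s *\<^sub>R (u - v)) = 1"
    "cinner (s *\<^sub>R (u + v)) (s *\<^sub>R (u - v)) = 0"
    unfolding norm_eq_1_iff_cinner using sc uv assms(3)
    by (simp_all add: cinner_simps mult_ac)
  have d: "dyad (s *\<^sub>R x) = (1/2) *\<^sub>R dyad x" for x :: 'a
    unfolding scaleR_scaleC dyad_scaleC by (simp add: power2_eq_square ss flip: of_real_mult)
  show "dyad (s *\<^sub>R (u + v)) + dyad (s *\<^sub>R (u - v)) = dyad u + dyad v"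
    unfolding d by (simp add: dyad_add dyad_diff algebra_simps flip: scaleR_add_left)
  have "dyad (s *\<^sub>R (u + v)) - dyad (s *\<^sub>R (u - v)) = (1/2) *\<^sub>R (2 *\<^sub>R sdyad u v)"
    unfolding d scaleR_diff_right[symmetric] by (simp add: dyad_add dyad_diff scaleR_2)
  then show "dyad (s *\<^sub>R (u + v)) - dyad (s *\<^sub>R (u - v)) = sdyad u v" by simp
qed

text \<open>A rotation by another angle, chosen with rational coefficients: the difference of the rotated pair is
  \<open>3/5\<close> of the diagonal and \<open>4/5\<close> of the off-diagonal Pauli matrix. It yields the relation between
  these two.\<close>

lemma rotated_pair5:
  fixes u v :: "'a::chilbert_space"
  assumes "norm u = 1" "norm v = 1" "cinner u v = 0"
  defines "s \<equiv> 1 / sqrt 5"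
  shows "norm (s *\<^sub>R (2 *\<^sub>R u + v)) = 1" "norm (s *\<^sub>R (u - 2 *\<^sub>R v)) = 1"
    "cinner (s *\<^sub>R (2 *\<^sub>R u + v)) (s *\<^sub>R (u - 2 *\<^sub>R v)) = 0"
    "dyad (s *\<^sub>R (2 *\<^sub>R u + v)) + dyad (s *\<^sub>R (u - 2 *\<^sub>R v)) = dyad u + dyad v"
    "5 *\<^sub>R (dyad (s *\<^sub>R (2 *\<^sub>R u + v)) - dyad (s *\<^sub>R (u - 2 *\<^sub>R v)))
      = 3 *\<^sub>R (dyad u - dyad v) + 4 *\<^sub>R sdyad u v"
proof -
  have ss: "s * s = 1 / 5" by (simp add: s_def)
  have uv: "cinner u u = 1" "cinner v v = 1" "cinner v u = 0"
    using assms(1-3) by (simp_all add: norm_eq_1_iff_cinner cinner_sym_0[of v])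
  have sc: "complex_of_real s * complex_of_real s = 1 / 5" unfolding of_real_mult[symmetric] ss by simp
  show "norm (s *\<^sub>R (2 *\<^sub>R u + v)) = 1" "norm (s *\<^sub>R (u - 2 *\<^sub>R v)) = 1"
    "cinner (s *\<^sub>R (2 *\<^sub>R u + v)) (s *\<^sub>R (u - 2 *\<^sub>R v)) = 0"
    unfolding norm_eq_1_iff_cinner using sc uv assms(3)
    by (simp_all add: cinner_simps mult_ac)
  have d: "dyad (r *\<^sub>R x) = (r * r) *\<^sub>R dyad x" for r and x :: 'a
    unfolding scaleR_scaleC dyad_scaleC by (simp add: power2_eq_square)
  have e: "dyad (2 *\<^sub>R u + v) = 4 *\<^sub>R dyad u + dyad v + 2 *\<^sub>R sdyad u v"
    "dyad (u - 2 *\<^sub>R v) = dyad u + 4 *\<^sub>R dyad v - 2 *\<^sub>R sdyad u v"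
    by (simp_all add: dyad_add dyad_diff d sdyad_commute[of "2 *\<^sub>R u"] sdyad_scaleR_right sdyad_commute[of v])
  have five: "5 *\<^sub>R A = 4 *\<^sub>R A + A" for A :: "'a \<Rightarrow>\<^sub>L 'a"
    using scaleR_add_left[of 4 1 A] by simp
  have "5 *\<^sub>R (dyad (s *\<^sub>R (2 *\<^sub>R u + v)) + dyad (s *\<^sub>R (u - 2 *\<^sub>R v))) = 5 *\<^sub>R (dyad u + dyad v)"
    unfolding d ss scaleR_add_right[symmetric] e scaleR_scaleR
    by (simp add: five scaleR_add_right)
  then show "dyad (s *\<^sub>R (2 *\<^sub>R u + v)) + dyad (s *\<^sub>R (u - 2 *\<^sub>R v)) = dyad u + dyad v"
    by (simp only: scaleR_cancel_left) simp
  show "5 *\<^sub>R (dyad (s *\<^sub>R (2 *\<^sub>R u + v)) - dyad (s *\<^sub>R (u - 2 *\<^sub>R v)))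
      = 3 *\<^sub>R (dyad u - dyad v) + 4 *\<^sub>R sdyad u v"
    unfolding d ss scaleR_diff_right[symmetric] e scaleR_scaleR
    using scaleR_add_left[of 3 1 "dyad u"] scaleR_add_left[of 3 1 "dyad v"] scaleR_add_left[of 2 2 "sdyad u v"]
    by (simp add: scaleR_add_right scaleR_diff_right)
qed

text \<open>The third Pauli matrix only changes its sign under the rotation by \<open>45\<close> degrees.\<close>

lemma sdyad_rotated:
  fixes u v :: "'a::chilbert_space"
  defines "s \<equiv> 1 / sqrt 2"
  shows "sdyad (\<i> *\<^sub>C (s *\<^sub>R (u + v))) (s *\<^sub>R (u - v)) = - sdyad (\<i> *\<^sub>C u) v"
proof -
  have ss: "s * s = 1 / 2" by (simp add: s_def)
  have self: "sdyad (\<i> *\<^sub>C x) x = 0" for x :: 'a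
    by (rule blinfun_eqI) (simp add: cinner_simps scaleC_simps)
  have i: "\<i> *\<^sub>C (s *\<^sub>R (u + v)) = s *\<^sub>R (\<i> *\<^sub>C u + \<i> *\<^sub>C v)"
    by (simp add: scaleR_scaleC scaleC_simps mult.commute)
  have "sdyad (\<i> *\<^sub>C (s *\<^sub>R (u + v))) (s *\<^sub>R (u - v)) = (s * s) *\<^sub>R sdyad (\<i> *\<^sub>C u + \<i> *\<^sub>C v) (u - v)"
    unfolding i by (simp add: sdyad_scaleR_right sdyad_commute[of "s *\<^sub>R (\<i> *\<^sub>C u + \<i> *\<^sub>C v)"] sdyad_commute[of "u - v"])
  also have "sdyad (\<i> *\<^sub>C u + \<i> *\<^sub>C v) (u - v) = sdyad (\<i> *\<^sub>C v) u - sdyad (\<i> *\<^sub>C u) v"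
    by (simp only: sdyad_diff_right sdyad_commute[of "\<i> *\<^sub>C u + \<i> *\<^sub>C v"] sdyad_add_right)
      (simp add: sdyad_commute[of u] sdyad_commute[of v] self)
  also have "\<dots> = - (2 *\<^sub>R sdyad (\<i> *\<^sub>C u) v)"
    by (simp add: sdyad_i_swap[of v] scaleR_2)
  finally show ?thesis by (simp add: ss)
qed

section \<open>Self-adjoint operators of finite rank\<close>

lemma range_sdyad: "range (blinfun_apply (sdyad x y)) \<subseteq> cspan {x, y}"
proof (rule image_subsetI)
  fix z
  have "x \<in> cspan {x, y}" "y \<in> cspan {x, y}"
    by (rule complex_vector.span_base; blast)+
  then have "cinner z x *\<^sub>C y + cinner z y *\<^sub>C x \<in> cspan {x, y}"
    by (intro complex_vector.span_add complex_vector.span_scale)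
  then show "sdyad x y \<cdot> z \<in> cspan {x, y}" by (simp only: sdyad_apply)
qed

lemma range_dyad: "range (blinfun_apply (dyad x)) \<subseteq> cspan {x}"
proof (rule image_subsetI)
  fix z
  have "cinner z x *\<^sub>C x \<in> cspan {x}"
    by (intro complex_vector.span_scale complex_vector.span_base) blast
  then show "dyad x \<cdot> z \<in> cspan {x}" by (simp only: dyad_apply)
qed

lemma fin_rank_sa_iff:
  "A \<in> fin_rank_sa \<longleftrightarrow> self_adjoint A \<and> (\<exists>B. finite B \<and> range (blinfun_apply A) \<subseteq> cspan B)"
  by (simp only: fin_rank_sa_def ecdim_finite_iff mem_Collect_eq)

lemma fin_rank_saI: "self_adjoint A \<Longrightarrow> finite B \<Longrightarrow> range (blinfun_apply A) \<subseteq> cspan B \<Longrightarrow> A \<in> fin_rank_sa"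
  by (metis fin_rank_sa_iff)

lemma fin_rank_saE:
  assumes "A \<in> fin_rank_sa"
  obtains B where "self_adjoint A" "finite B" "range (blinfun_apply A) \<subseteq> cspan B"
proof -
  obtain B where "finite B" "range (blinfun_apply A) \<subseteq> cspan B"
    using assms unfolding fin_rank_sa_iff by (elim conjE exE)
  moreover have "self_adjoint A" using assms unfolding fin_rank_sa_iff by (elim conjE)
  ultimately show thesis by (intro that)
qed

lemma dyad_fin_rank_sa [simp]: "dyad x \<in> fin_rank_sa"
  by (rule fin_rank_saI[of _ "{x}"]) (use range_dyad in auto)

lemma sdyad_fin_rank_sa [simp]: "sdyad x y \<in> fin_rank_sa"
  by (rule fin_rank_saI[of _ "{x, y}"]) (use range_sdyad in auto)

lemma fin_rank_sa_0 [simp]: "0 \<in> fin_rank_sa"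
  by (rule fin_rank_saI[of _ "{}"]) auto

lemma fin_rank_sa_add [simp]:
  assumes "A \<in> fin_rank_sa" "B \<in> fin_rank_sa"
  shows "A + B \<in> fin_rank_sa"
proof -
  obtain S T where s: "self_adjoint A" "finite S" "range (blinfun_apply A) \<subseteq> cspan S"
    and t: "self_adjoint B" "finite T" "range (blinfun_apply B) \<subseteq> cspan T"
    using assms by (elim fin_rank_saE)
  have "cspan S \<subseteq> cspan (S \<union> T)" "cspan T \<subseteq> cspan (S \<union> T)"
    by (auto intro!: complex_vector.span_mono)
  then have "range (blinfun_apply (A + B)) \<subseteq> cspan (S \<union> T)"
    using s t by (auto simp: blinfun.add_left intro!: complex_vector.span_add)
  then show ?thesis using s t by (intro fin_rank_saI[of _ "S \<union> T"] self_adjoint_add) auto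
qed

lemma fin_rank_sa_scaleR [simp]:
  assumes "A \<in> fin_rank_sa"
  shows "r *\<^sub>R A \<in> fin_rank_sa"
  using assms
  by (elim fin_rank_saE, intro fin_rank_saI)
    (auto simp: self_adjoint_scaleR blinfun.scaleR_left scaleR_scaleC intro!: complex_vector.span_scale)

lemma fin_rank_sa_uminus [simp]: "A \<in> fin_rank_sa \<Longrightarrow> - A \<in> fin_rank_sa"
  using fin_rank_sa_scaleR[of A "-1"] by simp

lemma fin_rank_sa_diff [simp]: "A \<in> fin_rank_sa \<Longrightarrow> B \<in> fin_rank_sa \<Longrightarrow> A - B \<in> fin_rank_sa"
  using fin_rank_sa_add[of A "-B"] by simp

lemma fin_rank_sa_sum: "(\<And>i. i \<in> I \<Longrightarrow> f i \<in> fin_rank_sa) \<Longrightarrow> (\<Sum>i\<in>I. f i) \<in> fin_rank_sa"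
  by (induction I rule: infinite_finite_induct) simp_all

lemma fin_rank_sa_self_adjoint: "A \<in> fin_rank_sa \<Longrightarrow> self_adjoint A"
  by (simp add: fin_rank_sa_def)

lemma fin_rank_sa_sum_dyads: "(\<Sum>x\<in>X. a x *\<^sub>R dyad x) \<in> fin_rank_sa"
  by (rule fin_rank_sa_sum) simp

lemma sum_dyads_apply:
  "(\<Sum>x\<in>X. a x *\<^sub>R dyad x) \<cdot> z = (\<Sum>x\<in>X. (complex_of_real (a x) * cinner z x) *\<^sub>C x)"
  by (simp add: blinfun.sum_left blinfun.scaleR_left scaleR_scaleC scaleC_scaleC)

lemma sum_dyads_eigen:
  assumes "orthonormal X" "finite X" "x \<in> X"
  shows "(\<Sum>x\<in>X. a x *\<^sub>R dyad x) \<cdot> x = complex_of_real (a x) *\<^sub>C x"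
proof -
  have "(\<Sum>x\<in>X. a x *\<^sub>R dyad x) \<cdot> x = (\<Sum>y\<in>X. if y = x then complex_of_real (a x) *\<^sub>C x else 0)"
    unfolding sum_dyads_apply using assms by (intro sum.cong) (auto simp: orthonormal_def)
  then show ?thesis using assms by simp
qed

lemma sum_dyads_range: "finite X \<Longrightarrow> (\<Sum>x\<in>X. a x *\<^sub>R dyad x) \<cdot> z \<in> cspan X"
  unfolding sum_dyads_apply
  by (intro complex_vector.span_sum complex_vector.span_scale complex_vector.span_base)

section \<open>Spectral decomposition\<close>

text \<open>Horner's scheme for \<open>p(A) w\<close>.\<close>

definition op_poly :: "('a::chilbert_space \<Rightarrow>\<^sub>L 'a) \<Rightarrow> 'a \<Rightarrow> complex poly \<Rightarrow> 'a" where
  "op_poly A w p = fold_coeffs (\<lambda>c s. c *\<^sub>C w + A \<cdot> s) p 0"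

lemma op_poly_0 [simp]: "op_poly A w 0 = 0"
  by (simp add: op_poly_def)

lemma op_poly_pCons [simp]: "op_poly A w (pCons c p) = c *\<^sub>C w + A \<cdot> op_poly A w p"
proof (cases "p = 0")
  case True
  then show ?thesis by (cases "c = 0") (simp_all add: op_poly_def)
qed (simp add: op_poly_def)

lemma op_poly_add: "op_poly A w (p + q) = op_poly A w p + op_poly A w q"
  by (induction p q rule: poly_induct2) (simp_all add: blinfun.add_right scaleC_simps)

lemma op_poly_smult: "self_adjoint A \<Longrightarrow> op_poly A w (smult c p) = c *\<^sub>C op_poly A w p"
  by (induction p) (simp_all add: blinfun.add_right scaleC_simps self_adjoint_scaleC)

lemma op_poly_monom: "self_adjoint A \<Longrightarrow> op_poly A w (monom c n) = c *\<^sub>C (blinfun_apply A ^^ n) w"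
  by (induction n) (simp_all add: monom_0 monom_Suc self_adjoint_scaleC)

lemma op_poly_sum: "op_poly A w (\<Sum>i\<in>I. f i) = (\<Sum>i\<in>I. op_poly A w (f i))"
  by (induction I rule: infinite_finite_induct) (simp_all add: op_poly_add)

lemma op_poly_range: "op_poly A (A \<cdot> v) p \<in> range (blinfun_apply A)" if "self_adjoint A"
proof (induction p)
  case (pCons c p)
  have "op_poly A (A \<cdot> v) (pCons c p) = A \<cdot> (c *\<^sub>C v + op_poly A (A \<cdot> v) p)"
    using that by (simp add: blinfun.add_right self_adjoint_scaleC)
  then show ?case by simp
qed (metis blinfun.zero_right op_poly_0 rangeI)

text \<open>A polynomial of least degree that annihilates a vector \<open>A v \<noteq> 0\<close> exists by finite rank; splitting
  off a root \<open>z\<close> of it exhibits an eigenvector in the range of \<open>A\<close>. Symmetry makes \<open>z\<close> real and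
  excludes \<open>z = 0\<close>, because kernel and range are orthogonal.\<close>

lemma eigenvector_exists:
  fixes A :: "'a::chilbert_space \<Rightarrow>\<^sub>L 'a"
  assumes A: "A \<in> fin_rank_sa" "A \<noteq> 0"
  shows "\<exists>u r. norm u = 1 \<and> r \<noteq> 0 \<and> A \<cdot> u = complex_of_real r *\<^sub>C u"
proof -
  obtain B where sa: "self_adjoint A" and B: "finite B" "range (blinfun_apply A) \<subseteq> cspan B"
    using A(1) by (elim fin_rank_saE)
  obtain v where v: "A \<cdot> v \<noteq> 0" using A(2) by (metis blinfun_eqI blinfun.zero_left)
  define w where "w = A \<cdot> v"
  have "\<exists>c. (\<Sum>i\<le>card B. c i *\<^sub>C (blinfun_apply A ^^ i) w) = 0 \<and> \<not> (\<forall>i\<in>{..card B}. c i = 0)"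
  proof (rule ccontr)
    assume no: "\<not> ?thesis"
    have "card {..card B} \<le> card B"
    proof (rule complex_vector.card_le_of_independent_family)
      show "(\<lambda>i. (blinfun_apply A ^^ i) w) ` {..card B} \<subseteq> cspan B"
      proof (rule image_subsetI)
        fix i
        have "(blinfun_apply A ^^ i) w \<in> range (blinfun_apply A)"
          by (cases i) (auto simp: w_def)
        then show "(blinfun_apply A ^^ i) w \<in> cspan B" using B(2) by blast
      qed
    qed (use B(1) no in auto)
    then show False by simp
  qed
  then obtain c i where c: "(\<Sum>i\<le>card B. c i *\<^sub>C (blinfun_apply A ^^ i) w) = 0" "i \<le> card B" "c i \<noteq> 0"
    by auto
  define p0 where "p0 = (\<Sum>i\<le>card B. monom (c i) i)"
  have "coeff p0 i = c i" using c(2) by (simp add: p0_def coeff_sum)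
  then have "p0 \<noteq> 0" using c(3) by auto
  moreover have "op_poly A w p0 = 0"
    using c(1) sa by (simp add: p0_def op_poly_sum op_poly_monom)
  ultimately have "\<exists>p. (p \<noteq> 0 \<and> op_poly A w p = 0) \<and> (\<forall>q. q \<noteq> 0 \<and> op_poly A w q = 0 \<longrightarrow> degree p \<le> degree q)"
    using ex_has_least_nat[of "\<lambda>p. p \<noteq> 0 \<and> op_poly A w p = 0" p0 degree] by blast
  then obtain p where p: "p \<noteq> 0" "op_poly A w p = 0"
    and min: "\<And>q. q \<noteq> 0 \<Longrightarrow> op_poly A w q = 0 \<Longrightarrow> degree p \<le> degree q" by blast
  have "degree p \<noteq> 0"
  proof
    assume "degree p = 0"
    then obtain a where "p = [:a:]" by (meson degree_eq_zeroE)
    then show False using p v by (simp add: w_def)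
  qed
  then obtain z where "poly p z = 0" using fundamental_theorem_of_algebra[of p] by (auto simp: constant_degree)
  then obtain q where q: "p = [:-z, 1:] * q" by (metis dvdE poly_eq_0_iff_dvd)
  have q0: "q \<noteq> 0" using p(1) q by auto
  have "degree p = Suc (degree q)" unfolding q using q0 by (subst degree_mult_eq) auto
  then have u0: "op_poly A w q \<noteq> 0" using min[OF q0] by auto
  define u where "u = op_poly A w q"
  have pq: "p = pCons 0 q + smult (-z) q" by (simp add: q)
  have Au: "A \<cdot> u = z *\<^sub>C u"
    using p(2) sa by (simp add: pq op_poly_add op_poly_smult u_def del: smult_minus_left)
  have uu: "cinner u u \<noteq> 0" using u0 by (simp add: u_def)
  have "z * cinner u u = cinner (A \<cdot> u) u" by (simp add: Au cinner_simps)
  also have "\<dots> = cinner u (A \<cdot> u)" by (rule self_adjointD[OF sa])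
  also have "\<dots> = cnj z * cinner u u" by (simp only: Au cinner_scaleC_right)
  finally have "z = cnj z" using uu by (metis mult_right_cancel)
  then have zr: "z = complex_of_real (Re z)" by (simp add: complex_eq_iff)
  have "z \<noteq> 0"
  proof
    assume z0: "z = 0"
    obtain s where s: "u = A \<cdot> s" using op_poly_range[OF sa, of v q] by (auto simp: u_def w_def)
    have "cinner u u = cinner s (A \<cdot> u)" by (subst s) (simp add: self_adjointD[OF sa])
    then show False using uu Au z0 by simp
  qed
  define e where "e = complex_of_real (1 / norm u) *\<^sub>C u"
  have "norm e = 1" using u0 by (simp add: e_def u_def norm_divide)
  moreover have "A \<cdot> e = complex_of_real (Re z) *\<^sub>C e"
    unfolding e_def zr[symmetric] by (simp add: self_adjoint_scaleC[OF sa] Au scaleC_simps mult.commute)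
  moreover have "Re z \<noteq> 0" using \<open>z \<noteq> 0\<close> zr by auto
  ultimately show ?thesis by blast
qed

text \<open>Take a largest orthonormal set of eigenvectors with nonzero eigenvalues. If the remainder of \<open>A\<close>
  were not zero, then an eigenvector of it could be added to the set.\<close>

theorem spectral_decomposition:
  fixes A :: "'a::chilbert_space \<Rightarrow>\<^sub>L 'a"
  assumes A: "A \<in> fin_rank_sa"
  obtains X a where "finite X" "orthonormal X" "\<And>x. x \<in> X \<Longrightarrow> a x \<noteq> 0" "A = (\<Sum>x\<in>X. a x *\<^sub>R dyad x)"
proof -
  obtain B where B: "finite B" "range (blinfun_apply A) \<subseteq> cspan B"
    using A by (elim fin_rank_saE)
  define good where
    "good X \<longleftrightarrow> orthonormal X \<and> (\<forall>x\<in>X. \<exists>r. r \<noteq> 0 \<and> A \<cdot> x = complex_of_real r *\<^sub>C x)" for X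
  have bnd: "finite X \<and> card X \<le> card B" if g: "good X" for X
  proof (rule orthonormal_finite_of_span[OF _ _ B(1)])
    show "orthonormal X" using g by (simp add: good_def)
    show "X \<subseteq> cspan B"
    proof
      fix x assume "x \<in> X"
      then obtain r where r: "r \<noteq> 0" "A \<cdot> x = complex_of_real r *\<^sub>C x"
        using g unfolding good_def by blast
      then have "x = complex_of_real (1/r) *\<^sub>C A \<cdot> x" by (simp add: scaleC_simps)
      moreover have "A \<cdot> x \<in> cspan B" using B(2) by blast
      ultimately show "x \<in> cspan B" by (metis complex_vector.span_scale)
    qed
  qed
  have "good {}" by (simp add: good_def)
  then obtain X where gX: "good X" and max: "\<And>Y. good Y \<Longrightarrow> card Y \<le> card X"
    using ex_has_greatest_nat[of good "{}" card "Suc (card B)"] bnd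
    by (metis le_imp_less_Suc)
  then obtain a where a: "\<And>x. x \<in> X \<Longrightarrow> a x \<noteq> 0" "\<And>x. x \<in> X \<Longrightarrow> A \<cdot> x = complex_of_real (a x) *\<^sub>C x"
    unfolding good_def by metis
  have X: "finite X" "orthonormal X" using gX bnd by (auto simp: good_def)
  define S where "S = (\<Sum>x\<in>X. a x *\<^sub>R dyad x)"
  have S: "S \<in> fin_rank_sa" unfolding S_def by (rule fin_rank_sa_sum_dyads)
  have "A - S = 0"
  proof (rule ccontr)
    assume ne: "A - S \<noteq> 0"
    have AS: "A - S \<in> fin_rank_sa" using A S by simp
    obtain u r where u: "norm u = 1" "r \<noteq> 0" "(A - S) \<cdot> u = complex_of_real r *\<^sub>C u"
      using eigenvector_exists[OF AS ne] by blast
    have ort: "cinner u x = 0" if "x \<in> X" for x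
    proof -
      have "complex_of_real r * cinner u x = cinner ((A - S) \<cdot> u) x"
        by (simp add: u(3) cinner_simps)
      also have "\<dots> = cinner u ((A - S) \<cdot> x)"
        by (rule self_adjointD[OF fin_rank_sa_self_adjoint[OF AS]])
      also have "(A - S) \<cdot> x = 0"
        using a(2)[OF that] sum_dyads_eigen[OF X(2,1) that, of a] by (simp add: blinfun.diff_left S_def)
      finally show ?thesis using u(2) by simp
    qed
    have "S \<cdot> u = 0" unfolding S_def sum_dyads_apply using ort by simp
    then have "A \<cdot> u = complex_of_real r *\<^sub>C u" using u(3) by (simp add: blinfun.diff_left)
    moreover have "orthonormal (insert u X)" using X(2) u(1) ort by (intro orthonormal_insert)
    ultimately have "good (insert u X)" using gX u(2) unfolding good_def by blast
    then have "card (insert u X) \<le> card X" by (rule max)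
    moreover have "u \<notin> X" using ort[of u] u(1) by (auto simp: norm_eq_1_iff_cinner)
    ultimately show False using X(1) by simp
  qed
  then show thesis using that[of X a] X a(1) S_def by simp
qed

lemma sum_dyads_in_projections:
  assumes "finite X" "orthonormal X"
  shows "(\<Sum>x\<in>X. dyad x) \<in> projections (card X)"
proof -
  let ?P = "\<Sum>x\<in>X. dyad x"
  have sa: "self_adjoint ?P" by (simp add: self_adjoint_sum)
  have ap: "?P \<cdot> z = (\<Sum>x\<in>X. cinner z x *\<^sub>C x)" for z
    by (simp add: blinfun.sum_left)
  have id: "?P \<cdot> z = z" if "z \<in> cspan X" for z
    using orthonormal_expand[OF assms(2,1) that] by (simp add: ap)
  have rg: "?P \<cdot> z \<in> cspan X" for z
    unfolding ap by (intro complex_vector.span_sum complex_vector.span_scale complex_vector.span_base)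
  have "range (blinfun_apply ?P) = cspan X" using id rg by (metis rangeI image_subsetI subsetI subset_antisym)
  moreover have "ecdim (cspan X) = enat (card X)"
    using orthonormal_cdim_span[OF assms(2,1)] assms(1) by (auto simp: ecdim_def)
  moreover have "?P o\<^sub>L ?P = ?P" using id rg by (intro blinfun_eqI) simp
  ultimately show ?thesis using sa by (simp add: projections_def)
qed

lemma projections_fin_rank_sa: "P \<in> projections k \<Longrightarrow> P \<in> fin_rank_sa"
  by (simp add: projections_def fin_rank_sa_def)

lemma projections_idem: "P \<in> projections k \<Longrightarrow> P \<cdot> (P \<cdot> x) = P \<cdot> x"
  unfolding projections_def by (metis (mono_tags, lifting) blinfun_apply_blinfun_compose mem_Collect_eq)

lemma projections_self_adjoint: "P \<in> projections k \<Longrightarrow> self_adjoint P"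
  by (simp add: projections_def)

lemma projections_decomposition:
  assumes "P \<in> projections m"
  obtains X where "finite X" "orthonormal X" "card X = m" "P = (\<Sum>x\<in>X. dyad x)"
proof -
  obtain X a where X: "finite X" "orthonormal X" "\<And>x. x \<in> X \<Longrightarrow> a x \<noteq> 0" "P = (\<Sum>x\<in>X. a x *\<^sub>R dyad x)"
    using spectral_decomposition[OF projections_fin_rank_sa[OF assms]] by metis
  have "a x = 1" if x: "x \<in> X" for x
  proof -
    have e: "P \<cdot> x = complex_of_real (a x) *\<^sub>C x"
      using sum_dyads_eigen[OF X(2,1) x] X(4) by simp
    have "complex_of_real (a x) *\<^sub>C complex_of_real (a x) *\<^sub>C x = complex_of_real (a x) *\<^sub>C x"
      using projections_idem[OF assms, of x]
      unfolding e self_adjoint_scaleC[OF projections_self_adjoint[OF assms]] .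
    then have "(complex_of_real (a x) * complex_of_real (a x) - complex_of_real (a x)) *\<^sub>C x = 0"
      by (simp add: scaleC_simps)
    moreover have "x \<noteq> 0" using orthonormal_norm[OF X(2) x] by auto
    ultimately have "complex_of_real (a x * a x - a x) = 0"
      by (simp add: complex_vector.scale_eq_0_iff)
    then show ?thesis using X(3)[OF x] by (simp only: of_real_eq_0_iff) simp
  qed
  then have P: "P = (\<Sum>x\<in>X. dyad x)" using X(4) by simp
  have "P \<in> projections (card X)" using sum_dyads_in_projections[OF X(1,2)] P by simp
  then have "card X = m" using assms by (simp add: projections_def)
  then show thesis using that X P by blast
qed

text \<open>\<open>\<langle>(P + Q) v, v\<rangle> = \<parallel>P v\<parallel>\<^sup>2 + \<parallel>Q v\<parallel>\<^sup>2\<close>.\<close>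

lemma projection_sum_eq_0:
  assumes "P \<in> projections m" "Q \<in> projections m" "(P + Q) \<cdot> v = 0"
  shows "P \<cdot> v = 0"
proof -
  have q: "cinner (R \<cdot> v) v = complex_of_real ((norm (R \<cdot> v))\<^sup>2)" if "R \<in> projections m" for R
  proof -
    have "cinner (R \<cdot> v) v = cinner (R \<cdot> (R \<cdot> v)) v"
      by (simp add: projections_idem[OF that])
    also have "\<dots> = cinner (R \<cdot> v) (R \<cdot> v)"
      by (rule self_adjointD[OF projections_self_adjoint[OF that]])
    finally show ?thesis by (simp add: cinner_self)
  qed
  have "0 = cinner (P \<cdot> v) v + cinner (Q \<cdot> v) v"
    using assms(3) by (metis blinfun.add_left cinner_add_left cinner_zero_left)
  then have "0 = (norm (P \<cdot> v))\<^sup>2 + (norm (Q \<cdot> v))\<^sup>2"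
    unfolding q[OF assms(1)] q[OF assms(2)] by (metis of_real_add of_real_eq_0_iff)
  then show ?thesis by (simp add: sum_power2_eq_zero_iff[symmetric] add_nonneg_eq_0_iff)
qed

lemma self_adjoint_range_subset:
  assumes A: "self_adjoint A" and Z: "finite Z" "orthonormal Z"
    and ker: "\<And>v. (\<And>z. z \<in> Z \<Longrightarrow> cinner v z = 0) \<Longrightarrow> A \<cdot> v = 0"
  shows "range (blinfun_apply A) \<subseteq> cspan Z"
proof (rule image_subsetI)
  fix y
  let ?s = "\<Sum>z\<in>Z. cinner (A \<cdot> y) z *\<^sub>C z"
  define w where "w = A \<cdot> y - ?s"
  have wz: "cinner w z = 0" if "z \<in> Z" for z
    unfolding w_def by (rule orthogonal_remainder[OF Z(2,1) that])
  then have "cinner w ?s = 0" by (simp add: cinner_sum_right cinner_scaleC_right)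
  then have "cinner w w = cinner w (A \<cdot> y)"
    by (subst (2) w_def) (simp add: cinner_diff_right)
  also have "\<dots> = cinner (A \<cdot> w) y" by (simp add: self_adjointD[OF A])
  also have "\<dots> = 0" using ker[OF wz] by simp
  finally have "A \<cdot> y = ?s" by (simp add: w_def)
  then show "A \<cdot> y \<in> cspan Z"
    by (metis (no_types, lifting) complex_vector.span_base complex_vector.span_scale complex_vector.span_sum)
qed

section \<open>The real dimension of the space of self-adjoint operators\<close>

text \<open>The usual real basis of the Hermitian matrices with respect to \<open>e\<^sub>0, e\<^sub>1, \<dots>\<close>, up to scaling: real parts
  are indexed by \<open>i \<le> j\<close> and imaginary parts by \<open>i > j\<close>, which makes \<open>d\<^sup>2\<close> indices for \<open>d\<close> vectors.\<close>

definition herm_unit :: "(nat \<Rightarrow> 'a::chilbert_space) \<Rightarrow> nat \<times> nat \<Rightarrow> 'a \<Rightarrow>\<^sub>L 'a" where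
  "herm_unit e = (\<lambda>(i, j). if i \<le> j then sdyad (e i) (e j) else sdyad (\<i> *\<^sub>C e i) (e j))"

text \<open>The matrix entries \<open>a\<^sub>i\<^sub>j\<close> are paired with \<open>a\<^sub>j\<^sub>i\<close>, their conjugates, which gives \<open>2 A\<close> as a real
  combination.\<close>

lemma hermitian_span:
  fixes e :: "nat \<Rightarrow> 'a::chilbert_space"
  assumes e: "\<And>i j. i < d \<Longrightarrow> j < d \<Longrightarrow> cinner (e i) (e j) = (if i = j then 1 else 0)"
    and A: "self_adjoint A" "range (blinfun_apply A) \<subseteq> cspan (e ` {..<d})"
  shows "A \<in> span (herm_unit e ` ({..<d} \<times> {..<d}))"
proof -
  let ?T = "herm_unit e ` ({..<d} \<times> {..<d})"
  have inj: "inj_on e {..<d}" using e by (intro inj_onI) (metis lessThan_iff zero_neq_one)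
  have on: "orthonormal (e ` {..<d})" unfolding orthonormal_def
    using e inj by (auto simp: inj_on_eq_iff)
  have ex: "z = (\<Sum>i<d. cinner z (e i) *\<^sub>C e i)" if "z \<in> cspan (e ` {..<d})" for z
    using orthonormal_expand[OF on _ that] by (simp add: sum.reindex[OF inj])
  define a where "a i j = cinner (A \<cdot> e i) (e j)" for i j
  have cnj_a: "cnj (a i j) = a j i" for i j
    unfolding a_def by (metis cinner_commute self_adjointD[OF A(1)])
  have app: "A \<cdot> z = (\<Sum>j<d. \<Sum>i<d. (a i j * cinner z (e i)) *\<^sub>C e j)" for z
  proof -
    have "cinner (A \<cdot> z) (e j) = (\<Sum>i<d. a i j * cinner z (e i))" if "j < d" for j
    proof -
      have "cinner (A \<cdot> z) (e j) = cinner z (A \<cdot> e j)"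
        by (rule self_adjointD[OF A(1)])
      also have "A \<cdot> e j = (\<Sum>i<d. a j i *\<^sub>C e i)"
        unfolding a_def using A(2) by (intro ex) blast
      also have "cinner z \<dots> = (\<Sum>i<d. a i j * cinner z (e i))"
        by (simp add: cinner_sum_right cinner_scaleC_right cnj_a)
      finally show ?thesis .
    qed
    moreover have "A \<cdot> z = (\<Sum>j<d. cinner (A \<cdot> z) (e j) *\<^sub>C e j)"
      using A(2) by (intro ex) blast
    ultimately show ?thesis by (simp add: complex_vector.scale_sum_left)
  qed
  have "2 *\<^sub>R A = (\<Sum>i<d. \<Sum>j<d. sdyad (cnj (a i j) *\<^sub>C e i) (e j))"
  proof (rule blinfun_eqI)
    fix z
    have "(\<Sum>i<d. \<Sum>j<d. sdyad (cnj (a i j) *\<^sub>C e i) (e j)) \<cdot> z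
      = (\<Sum>i<d. \<Sum>j<d. (a i j * cinner z (e i)) *\<^sub>C e j) + (\<Sum>i<d. \<Sum>j<d. (a j i * cinner z (e j)) *\<^sub>C e i)"
      by (simp add: blinfun.sum_left sum.distrib cinner_simps scaleC_simps cnj_a mult.commute)
    also have "(\<Sum>i<d. \<Sum>j<d. (a i j * cinner z (e i)) *\<^sub>C e j) = A \<cdot> z"
      unfolding app by (rule sum.swap)
    also have "(\<Sum>i<d. \<Sum>j<d. (a j i * cinner z (e j)) *\<^sub>C e i) = A \<cdot> z"
      unfolding app by simp
    finally show "(2 *\<^sub>R A) \<cdot> z = (\<Sum>i<d. \<Sum>j<d. sdyad (cnj (a i j) *\<^sub>C e i) (e j)) \<cdot> z"
      by (simp add: blinfun.add_left scaleR_2)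
  qed
  moreover have "sdyad (c *\<^sub>C e i) (e j) \<in> span ?T" if "i < d" "j < d" for c i j
  proof -
    have h: "herm_unit e (i, j) \<in> span ?T" "herm_unit e (j, i) \<in> span ?T"
      using that by (auto intro!: span_base)
    have "sdyad (e i) (e j) \<in> span ?T"
      using h by (cases "i \<le> j") (auto simp: herm_unit_def sdyad_commute[of "e i"] split: if_splits)
    moreover have "sdyad (\<i> *\<^sub>C e i) (e j) \<in> span ?T"
    proof (cases i j rule: linorder_cases)
      case less
      then show ?thesis using h(2) by (simp add: herm_unit_def sdyad_i_swap[of "e i"] span_neg)
    next
      case equal
      then have "sdyad (\<i> *\<^sub>C e i) (e j) = 0"
        by (intro blinfun_eqI) (simp add: cinner_simps scaleC_simps)
      then show ?thesis by (simp add: span_zero)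
    next
      case greater
      then show ?thesis using h(1) by (simp add: herm_unit_def)
    qed
    ultimately show ?thesis by (subst sdyad_scaleC_left) (intro span_add span_scale)
  qed
  ultimately have "2 *\<^sub>R A \<in> span ?T" by (auto intro!: span_sum)
  then have "(1/2) *\<^sub>R 2 *\<^sub>R A \<in> span ?T" by (rule span_scale)
  then show ?thesis by simp
qed

lemma hermitian_space_finite_span:
  fixes Y :: "'a::chilbert_space set"
  assumes "finite Y" "orthonormal Y"
  obtains T where "finite T" "card T \<le> card Y * card Y"
    "\<And>A. self_adjoint A \<Longrightarrow> range (blinfun_apply A) \<subseteq> cspan Y \<Longrightarrow> A \<in> span T"
proof -
  obtain e where e: "bij_betw e {..<card Y} Y"
    using ex_bij_betw_nat_finite[OF assms(1)] by (auto simp: atLeast0LessThan)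
  then have Y: "Y = e ` {..<card Y}" and inj: "inj_on e {..<card Y}"
    by (auto simp: bij_betw_def)
  let ?T = "herm_unit e ` ({..<card Y} \<times> {..<card Y})"
  have on: "cinner (e i) (e j) = (if i = j then 1 else 0)" if "i < card Y" "j < card Y" for i j
  proof -
    have "e i \<in> Y" "e j \<in> Y" using Y that by blast+
    then show ?thesis using orthonormalD[OF assms(2)] inj that by (simp add: inj_on_eq_iff)
  qed
  show thesis
  proof (rule that[of ?T])
    show "card ?T \<le> card Y * card Y"
      by (rule order_trans[OF card_image_le]) (auto simp: card_cartesian_product)
    show "A \<in> span ?T" if "self_adjoint A" "range (blinfun_apply A) \<subseteq> cspan Y" for A
      using hermitian_span[of "card Y" e A] on that Y by auto
  qed simp
qed

section \<open>The Jordan product\<close>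

text \<open>Without the customary factor \<open>1/2\<close>.\<close>

definition acomm :: "('a::real_normed_vector \<Rightarrow>\<^sub>L 'a) \<Rightarrow> ('a \<Rightarrow>\<^sub>L 'a) \<Rightarrow> 'a \<Rightarrow>\<^sub>L 'a" where
  "acomm A B = (A o\<^sub>L B) + (B o\<^sub>L A)"

lemma acomm_apply: "acomm A B \<cdot> x = A \<cdot> (B \<cdot> x) + B \<cdot> (A \<cdot> x)"
  by (simp add: acomm_def blinfun.add_left)

lemma acomm_commute: "acomm A B = acomm B A"
  by (simp add: acomm_def add.commute)

lemma acomm_add_left: "acomm (A + B) C = acomm A C + acomm B C"
  by (rule blinfun_eqI) (simp add: acomm_apply blinfun.add_left blinfun.add_right)

lemma acomm_diff_left: "acomm (A - B) C = acomm A C - acomm B C"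
  by (rule blinfun_eqI) (simp add: acomm_apply blinfun.diff_left blinfun.diff_right)

lemma acomm_scaleR_left: "acomm (r *\<^sub>R A) C = r *\<^sub>R acomm A C"
  by (rule blinfun_eqI) (simp add: acomm_apply blinfun.scaleR_left blinfun.scaleR_right scaleR_add_right)

lemma acomm_minus_left: "acomm (- A) C = - acomm A C"
  using acomm_scaleR_left[of "-1" A C] by simp

lemma acomm_add_right: "acomm C (A + B) = acomm C A + acomm C B"
  by (simp add: acomm_commute[of C] acomm_add_left)

lemma acomm_diff_right: "acomm C (A - B) = acomm C A - acomm C B"
  by (simp add: acomm_commute[of C] acomm_diff_left)

lemma acomm_scaleR_right: "acomm C (r *\<^sub>R A) = r *\<^sub>R acomm C A"
  by (simp add: acomm_commute[of C] acomm_scaleR_left)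

lemma acomm_minus_right: "acomm C (- A) = - acomm C A"
  by (simp add: acomm_commute[of C] acomm_minus_left)

lemma acomm_0_left [simp]: "acomm 0 C = 0"
  using acomm_diff_left[of 0 0 C] by simp

lemma acomm_0_right [simp]: "acomm C 0 = 0"
  by (simp add: acomm_commute[of C])

lemma acomm_sum_right: "acomm C (\<Sum>i\<in>I. f i) = (\<Sum>i\<in>I. acomm C (f i))"
  by (induction I rule: infinite_finite_induct) (simp_all add: acomm_add_right)

lemmas acomm_simps = acomm_add_left acomm_diff_left acomm_scaleR_left acomm_add_right
  acomm_diff_right acomm_scaleR_right

lemma acomm_0_apply: "acomm A B = 0 \<Longrightarrow> A \<cdot> (B \<cdot> v) = - B \<cdot> (A \<cdot> v)"
  using acomm_apply[of A B v] by (simp add: add_eq_0_iff)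

lemma acomm_square_apply:
  assumes "acomm A A = acomm B B"
  shows "A \<cdot> (A \<cdot> v) = B \<cdot> ((B :: 'c::real_normed_vector \<Rightarrow>\<^sub>L 'c) \<cdot> v)"
proof -
  have "2 *\<^sub>R A \<cdot> (A \<cdot> v) = 2 *\<^sub>R B \<cdot> (B \<cdot> v)"
    using arg_cong[OF assms, of "\<lambda>C. C \<cdot> v"] by (simp add: acomm_apply scaleR_2)
  then show ?thesis by simp
qed

lemma self_adjoint_square_zero:
  assumes "self_adjoint A" "acomm A A = 0"
  shows "A = 0"
proof (rule blinfun_eqI)
  fix x
  have "2 *\<^sub>R A \<cdot> (A \<cdot> x) = 0"
    using arg_cong[OF assms(2), of "\<lambda>B. B \<cdot> x"] by (simp add: acomm_apply scaleR_2)
  then have "cinner x (A \<cdot> (A \<cdot> x)) = 0" by simp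
  then have "cinner (A \<cdot> x) (A \<cdot> x) = 0"
    by (simp add: self_adjointD[OF assms(1)])
  then show "A \<cdot> x = 0 \<cdot> x" by simp
qed

lemma projections_acomm: "P \<in> projections k \<Longrightarrow> acomm P P = P + P"
  by (rule blinfun_eqI) (simp add: acomm_apply blinfun.add_left projections_idem)

text \<open>The operators \<open>D\<^sup>2 X\<^sub>n\<close> are self-adjoint, live on the finite-dimensional range of \<open>D\<close>, and
  anticommute pairwise. Anticommuting self-adjoint operators different from zero are linearly
  independent, so only finitely many of them are nonzero.\<close>

lemma finitely_many_anticommuting_overlaps:
  fixes D :: "'a::chilbert_space \<Rightarrow>\<^sub>L 'a"
  assumes D: "D \<in> fin_rank_sa" and X: "\<And>n. self_adjoint (X n)"
    and DX: "\<And>n. n \<in> J \<Longrightarrow> acomm D (X n) = 0"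
    and XX: "\<And>i j. i \<in> J \<Longrightarrow> j \<in> J \<Longrightarrow> i \<noteq> j \<Longrightarrow> acomm (X i) (X j) = 0"
  shows "finite {n \<in> J. D o\<^sub>L X n \<noteq> 0}"
proof -
  have saD: "self_adjoint D" using D by (rule fin_rank_sa_self_adjoint)
  obtain Z a where Z: "finite Z" "orthonormal Z" "D = (\<Sum>z\<in>Z. a z *\<^sub>R dyad z)"
    using spectral_decomposition[OF D] by metis
  obtain T where T: "finite T"
    "\<And>A. self_adjoint A \<Longrightarrow> range (blinfun_apply A) \<subseteq> cspan Z \<Longrightarrow> A \<in> span T"
    using hermitian_space_finite_span[OF Z(1,2)] by metis
  define Y where "Y n = D o\<^sub>L D o\<^sub>L X n" for n
  have Yap: "Y n \<cdot> v = D \<cdot> (D \<cdot> (X n \<cdot> v))" for n v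
    by (simp add: Y_def)
  have swap: "X n \<cdot> (D \<cdot> v) = - D \<cdot> (X n \<cdot> v)" if "n \<in> J" for n v
    using arg_cong[OF DX[OF that], of "\<lambda>B. B \<cdot> v"] by (simp add: acomm_apply add_eq_0_iff)
  have saY: "self_adjoint (Y n)" if "n \<in> J" for n
    unfolding self_adjoint_iff Yap
    by (simp add: self_adjointD[OF saD] self_adjointD[OF X] swap[OF that] blinfun.minus_right)
  have YY: "acomm (Y i) (Y j) = 0" if ij: "i \<in> J" "j \<in> J" "i \<noteq> j" for i j
  proof (rule blinfun_eqI)
    fix v
    let ?D = "blinfun_apply D"
    have "(acomm (Y i) (Y j)) \<cdot> v = ?D (?D (?D (?D ((acomm (X i) (X j)) \<cdot> v))))"
      by (simp add: acomm_apply Yap swap ij blinfun.minus_right blinfun.add_right)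
    then show "(acomm (Y i) (Y j)) \<cdot> v = 0 \<cdot> v" by (simp add: XX[OF ij] blinfun.zero_right)
  qed
  have Y0: "D o\<^sub>L X n = 0" if "Y n = 0" for n
  proof (rule blinfun_eqI)
    fix v
    let ?w = "D \<cdot> (X n \<cdot> v)"
    have "cinner ?w ?w = cinner (X n \<cdot> v) (Y n \<cdot> v)"
      by (simp add: Yap self_adjointD[OF saD])
    then have "cinner ?w ?w = 0" by (simp add: that)
    then show "(D o\<^sub>L X n) \<cdot> v = 0 \<cdot> v" by simp
  qed
  have le: "card I \<le> card T" if I: "finite I" "I \<subseteq> {n \<in> J. D o\<^sub>L X n \<noteq> 0}" for I
  proof (rule card_le_of_independent_family[OF I(1) T(1), of Y])
    show "Y ` I \<subseteq> span T"
    proof (rule image_subsetI)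
      fix n assume "n \<in> I"
      then have "n \<in> J" using I(2) by blast
      moreover have "range (blinfun_apply (Y n)) \<subseteq> cspan Z"
        unfolding Yap Z(3) using sum_dyads_range[OF Z(1)] by blast
      ultimately show "Y n \<in> span T" using saY by (intro T(2))
    qed
    fix c assume c: "(\<Sum>i\<in>I. c i *\<^sub>R Y i) = 0"
    show "\<forall>i\<in>I. c i = 0"
    proof
      fix j assume j: "j \<in> I"
      have "0 = acomm (Y j) (\<Sum>i\<in>I. c i *\<^sub>R Y i)" by (simp add: c)
      also have "\<dots> = (\<Sum>i\<in>I. c i *\<^sub>R acomm (Y j) (Y i))"
        by (simp add: acomm_sum_right acomm_scaleR_right)
      also have "\<dots> = (\<Sum>i\<in>{j}. c i *\<^sub>R acomm (Y j) (Y i))"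
        using I j YY by (intro sum.mono_neutral_right) auto
      finally have "c j = 0 \<or> acomm (Y j) (Y j) = 0" by simp
      moreover have "acomm (Y j) (Y j) \<noteq> 0"
      proof
        assume "acomm (Y j) (Y j) = 0"
        moreover have "j \<in> J" using I j by blast
        ultimately have "Y j = 0" using self_adjoint_square_zero saY by metis
        then show False using Y0[of j] I(2) j by blast
      qed
      ultimately show "c j = 0" by blast
    qed
  qed
  show ?thesis
  proof (rule ccontr)
    assume "infinite {n \<in> J. D o\<^sub>L X n \<noteq> 0}"
    from infinite_arbitrarily_large[OF this, of "Suc (card T)"]
    obtain I where I: "finite I" "card I = Suc (card T)" "I \<subseteq> {n \<in> J. D o\<^sub>L X n \<noteq> 0}"
      by (elim exE conjE)
    show False using le[OF I(1,3)] I(2) by simp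
  qed
qed

text \<open>Greedy choice: finitely many chosen indices exclude only finitely many others.\<close>

lemma conflict_free_subset:
  fixes P :: "nat \<Rightarrow> nat \<Rightarrow> bool"
  assumes fin: "\<And>n. finite {l. P n l}" and sym: "\<And>i j. P i j \<Longrightarrow> P j i"
  shows "\<exists>S. finite S \<and> card S = Suc r \<and> 0 \<in> S \<and> (\<forall>i\<in>S. \<forall>j\<in>S. i \<noteq> j \<longrightarrow> \<not> P i j)"
proof (induction r)
  case 0
  show ?case by (intro exI[of _ "{0}"]) simp
next
  case (Suc r)
  then obtain S where S: "finite S" "card S = Suc r" "0 \<in> S" "\<forall>i\<in>S. \<forall>j\<in>S. i \<noteq> j \<longrightarrow> \<not> P i j"
    by blast
  have "finite (S \<union> (\<Union>n\<in>S. {l. P n l}))" using S(1) fin by simp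
  then obtain l where l: "l \<notin> S \<union> (\<Union>n\<in>S. {l. P n l})" using ex_new_if_finite infinite_UNIV_nat by metis
  then have "\<not> P i l" "\<not> P l i" if "i \<in> S" for i using that sym by blast+
  then show ?case using S l by (intro exI[of _ "insert l S"]) auto
qed

section \<open>Maps that send rank k projections to rank m projections\<close>

text \<open>The hypotheses on \<open>L\<close> that both parts of the theorem share.\<close>

locale projection_map =
  fixes L :: "('a::chilbert_space \<Rightarrow>\<^sub>L 'a) \<Rightarrow> ('b::chilbert_space \<Rightarrow>\<^sub>L 'b)" and k m :: nat
  assumes k_pos: "0 < k" and m_pos: "0 < m" and k_less: "enat k < ecdim (UNIV :: 'a set)"
    and L_fin: "L ` fin_rank_sa \<subseteq> fin_rank_sa"
    and L_add: "A \<in> fin_rank_sa \<Longrightarrow> B \<in> fin_rank_sa \<Longrightarrow> L (A + B) = L A + L B"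
    and L_scaleR: "A \<in> fin_rank_sa \<Longrightarrow> L (c *\<^sub>R A) = c *\<^sub>R L A"
    and L_proj: "L ` projections k \<subseteq> projections m"
    and L_inj: "inj_on L (projections k)"
begin

lemma L_fin_rank [simp]: "A \<in> fin_rank_sa \<Longrightarrow> L A \<in> fin_rank_sa"
  using L_fin by blast

lemma L_self_adjoint: "A \<in> fin_rank_sa \<Longrightarrow> self_adjoint (L A)"
  by (simp add: fin_rank_sa_self_adjoint)

lemma L_0 [simp]: "L 0 = 0"
  using L_scaleR[of 0 0] by simp

lemma L_uminus: "A \<in> fin_rank_sa \<Longrightarrow> L (- A) = - L A"
  using L_scaleR[of A "-1"] by simp

lemma L_diff: "A \<in> fin_rank_sa \<Longrightarrow> B \<in> fin_rank_sa \<Longrightarrow> L (A - B) = L A - L B"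
  using L_add[of A "-B"] L_uminus[of B] by simp

lemma L_sum: "(\<And>i. i \<in> I \<Longrightarrow> f i \<in> fin_rank_sa) \<Longrightarrow> L (\<Sum>i\<in>I. f i) = (\<Sum>i\<in>I. L (f i))"
proof (induction I rule: infinite_finite_induct)
  case (insert x F)
  then have "(\<Sum>i\<in>F. f i) \<in> fin_rank_sa" by (intro fin_rank_sa_sum) auto
  then show ?case using insert by (simp add: L_add)
qed simp_all

lemma L_sum_dyads: "L (\<Sum>x\<in>X. dyad x) = (\<Sum>x\<in>X. L (dyad x))"
  by (rule L_sum) simp

lemma L_sum_scaled_dyads: "L (\<Sum>x\<in>X. a x *\<^sub>R dyad x) = (\<Sum>x\<in>X. a x *\<^sub>R L (dyad x))"
  by (subst L_sum) (simp_all add: L_scaleR)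

lemma frame_projection:
  assumes "finite X" "orthonormal X" "card X = k"
  shows "(\<Sum>x\<in>X. L (dyad x)) \<in> projections m"
  using L_proj sum_dyads_in_projections[OF assms(1,2)] assms(3) unfolding L_sum_dyads[symmetric] by blast

lemma L_dyad_neq:
  assumes "orthonormal {x, y}" "x \<noteq> y"
  shows "L (dyad x) \<noteq> L (dyad y)"
proof
  assume eq: "L (dyad x) = L (dyad y)"
  have "enat (Suc k) \<le> ecdim (UNIV :: 'a set)" using k_less Suc_ile_eq by blast
  moreover have "card {x, y} + (k - 1) = Suc k" using k_pos assms(2) by simp
  ultimately obtain R where R: "finite R" "card R = k - 1" "R \<inter> {x, y} = {}" "orthonormal ({x, y} \<union> R)"
    using orthonormal_extend[OF assms(1), of "k - 1"] by auto
  have on: "orthonormal (insert x R)" "orthonormal (insert y R)"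
    by (rule orthonormal_subset[OF R(4)]; auto)+
  have c: "card (insert x R) = k" "card (insert y R) = k" using R k_pos by auto
  have nR: "x \<notin> R" "y \<notin> R" using R(3) by blast+
  have "(\<Sum>z\<in>insert x R. dyad z) = (\<Sum>z\<in>insert y R. dyad z)"
  proof (rule inj_onD[OF L_inj])
    show "L (\<Sum>z\<in>insert x R. dyad z) = L (\<Sum>z\<in>insert y R. dyad z)"
      unfolding L_sum_dyads using R(1) nR eq by simp
    show "(\<Sum>z\<in>insert x R. dyad z) \<in> projections k"
      by (rule sum_dyads_in_projections[OF _ on(1), unfolded c(1)]) (simp add: R(1))
    show "(\<Sum>z\<in>insert y R. dyad z) \<in> projections k"
      by (rule sum_dyads_in_projections[OF _ on(2), unfolded c(2)]) (simp add: R(1))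
  qed
  then have "dyad x = dyad y" using R(1) nR by simp
  then have "dyad x \<cdot> x = dyad y \<cdot> x" by simp
  then have "x = 0" using assms by (simp add: orthonormal_def scaleC_one split: if_splits)
  then show False using orthonormal_norm[OF assms(1), of x] by simp
qed

text \<open>Four projections whose images share a \<open>(k - 2)\<close>-dimensional part give four idempotents
  \<open>b + a\<^sub>i + a\<^sub>j\<close> (\<open>i \<in> {1, 2}\<close>, \<open>j \<in> {3, 4}\<close>); the mixed second difference of the identities
  \<open>p\<^sup>2 = p\<close> leaves only the Jordan product of \<open>a\<^sub>1 - a\<^sub>2\<close> and \<open>a\<^sub>3 - a\<^sub>4\<close>.\<close>

lemma acomm_disjoint_pairs:
  assumes on: "orthonormal {x1, x2, x3, x4}" and c4: "card {x1, x2, x3, x4} = 4"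
    and k2: "2 \<le> k" and dim: "enat (k + 2) \<le> ecdim (UNIV :: 'a set)"
  shows "acomm (L (dyad x1) - L (dyad x2)) (L (dyad x3) - L (dyad x4)) = 0"
proof -
  have "card {x1, x2, x3, x4} + (k - 2) = k + 2" using k2 c4 by simp
  then obtain R where R: "finite R" "card R = k - 2" "R \<inter> {x1, x2, x3, x4} = {}"
    "orthonormal ({x1, x2, x3, x4} \<union> R)"
    using orthonormal_extend[OF on, of "k - 2"] dim by auto
  define B where "B = (\<Sum>x\<in>R. L (dyad x))"
  have ne: "x1 \<noteq> x2" "x1 \<noteq> x3" "x1 \<noteq> x4" "x2 \<noteq> x3" "x2 \<noteq> x4" "x3 \<noteq> x4"
    using c4 by (auto simp: card_insert_if split: if_splits)
  have p: "acomm (B + (L (dyad x) + L (dyad y))) (B + (L (dyad x) + L (dyad y)))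
      = (B + (L (dyad x) + L (dyad y))) + (B + (L (dyad x) + L (dyad y)))"
    if "x \<in> {x1, x2, x3, x4}" "y \<in> {x1, x2, x3, x4}" "x \<noteq> y" for x y
  proof -
    have "(\<Sum>z\<in>insert x (insert y R). L (dyad z)) \<in> projections m"
    proof (rule frame_projection)
      show "orthonormal (insert x (insert y R))"
        by (rule orthonormal_subset[OF R(4)]) (use that in auto)
      have "x \<notin> R" "y \<notin> R" using R(3) that by blast+
      then show "card (insert x (insert y R)) = k" using R(1,2) that(3) k2 by simp
    qed (use R in simp)
    moreover have "x \<notin> R" "y \<notin> R" using R(3) that by blast+
    ultimately have "B + (L (dyad x) + L (dyad y)) \<in> projections m"
      using R(1) that(3) by (simp add: B_def add.commute add.left_commute)
    then show ?thesis by (rule projections_acomm)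
  qed
  have "2 *\<^sub>R acomm (L (dyad x1) - L (dyad x2)) (L (dyad x3) - L (dyad x4))
    = acomm (B + (L (dyad x1) + L (dyad x3))) (B + (L (dyad x1) + L (dyad x3)))
      - acomm (B + (L (dyad x1) + L (dyad x4))) (B + (L (dyad x1) + L (dyad x4)))
      - acomm (B + (L (dyad x2) + L (dyad x3))) (B + (L (dyad x2) + L (dyad x3)))
      + acomm (B + (L (dyad x2) + L (dyad x4))) (B + (L (dyad x2) + L (dyad x4)))"
    by (simp only: acomm_simps scaleR_2) (simp add: acomm_commute algebra_simps)
  also have "\<dots> = 0" using ne by (simp add: p)
  finally show ?thesis by simp
qed

section \<open>The inequality between the ranks\<close>

text \<open>Write a trace zero operator as \<open>\<Sum> a\<^sub>x (x x\<^sup>* - e e\<^sup>*)\<close> with a vector \<open>e\<close> in its kernel.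
  The images \<open>d\<^sub>x\<close> of the summands have Jordan products \<open>d\<^sub>x \<circ> d\<^sub>y\<close> that do not depend
  on \<open>y \<noteq> x\<close>, so multiplying \<open>\<Sum> a\<^sub>x d\<^sub>x = 0\<close> by \<open>d\<^sub>x\<close> forces \<open>d\<^sub>x \<circ> d\<^sub>y = d\<^sub>x \<circ> d\<^sub>x\<close>, whence
  \<open>(d\<^sub>x - d\<^sub>y)\<^sup>2 = 0\<close>, which injectivity forbids.\<close>

lemma traceless_kernel_trivial:
  assumes k2: "2 \<le> k" and dim: "enat (k + 2) \<le> ecdim (UNIV :: 'a set)"
    and X: "finite X" "orthonormal (insert e X)" "e \<notin> X" "\<And>x. x \<in> X \<Longrightarrow> a x \<noteq> 0"
    and tr: "(\<Sum>x\<in>X. a x) = 0" and ker: "L (\<Sum>x\<in>X. a x *\<^sub>R dyad x) = 0"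
  shows "X = {}"
proof (rule ccontr)
  assume "X \<noteq> {}"
  then obtain i where i: "i \<in> X" by blast
  define d where "d x = L (dyad x) - L (dyad e)" for x
  have "X \<noteq> {i}" using tr X(4)[OF i] by auto
  then obtain j where j: "j \<in> X" "j \<noteq> i" using i by blast
  have LA: "(\<Sum>x\<in>X. a x *\<^sub>R d x) = 0"
  proof -
    have "(\<Sum>x\<in>X. a x *\<^sub>R d x) = L (\<Sum>x\<in>X. a x *\<^sub>R dyad x) - (\<Sum>x\<in>X. a x) *\<^sub>R L (dyad e)"
      by (simp add: d_def scaleR_diff_right sum_subtractf scaleR_sum_left L_sum_scaled_dyads)
    then show ?thesis using tr ker by simp
  qed
  have key: "acomm (d p) (d q) = acomm (d p) (d p)" if pq: "p \<in> X" "q \<in> X" "p \<noteq> q" for p q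
  proof -
    have const: "acomm (d p) (d l) = acomm (d p) (d q)" if l: "l \<in> X - {p}" for l
    proof (cases "l = q")
      case False
      have "acomm (L (dyad p) - L (dyad e)) (L (dyad l) - L (dyad q)) = 0"
      proof (rule acomm_disjoint_pairs[OF _ _ k2 dim])
        show "orthonormal {p, e, l, q}" by (rule orthonormal_subset[OF X(2)]) (use pq l in auto)
        show "card {p, e, l, q} = 4" using pq l X(3) False by (auto simp: card_insert_if)
      qed
      then show ?thesis by (simp add: d_def acomm_diff_right)
    qed simp
    have "0 = acomm (d p) (\<Sum>x\<in>X. a x *\<^sub>R d x)" by (simp add: LA)
    also have "\<dots> = (\<Sum>x\<in>X. a x *\<^sub>R acomm (d p) (d x))"
      by (simp add: acomm_sum_right acomm_scaleR_right)
    also have "\<dots> = a p *\<^sub>R acomm (d p) (d p) + (\<Sum>x\<in>X - {p}. a x *\<^sub>R acomm (d p) (d x))"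
      by (rule sum.remove[OF X(1) pq(1)])
    also have "(\<Sum>x\<in>X - {p}. a x *\<^sub>R acomm (d p) (d x)) = (\<Sum>x\<in>X - {p}. a x) *\<^sub>R acomm (d p) (d q)"
      using const by (simp add: scaleR_sum_left)
    also have "(\<Sum>x\<in>X - {p}. a x) = - a p" using sum.remove[OF X(1) pq(1), of a] tr by simp
    finally show ?thesis using X(4)[OF pq(1)] by simp
  qed
  have "acomm (d i - d j) (d i - d j) = 0"
    using key[OF i j(1)] key[OF j(1) i] j(2) by (simp add: acomm_simps acomm_commute[of "d j" "d i"])
  moreover have "self_adjoint (d i - d j)"
    unfolding d_def by (intro self_adjoint_diff L_self_adjoint) simp_all
  ultimately have "d i - d j = 0" by (rule self_adjoint_square_zero[rotated])
  then have "L (dyad i) = L (dyad j)" by (simp add: d_def)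
  moreover have "orthonormal {i, j}" by (rule orthonormal_subset[OF X(2)]) (use i j in auto)
  ultimately show False using L_dyad_neq j(2) by metis
qed

text \<open>Let \<open>N\<close> be the sum over the whole frame. Half of \<open>Q\<close>, completed by \<open>x\<close> or by \<open>x'\<close>, gives two
  projections with the difference in question. Each of them has a complementary projection such that
  the sum of the two is \<open>N\<close>, so its range is contained in the range of \<open>N\<close>.\<close>

lemma range_difference_subset:
  assumes Q: "finite Q" "card Q = 2 * (k - 1)" "x \<notin> Q" "x' \<notin> Q" "x \<noteq> x'"
    and on: "orthonormal (insert x (insert x' Q))"
    and Z: "finite Z" "orthonormal Z"
    and ker: "\<And>v. (\<And>z. z \<in> Z \<Longrightarrow> cinner v z = 0) \<Longrightarrow>
      (\<Sum>y\<in>insert x (insert x' Q). L (dyad y)) \<cdot> v = 0"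
  shows "range (blinfun_apply (L (dyad x) - L (dyad x'))) \<subseteq> cspan Z"
proof -
  obtain Q1 where Q1: "Q1 \<subseteq> Q" "card Q1 = k - 1" "finite Q1"
    using obtain_subset_with_card_n[of "k - 1" Q] Q(2) by auto
  define Q2 where "Q2 = Q - Q1"
  have Q2: "Q2 \<subseteq> Q" "card Q2 = k - 1" "finite Q2" "Q1 \<inter> Q2 = {}" "Q = Q1 \<union> Q2"
    using Q1 Q by (auto simp: Q2_def card_Diff_subset)
  have sQ: "(\<Sum>y\<in>Q. L (dyad y)) = (\<Sum>y\<in>Q1. L (dyad y)) + (\<Sum>y\<in>Q2. L (dyad y))"
    unfolding Q2(5) by (rule sum.union_disjoint[OF Q1(3) Q2(3,4)])
  let ?p = "\<lambda>y T. \<Sum>y\<in>insert y T. L (dyad y)"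
  have proj: "?p y T \<in> projections m" if "y \<in> {x, x'}" "T \<subseteq> Q" "card T = k - 1" "finite T" for y T
  proof (rule frame_projection)
    show "orthonormal (insert y T)" by (rule orthonormal_subset[OF on]) (use that in auto)
    have "y \<notin> T" using that Q(3,4) by auto
    then show "card (insert y T) = k" using that k_pos by simp
  qed (use that in simp)
  have nQ: "x \<notin> Q1" "x' \<notin> Q1" "x \<notin> Q2" "x' \<notin> Q2" using Q Q1 Q2 by auto
  have sub: "range (blinfun_apply (?p y Q1)) \<subseteq> cspan Z" if "y \<in> {x, x'}" for y
  proof -
    define y' where "y' = (if y = x then x' else x)"
    have y': "y' \<in> {x, x'}" "{y, y'} = {x, x'}" using that by (auto simp: y'_def)
    have s: "?p y Q1 + ?p y' Q2 = (\<Sum>y\<in>insert x (insert x' Q). L (dyad y))"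
      using y' that Q nQ Q1 Q2(3) by (auto simp: sQ doubleton_eq_iff algebra_simps)
    show ?thesis
    proof (rule self_adjoint_range_subset[OF _ Z])
      show "self_adjoint (?p y Q1)" using proj[OF that Q1] projections_self_adjoint by blast
      fix v assume "\<And>z. z \<in> Z \<Longrightarrow> cinner v z = 0"
      then have "(?p y Q1 + ?p y' Q2) \<cdot> v = 0" unfolding s by (rule ker)
      then show "(?p y Q1) \<cdot> v = 0"
        by (rule projection_sum_eq_0[OF proj[OF that Q1] proj[OF y'(1) Q2(1-3)]])
    qed
  qed
  show ?thesis
  proof (rule image_subsetI)
    fix z
    have "L (dyad x) - L (dyad x') = ?p x Q1 - ?p x' Q1" using nQ Q1(3) by simp
    moreover have "(?p x Q1) \<cdot> z \<in> cspan Z" "(?p x' Q1) \<cdot> z \<in> cspan Z"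
      using sub[of x] sub[of x'] by blast+
    ultimately show "(L (dyad x) - L (dyad x')) \<cdot> z \<in> cspan Z"
      by (simp add: blinfun.diff_left complex_vector.span_diff)
  qed
qed

text \<open>Fix a frame \<open>S\<close> of \<open>2k\<close> vectors and \<open>e \<in> S\<close>. The operators on the span of \<open>S - {e}\<close> with
  vanishing diagonal form a real vector space of dimension \<open>(2k - 1)(2k - 2)\<close>, on which \<open>L\<close> is
  injective, and the images live in the range of a sum of two rank \<open>m\<close> projections. Hence
  \<open>(2k - 1)(2k - 2) \<le> (2m)\<^sup>2\<close>, which fails for \<open>m < k\<close> when \<open>k \<ge> 2\<close>.\<close>

theorem rank_inequality:
  assumes dim: "enat (2 * k) \<le> ecdim (UNIV :: 'a set)"
  shows "k \<le> m"
proof (cases "k = 1")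
  case True
  then show ?thesis using m_pos by simp
next
  case False
  then have k2: "2 \<le> k" using k_pos by simp
  have dim': "enat (k + 2) \<le> ecdim (UNIV :: 'a set)"
    by (rule order_trans[OF _ dim]) (use k2 in simp)
  obtain S :: "'a set" where S: "finite S" "card S = 2 * k" "orthonormal S"
    using orthonormal_extend[of "{}" "2 * k"] dim by auto
  then obtain e where e: "e \<in> S" using k_pos by fastforce
  define n where "n = 2 * k - 1"
  define S' where "S' = S - {e}"
  have S': "finite S'" "card S' = n" "orthonormal S'" "S = insert e S'" "e \<notin> S'"
    using S e by (auto simp: S'_def n_def intro: orthonormal_subset)
  obtain f where f: "bij_betw f {..<n} S'"
    using ex_bij_betw_nat_finite[OF S'(1)] S'(2) by (auto simp: atLeast0LessThan)
  have fS: "f i \<in> S'" if "i < n" for i using f that by (auto simp: bij_betw_def)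
  have f_eq: "f i = f j \<longleftrightarrow> i = j" if "i < n" "j < n" for i j
    using f that by (auto simp: bij_betw_def inj_on_eq_iff)
  have f_on: "cinner (f i) (f j) = (if i = j then 1 else 0)" if "i < n" "j < n" for i j
    using orthonormalD[OF S'(3) fS[OF that(1)] fS[OF that(2)]] f_eq[OF that] by simp
  let ?N = "\<Sum>y\<in>S. L (dyad y)"
  have "?N \<in> fin_rank_sa" by (rule fin_rank_sa_sum) simp
  then obtain Z b where Z: "finite Z" "orthonormal Z" "\<And>z. z \<in> Z \<Longrightarrow> b z \<noteq> 0" "?N = (\<Sum>z\<in>Z. b z *\<^sub>R dyad z)"
    using spectral_decomposition by metis
  have ker: "?N \<cdot> v = 0" if "\<And>z. z \<in> Z \<Longrightarrow> cinner v z = 0" for v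
    unfolding Z(4) sum_dyads_apply using that by simp
  have cardZ: "card Z \<le> 2 * m"
  proof -
    obtain S1 where S1: "S1 \<subseteq> S" "card S1 = k" "finite S1"
      using obtain_subset_with_card_n[of k S] S(2) by auto
    define S2 where "S2 = S - S1"
    have S2: "S2 \<subseteq> S" "card S2 = k" "finite S2" "S1 \<inter> S2 = {}" "S = S1 \<union> S2"
      using S1 S by (auto simp: S2_def card_Diff_subset)
    have P: "(\<Sum>y\<in>S1. L (dyad y)) \<in> projections m" "(\<Sum>y\<in>S2. L (dyad y)) \<in> projections m"
      using S1 S2 orthonormal_subset[OF S(3)] by (simp_all add: frame_projection)
    obtain X1 where X1: "finite X1" "card X1 = m" "(\<Sum>y\<in>S1. L (dyad y)) = (\<Sum>x\<in>X1. dyad x)"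
      using projections_decomposition[OF P(1)] by metis
    obtain X2 where X2: "finite X2" "card X2 = m" "(\<Sum>y\<in>S2. L (dyad y)) = (\<Sum>x\<in>X2. dyad x)"
      using projections_decomposition[OF P(2)] by metis
    have N: "?N = (\<Sum>x\<in>X1. dyad x) + (\<Sum>x\<in>X2. dyad x)"
      unfolding X1(3)[symmetric] X2(3)[symmetric] using sum.union_disjoint[OF S1(3) S2(3,4)] S2(5) by simp
    have inN: "?N \<cdot> v \<in> cspan (X1 \<union> X2)" for v
      unfolding N by (simp add: blinfun.add_left blinfun.sum_left)
        (intro complex_vector.span_add complex_vector.span_sum complex_vector.span_scale complex_vector.span_base; simp)
    have "Z \<subseteq> cspan (X1 \<union> X2)"
    proof
      fix z assume z: "z \<in> Z"
      have "z = complex_of_real (1 / b z) *\<^sub>C ?N \<cdot> z"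
        using Z(3)[OF z] unfolding Z(4) sum_dyads_eigen[OF Z(2,1) z] by (simp add: scaleC_simps)
      then show "z \<in> cspan (X1 \<union> X2)" using inN[of z] by (metis complex_vector.span_scale)
    qed
    then have "card Z \<le> card (X1 \<union> X2)" using orthonormal_card_le[OF Z(2,1)] X1(1) X2(1) by simp
    also have "\<dots> \<le> 2 * m" using card_Un_le[of X1 X2] X1 X2 by simp
    finally show ?thesis .
  qed
  \<comment> \<open>An off-diagonal unit is the difference of two dyads of a rotated frame with the same sum.\<close>
  have img: "range (blinfun_apply (L (sdyad (c *\<^sub>C f i) (f j)))) \<subseteq> cspan Z"
    if ij: "i < n" "j < n" "i \<noteq> j" and c: "cmod c = 1" for i j c
  proof -
    define u where "u = c *\<^sub>C f i"
    have nf: "norm (f i) = 1" "norm (f j) = 1" using orthonormal_norm[OF S'(3)] fS ij by auto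
    have nu: "norm u = 1" using nf c by (simp add: u_def)
    have du: "dyad u = dyad (f i)" by (simp add: u_def dyad_scaleC c)
    have uj: "cinner u (f j) = 0" using f_on ij by (simp add: u_def cinner_scaleC_left)
    define s where "s = 1 / sqrt 2"
    define x where "x = s *\<^sub>R (u + f j)"
    define x' where "x' = s *\<^sub>R (u - f j)"
    note rp = rotated_pair[OF nu nf(2) uj, folded s_def, folded x_def x'_def]
    define Q where "Q = S - {f i, f j}"
    have SQ: "S = insert (f i) (insert (f j) Q)" "f i \<notin> Q" "f j \<notin> Q" "f i \<noteq> f j"
      using fS[OF ij(1)] fS[OF ij(2)] f_eq ij S'(4) by (auto simp: Q_def)
    have finQ: "finite Q" using S(1) by (simp add: Q_def)
    have orth: "cinner x y = 0" "cinner x' y = 0" if "y \<in> Q" for y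
    proof -
      have "cinner (f i) y = 0" "cinner (f j) y = 0"
        using orthonormalD[OF S(3), of "f i" y] orthonormalD[OF S(3), of "f j" y] that SQ by auto
      then show "cinner x y = 0" "cinner x' y = 0"
        by (simp_all add: x_def x'_def u_def cinner_simps)
    qed
    have onQ: "orthonormal Q" by (rule orthonormal_subset[OF S(3)]) (simp add: Q_def)
    have nQ: "x \<notin> Q" "x' \<notin> Q" using orth[of x] orth[of x'] rp(1,2) by (auto simp: norm_eq_1_iff_cinner)
    have xx: "x \<noteq> x'" using rp(1,3) by (auto simp: norm_eq_1_iff_cinner)
    have sumN: "(\<Sum>y\<in>insert x (insert x' Q). L (dyad y)) = ?N"
    proof -
      have "L (dyad x) + L (dyad x') = L (dyad (f i)) + L (dyad (f j))"
        using arg_cong[OF rp(4), of L] by (simp add: L_add du)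
      then show ?thesis using finQ nQ xx SQ by (subst SQ(1)) (simp add: add.assoc[symmetric])
    qed
    have "range (blinfun_apply (L (dyad x) - L (dyad x'))) \<subseteq> cspan Z"
    proof (rule range_difference_subset[OF finQ _ nQ xx _ Z(1,2)])
      show "card Q = 2 * (k - 1)" using S(2) SQ finQ by simp
      show "orthonormal (insert x (insert x' Q))"
        using onQ rp(1-3) orth by (intro orthonormal_insert) auto
    qed (unfold sumN, rule ker)
    then show ?thesis using arg_cong[OF rp(5), of L] by (simp add: L_diff u_def)
  qed
  obtain T where T: "finite T" "card T \<le> card Z * card Z"
    "\<And>A. self_adjoint A \<Longrightarrow> range (blinfun_apply A) \<subseteq> cspan Z \<Longrightarrow> A \<in> span T"
    using hermitian_space_finite_span[OF Z(1,2)] by blast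
  define I where "I = {(i, j). i < n \<and> j < n \<and> i \<noteq> j}"
  have I: "I = (SIGMA i:{..<n}. {..<n} - {i})" by (auto simp: I_def)
  have finI: "finite I" and cardI: "card I = n * (n - 1)" unfolding I by (simp_all add: card_Diff_subset)
  have fr: "herm_unit f p \<in> fin_rank_sa" for p by (simp add: herm_unit_def split: prod.split)
  have "card I \<le> card T"
  proof (rule card_le_of_independent_family[OF finI T(1), of "\<lambda>p. L (herm_unit f p)"])
    show "(\<lambda>p. L (herm_unit f p)) ` I \<subseteq> span T"
    proof (rule image_subsetI)
      fix p assume "p \<in> I"
      then obtain i j where p: "p = (i, j)" "i < n" "j < n" "i \<noteq> j" by (auto simp: I_def)
      show "L (herm_unit f p) \<in> span T"
        using img[OF p(2-4), of 1] img[OF p(2-4), of \<i>]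
        by (intro T(3) L_self_adjoint fr) (auto simp: p(1) herm_unit_def scaleC_one)
    qed
  next
    fix c :: "nat \<times> nat \<Rightarrow> real"
    assume c: "(\<Sum>p\<in>I. c p *\<^sub>R L (herm_unit f p)) = 0"
    define A where "A = (\<Sum>p\<in>I. c p *\<^sub>R herm_unit f p)"
    have A: "A \<in> fin_rank_sa" unfolding A_def by (rule fin_rank_sa_sum) (simp add: fr)
    have LA: "L A = 0"
      using c unfolding A_def by (subst L_sum) (simp_all add: fr L_scaleR)
    have diag: "cinner (A \<cdot> y) y = 0" if y: "y \<in> S'" for y
    proof -
      obtain l where l: "l < n" "y = f l" using f y by (auto simp: bij_betw_def)
      have "cinner (herm_unit f p \<cdot> f l) (f l) = 0" if "p \<in> I" for p
        using that l f_on by (auto simp: I_def herm_unit_def cinner_simps)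
      then show ?thesis by (simp add: A_def l(2) blinfun.sum_left blinfun.scaleR_left cinner_sum_left cinner_scaleR_left)
    qed
    have rgA: "A \<cdot> v \<in> cspan S'" for v
    proof -
      have "herm_unit f p \<cdot> v \<in> cspan S'" if pI: "p \<in> I" for p
      proof -
        obtain i j where p: "p = (i, j)" "i < n" "j < n" using pI by (auto simp: I_def)
        have "f i \<in> cspan S'" "f j \<in> cspan S'" using fS p by (simp_all add: complex_vector.span_base)
        then show ?thesis
          by (simp add: p(1) herm_unit_def complex_vector.span_add complex_vector.span_scale)
      qed
      then show ?thesis unfolding A_def
        by (auto simp: blinfun.sum_left blinfun.scaleR_left scaleR_scaleC
            intro!: complex_vector.span_sum complex_vector.span_scale)
    qed
    obtain X a where X: "finite X" "orthonormal X" "\<And>x. x \<in> X \<Longrightarrow> a x \<noteq> 0" "A = (\<Sum>x\<in>X. a x *\<^sub>R dyad x)"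
      using spectral_decomposition[OF A] by metis
    have XS: "x \<in> cspan S'" if "x \<in> X" for x
    proof -
      have "x = complex_of_real (1 / a x) *\<^sub>C A \<cdot> x"
        using X(3)[OF that] unfolding X(4) sum_dyads_eigen[OF X(2,1) that] by (simp add: scaleC_simps)
      then show ?thesis using rgA[of x] by (metis complex_vector.span_scale)
    qed
    have eX: "cinner e x = 0" if "x \<in> X" for x
    proof -
      have "cinner e y = 0" if "y \<in> S'" for y
        using orthonormalD[OF S(3), of e y] that S'(4,5) by auto
      then show ?thesis
        by (subst orthonormal_expand[OF S'(3,1) XS[OF that]]) (simp add: cinner_sum_right cinner_scaleC_right)
    qed
    have "complex_of_real (\<Sum>x\<in>X. a x) = (\<Sum>x\<in>X. complex_of_real (a x) * (\<Sum>y\<in>S'. cinner x y * cinner y x))"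
      using parseval_finite[OF S'(3,1) XS] orthonormalD[OF X(2)] by (simp cong: sum.cong)
    also have "\<dots> = (\<Sum>y\<in>S'. \<Sum>x\<in>X. complex_of_real (a x) * (cinner x y * cinner y x))"
      unfolding sum_distrib_left by (rule sum.swap)
    also have "\<dots> = (\<Sum>y\<in>S'. cinner (A \<cdot> y) y)"
      unfolding X(4) sum_dyads_apply by (simp add: cinner_sum_left cinner_scaleC_left mult.commute mult.left_commute)
    also have "\<dots> = 0" using diag by simp
    finally have tr: "(\<Sum>x\<in>X. a x) = 0" by (simp only: of_real_eq_0_iff)
    have eX': "e \<notin> X" using eX[of e] orthonormal_norm[OF S(3) e] by (auto simp: norm_eq_1_iff_cinner)
    have "X = {}"
    proof (rule traceless_kernel_trivial[OF k2 dim' X(1) _ eX' X(3) tr])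
      show "orthonormal (insert e X)"
        using X(2) orthonormal_norm[OF S(3) e] eX by (intro orthonormal_insert)
      show "L (\<Sum>x\<in>X. a x *\<^sub>R dyad x) = 0" using LA X(4) by simp
    qed
    then have A0: "A = 0" using X(4) by simp
    have zero: "c (i, j) = 0 \<and> c (j, i) = 0" if ij: "i < j" "j < n" for i j
    proof -
      have h: "cinner (herm_unit f p \<cdot> f i) (f j)
          = (if p = (i, j) then 1 else 0) + (if p = (j, i) then \<i> else 0)" if "p \<in> I" for p
        using that ij f_on by (cases p) (auto simp: I_def herm_unit_def cinner_simps)
      have "cinner (A \<cdot> f i) (f j)
          = (\<Sum>p\<in>I. complex_of_real (c p) * cinner (herm_unit f p \<cdot> f i) (f j))"
        by (simp add: A_def blinfun.sum_left blinfun.scaleR_left cinner_sum_left cinner_scaleR_left)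
      also have "\<dots> = (\<Sum>p\<in>I. (if p = (i, j) then complex_of_real (c p) else 0)
          + (if p = (j, i) then complex_of_real (c p) * \<i> else 0))"
        by (rule sum.cong[OF refl], simp only: h distrib_left if_distrib[of "(*) _"] mult_1_right mult_zero_right)
      also have "\<dots> = (\<Sum>p\<in>I. if p = (i, j) then complex_of_real (c p) else 0)
          + (\<Sum>p\<in>I. if p = (j, i) then complex_of_real (c p) * \<i> else 0)"
        by (rule sum.distrib)
      also have "\<dots> = complex_of_real (c (i, j)) + complex_of_real (c (j, i)) * \<i>"
      proof -
        have "(i, j) \<in> I" "(j, i) \<in> I" using ij by (simp_all add: I_def)
        then show ?thesis using finI by simp
      qed
      finally show ?thesis using A0 by (simp add: complex_eq_iff)
    qed
    show "\<forall>p\<in>I. c p = 0"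
    proof
      fix p assume "p \<in> I"
      then obtain i j where p: "p = (i, j)" "i < n" "j < n" "i \<noteq> j" by (auto simp: I_def)
      then show "c p = 0" using zero[of i j] zero[of j i] by (cases "i < j") auto
    qed
  qed
  then have le: "n * (n - 1) \<le> card Z * card Z" using T(2) cardI by simp
  show "k \<le> m"
  proof (rule ccontr)
    assume "\<not> k \<le> m"
    then have "card Z \<le> 2 * (k - 1)" using cardZ by arith
    then have "card Z * card Z \<le> (2 * (k - 1)) * (2 * (k - 1))" by (intro mult_mono) simp_all
    then have "(2 * k - 1) * (2 * (k - 1)) \<le> (2 * (k - 1)) * (2 * (k - 1))"
      using le by (simp add: n_def algebra_simps)
    then show False using k2 by simp
  qed
qed

section \<open>Images of the Pauli matrices of a plane\<close>

abbreviation dd :: "'a \<Rightarrow> 'a \<Rightarrow> 'b \<Rightarrow>\<^sub>L 'b" where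
  "dd x y \<equiv> L (dyad x) - L (dyad y)"

lemma frame_complement_exists:
  fixes x y :: 'a
  assumes "norm x = 1" "norm y = 1" "cinner x y = 0"
  obtains R where "finite R" "card R = k - 1" "x \<notin> R" "y \<notin> R" "orthonormal (insert x (insert y R))"
proof -
  have xy: "x \<noteq> y" by (rule orthonormal_pair_neq[OF assms(1,3)])
  have "enat (Suc k) \<le> ecdim (UNIV :: 'a set)" using k_less Suc_ile_eq by blast
  moreover have "card {x, y} + (k - 1) = Suc k" using k_pos xy by simp
  ultimately have "\<exists>R. finite R \<and> card R = k - 1 \<and> R \<inter> {x, y} = {} \<and> orthonormal ({x, y} \<union> R)"
    by (intro orthonormal_extend[OF orthonormal_pair[OF assms]]) (simp_all only: finite.emptyI finite.insertI)
  then obtain R where R: "finite R" "card R = k - 1" "R \<inter> {x, y} = {}" "orthonormal ({x, y} \<union> R)"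
    by (elim exE conjE)
  show thesis
    by (rule that[OF R(1,2)]) (use R(3,4) in auto)
qed

text \<open>The frames \<open>R \<union> {x}\<close> and \<open>R \<union> {y}\<close> give projections \<open>p, q\<close>. When the orthonormal pair
  \<open>x, y\<close> is rotated within its plane, \<open>p + q\<close> does not change; therefore all differences \<open>p - q\<close>
  have the same square.\<close>

lemma plane_identities:
  assumes on: "orthonormal (insert x (insert y R))" "x \<noteq> y" "x \<notin> R" "y \<notin> R"
    and R: "finite R" "card R = k - 1"
    and xy': "norm x' = 1" "norm y' = 1" "cinner x' y' = 0"
    and eq: "dyad x' + dyad y' = dyad x + dyad y"
  defines "S \<equiv> 2 *\<^sub>R (\<Sum>z\<in>R. L (dyad z)) + (L (dyad x) + L (dyad y))"
  shows "acomm S (dd x' y') = 2 *\<^sub>R dd x' y'"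
    and "acomm (dd x' y') (dd x' y') = 4 *\<^sub>R S - acomm S S"
proof -
  define r where "r = (\<Sum>z\<in>R. L (dyad z))"
  have ort: "cinner z x' = 0" "cinner z y' = 0" if "z \<in> R" for z
  proof -
    have zx: "cinner z x = 0" "cinner z y = 0" using orthonormalD[OF on(1), of z] that on by auto
    have "(dyad x' + dyad y') \<cdot> z = 0"
      unfolding eq by (simp add: blinfun.add_left zx)
    then have w: "cinner z x' *\<^sub>C x' + cinner z y' *\<^sub>C y' = 0" by (simp add: blinfun.add_left)
    have "cinner (cinner z x' *\<^sub>C x' + cinner z y' *\<^sub>C y') x' = cinner z x'"
      "cinner (cinner z x' *\<^sub>C x' + cinner z y' *\<^sub>C y') y' = cinner z y'"
      using xy' cinner_sym_0[of x' y'] by (simp_all add: cinner_simps norm_eq_1_iff_cinner)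
    then show "cinner z x' = 0" "cinner z y' = 0" unfolding w by simp_all
  qed
  have onR: "orthonormal R" by (rule orthonormal_subset[OF on(1)]) auto
  have proj: "r + L (dyad w) \<in> projections m" if w: "w \<in> {x', y'}" for w
  proof -
    have nw: "norm w = 1" and ow: "\<And>z. z \<in> R \<Longrightarrow> cinner w z = 0"
      using w xy' ort cinner_sym_0[of w] by auto
    have "w \<notin> R" using ow[of w] nw by (auto simp: norm_eq_1_iff_cinner)
    moreover have "orthonormal (insert w R)" by (rule orthonormal_insert[OF onR nw ow])
    ultimately have "(\<Sum>z\<in>insert w R. L (dyad z)) \<in> projections m"
      using R k_pos by (intro frame_projection) auto
    then show ?thesis using R \<open>w \<notin> R\<close> by (simp add: r_def add.commute)
  qed
  define p where "p = r + L (dyad x')"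
  define q where "q = r + L (dyad y')"
  have pp: "acomm p p = p + p" and qq: "acomm q q = q + q"
    unfolding p_def q_def using proj by (auto intro: projections_acomm)
  have "L (dyad x') + L (dyad y') = L (dyad x) + L (dyad y)"
    using arg_cong[OF eq, of L] by (simp add: L_add)
  then have S: "S = p + q" by (simp add: S_def p_def q_def r_def scaleR_2 algebra_simps)
  have D: "dd x' y' = p - q" by (simp add: p_def q_def)
  show "acomm S (dd x' y') = 2 *\<^sub>R dd x' y'"
    unfolding S D by (simp add: acomm_simps pp qq acomm_commute[of q p] scaleR_2)
  have four: "4 *\<^sub>R A = A + A + A + A" for A :: "'b \<Rightarrow>\<^sub>L 'b"
    using scaleR_add_left[of 2 2 A] by (simp add: scaleR_2)
  show "acomm (dd x' y') (dd x' y') = 4 *\<^sub>R S - acomm S S"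
    unfolding S D four by (simp add: acomm_simps pp qq acomm_commute[of q p])
qed

lemma plane_square_eq:
  assumes xy: "norm x = 1" "norm y = 1" "cinner x y = 0"
    and xy': "norm x' = 1" "norm y' = 1" "cinner x' y' = 0"
    and eq: "dyad x' + dyad y' = dyad x + dyad y"
  shows "acomm (dd x' y') (dd x' y') = acomm (dd x y) (dd x y)"
proof -
  obtain R where R: "finite R" "card R = k - 1" "x \<notin> R" "y \<notin> R" "orthonormal (insert x (insert y R))"
    using frame_complement_exists[OF xy] by metis
  note pl = plane_identities(2)[OF R(5) orthonormal_pair_neq[OF xy(1,3)] R(3,4,1,2)]
  show ?thesis unfolding pl[OF xy' eq] pl[OF xy refl] ..
qed

text \<open>The operators \<open>x x\<^sup>* - y y\<^sup>*\<close>, \<open>x y\<^sup>* + y x\<^sup>*\<close> and \<open>i (y x\<^sup>* - x y\<^sup>*)\<close> are, up to sign, the Pauli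
  matrices of the plane of \<open>x\<close> and \<open>y\<close>. Rotations of the pair permute them, and therefore their
  images anticommute and have a common square.\<close>

lemma pauli_off_diagonal:
  assumes xy: "norm x = 1" "norm y = 1" "cinner x y = 0"
  shows "L (sdyad x y) = dd ((1 / sqrt 2) *\<^sub>R (x + y)) ((1 / sqrt 2) *\<^sub>R (x - y))"
  using arg_cong[OF rotated_pair(5)[OF xy], of L] by (simp add: L_diff)

lemma pauli_square:
  assumes xy: "norm x = 1" "norm y = 1" "cinner x y = 0"
  shows "acomm (L (sdyad x y)) (L (sdyad x y)) = acomm (dd x y) (dd x y)"
  unfolding pauli_off_diagonal[OF xy]
  using rotated_pair[OF xy] by (intro plane_square_eq xy)

lemma pauli_anticommute_diagonal:
  assumes xy: "norm x = 1" "norm y = 1" "cinner x y = 0"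
  shows "acomm (dd x y) (L (sdyad x y)) = 0"
proof -
  let ?s = "1 / sqrt 5 :: real"
  let ?D' = "dd (?s *\<^sub>R (2 *\<^sub>R x + y)) (?s *\<^sub>R (x - 2 *\<^sub>R y))"
  let ?D = "dd x y" and ?M = "L (sdyad x y)"
  have "acomm ?D' ?D' = acomm ?D ?D"
    using rotated_pair5[OF xy] by (intro plane_square_eq xy)
  moreover have "5 *\<^sub>R ?D' = 3 *\<^sub>R ?D + 4 *\<^sub>R ?M"
    using arg_cong[OF rotated_pair5(5)[OF xy], of L] by (simp add: L_diff L_add L_scaleR)
  moreover have "acomm (5 *\<^sub>R A) (5 *\<^sub>R A) = 25 *\<^sub>R acomm A A" for A :: "'b \<Rightarrow>\<^sub>L 'b"
    by (simp add: acomm_scaleR_left acomm_scaleR_right)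
  ultimately have "acomm (3 *\<^sub>R ?D + 4 *\<^sub>R ?M) (3 *\<^sub>R ?D + 4 *\<^sub>R ?M) = 25 *\<^sub>R acomm ?D ?D"
    by metis
  moreover have "acomm (3 *\<^sub>R A + 4 *\<^sub>R B) (3 *\<^sub>R A + 4 *\<^sub>R B) = 9 *\<^sub>R acomm A A + 16 *\<^sub>R acomm B B + 24 *\<^sub>R acomm A B" for A B :: "'b \<Rightarrow>\<^sub>L 'b"
    using scaleR_add_left[of 12 12 "acomm A B"]
    by (simp only: acomm_simps acomm_commute[of B A]) (simp add: scaleR_add_right)
  moreover have "25 *\<^sub>R acomm ?D ?D = 9 *\<^sub>R acomm ?D ?D + 16 *\<^sub>R acomm ?D ?D"
    using scaleR_add_left[of 9 16 "acomm ?D ?D"] by simp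
  ultimately have "24 *\<^sub>R acomm ?D ?M = 0" using pauli_square[OF xy] by simp
  then show ?thesis by simp
qed

lemma pauli_anticommute_off_diagonal:
  assumes xy: "norm x = 1" "norm y = 1" "cinner x y = 0"
  shows "acomm (L (sdyad x y)) (L (sdyad (\<i> *\<^sub>C x) y)) = 0"
proof -
  let ?s = "1 / sqrt 2 :: real"
  let ?x = "?s *\<^sub>R (x + y)" and ?y = "?s *\<^sub>R (x - y)"
  note rp = rotated_pair[OF xy]
  have ix: "norm (\<i> *\<^sub>C ?x) = 1" "cinner (\<i> *\<^sub>C ?x) ?y = 0"
    using rp(1,3) by (simp_all only: norm_scaleC cinner_scaleC_left) simp_all
  have "acomm (dd (\<i> *\<^sub>C ?x) ?y) (L (sdyad (\<i> *\<^sub>C ?x) ?y)) = 0"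
    by (rule pauli_anticommute_diagonal[OF ix(1) rp(2) ix(2)])
  moreover have "dd (\<i> *\<^sub>C ?x) ?y = L (sdyad x y)"
    unfolding pauli_off_diagonal[OF xy] dyad_scaleC by simp
  moreover have "L (sdyad (\<i> *\<^sub>C ?x) ?y) = - L (sdyad (\<i> *\<^sub>C x) y)"
    unfolding sdyad_rotated by (simp add: L_uminus)
  ultimately show ?thesis by (simp only: acomm_minus_right neg_equal_0_iff_equal)
qed

lemma dd_neq_0:
  assumes "norm x = 1" "norm y = 1" "cinner x y = 0"
  shows "dd x y \<noteq> 0"
  using L_dyad_neq[OF orthonormal_pair[OF assms] orthonormal_pair_neq[OF assms(1,3)]] by simp

lemma dd_self_adjoint: "self_adjoint (dd x y)"
  by (intro self_adjoint_diff L_self_adjoint) simp_all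

text \<open>An off-diagonal Pauli matrix maps eigenvectors of \<open>dd x y\<close> to eigenvectors for the opposite
  eigenvalue.\<close>

lemma eigenvalue_flip:
  assumes xy: "norm x = 1" "norm y = 1" "cinner x y = 0"
    and t: "dd x y \<cdot> t = complex_of_real r *\<^sub>C t" "t \<noteq> 0" "r \<noteq> 0"
  defines "w \<equiv> (L (sdyad x y)) \<cdot> t"
  shows "dd x y \<cdot> w = complex_of_real (- r) *\<^sub>C w" and "w \<noteq> 0"
proof -
  have sM: "self_adjoint (L (sdyad x y))" by (simp add: L_self_adjoint)
  show "dd x y \<cdot> w = complex_of_real (- r) *\<^sub>C w"
    unfolding w_def acomm_0_apply[OF pauli_anticommute_diagonal[OF xy]] t(1)
    by (simp add: self_adjoint_scaleC[OF sM])
  have Mw: "(L (sdyad x y)) \<cdot> w = complex_of_real (r * r) *\<^sub>C t"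
    unfolding w_def acomm_square_apply[OF pauli_square[OF xy]] t(1) self_adjoint_scaleC[OF dd_self_adjoint]
    by (simp add: t(1) scaleC_simps)
  show "w \<noteq> 0" using Mw t(2,3) by (auto simp: complex_vector.scale_eq_0_iff)
qed

text \<open>\<open>dd x y\<close> has a nonzero eigenvalue, and with it the opposite one.\<close>

lemma eigenvalue_pair_exists:
  assumes xy: "norm x = 1" "norm y = 1" "cinner x y = 0"
    and X: "finite X" "orthonormal X" "\<And>t. t \<in> X \<Longrightarrow> a t \<noteq> 0" "dd x y = (\<Sum>t\<in>X. a t *\<^sub>R dyad t)"
  obtains u v where "u \<in> X" "v \<in> X" "a u > 0" "a v < 0"
proof -
  have "X \<noteq> {}" using dd_neq_0[OF xy] X(4) by auto
  then obtain t where t: "t \<in> X" by blast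
  have e: "dd x y \<cdot> s = complex_of_real (a s) *\<^sub>C s" if "s \<in> X" for s
    unfolding X(4) by (rule sum_dyads_eigen[OF X(2,1) that])
  have t0: "t \<noteq> 0" using orthonormal_norm[OF X(2) t] by auto
  define w where "w = (L (sdyad x y)) \<cdot> t"
  have w: "dd x y \<cdot> w = complex_of_real (- a t) *\<^sub>C w" "w \<noteq> 0"
    using eigenvalue_flip[OF xy e[OF t] t0 X(3)[OF t]] by (simp_all add: w_def)
  have "\<exists>s\<in>X. cinner w s \<noteq> 0"
  proof (rule ccontr)
    assume "\<not> ?thesis"
    then have "dd x y \<cdot> w = 0" unfolding X(4) sum_dyads_apply by simp
    then show False using w X(3)[OF t] by (simp add: complex_vector.scale_eq_0_iff)
  qed
  then obtain s where s: "s \<in> X" "cinner w s \<noteq> 0" by blast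
  have "complex_of_real (a s) * cinner w s = cinner w (dd x y \<cdot> s)"
    by (simp only: e[OF s(1)] cinner_scaleC_right complex_cnj_complex_of_real)
  also have "\<dots> = cinner (dd x y \<cdot> w) s" by (rule self_adjointD[OF dd_self_adjoint, symmetric])
  also have "\<dots> = complex_of_real (- a t) * cinner w s" by (simp only: w(1) cinner_scaleC_left)
  finally have "a s = - a t" using s(2) by (metis mult_right_cancel of_real_eq_iff)
  then show thesis using that[of s t] that[of t s] s(1) t X(3)[OF t] by (cases "a t > 0") auto
qed

lemma positive_eigenvector_exists:
  assumes xy: "norm x = 1" "norm y = 1" "cinner x y = 0"
  obtains u r where "norm u = 1" "r > 0" "dd x y \<cdot> u = complex_of_real r *\<^sub>C u"
proof -
  have "dd x y \<in> fin_rank_sa" by simp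
  then obtain X a where X: "finite X" "orthonormal X" "\<And>t. t \<in> X \<Longrightarrow> a t \<noteq> 0" "dd x y = (\<Sum>t\<in>X. a t *\<^sub>R dyad t)"
    using spectral_decomposition by metis
  obtain u v where u: "u \<in> X" "a u > 0" using eigenvalue_pair_exists[OF xy X] by metis
  show thesis
  proof (rule that[OF orthonormal_norm[OF X(2) u(1)] u(2)])
    show "dd x y \<cdot> u = complex_of_real (a u) *\<^sub>C u"
      unfolding X(4) by (rule sum_dyads_eigen[OF X(2,1) u(1)])
  qed
qed

end

section \<open>Images with large intersections\<close>

text \<open>On the span of the eigenvectors, where \<open>P - Q\<close> is positive, the projection \<open>P\<close> is injective. It maps
  this span into the orthogonal complement of the common range within the range of \<open>P\<close>, which has
  dimension at most \<open>k\<close>.\<close>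

lemma positive_eigenvectors_bound:
  fixes P Q :: "'a::chilbert_space \<Rightarrow>\<^sub>L 'a"
  assumes P: "P \<in> projections m" and Q: "Q \<in> projections m" and km: "k \<le> m"
    and meet: "enat (m - k) \<le> ecdim (range (blinfun_apply P) \<inter> range (blinfun_apply Q))"
    and T: "finite T" "orthonormal T"
    and r: "\<And>t. t \<in> T \<Longrightarrow> r t > 0"
      "\<And>t. t \<in> T \<Longrightarrow> (P - Q) \<cdot> t = complex_of_real (r t) *\<^sub>C t"
  shows "card T \<le> k"
proof -
  let ?Z = "range (blinfun_apply P) \<inter> range (blinfun_apply Q)"
  obtain X where X: "finite X" "card X = m" "P = (\<Sum>x\<in>X. dyad x)"
    using projections_decomposition[OF P] by metis
  have rP: "P \<cdot> v \<in> cspan X" for v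
    unfolding X(3) blinfun.sum_left dyad_apply
    by (intro complex_vector.span_sum complex_vector.span_scale complex_vector.span_base)
  then have ZX: "?Z \<subseteq> cspan X" by blast
  then have "ecdim ?Z = enat (cdim ?Z)" using X(1) by (auto simp: ecdim_def)
  then have dimZ: "m - k \<le> cdim ?Z" using meet by simp
  obtain B where B: "B \<subseteq> ?Z" "complex_vector.independent B" "card B = cdim ?Z"
    using complex_vector.basis_exists[of ?Z] unfolding cdim_def by metis
  have "B \<subseteq> cspan X" using B(1) ZX by (rule subset_trans)
  then have finB: "finite B"
    using complex_vector.independent_span_bound[OF X(1) B(2)] unfolding cspan_def by blast
  have saP: "self_adjoint P" and saQ: "self_adjoint Q" using P Q projections_self_adjoint by blast+
  have saD: "self_adjoint (P - Q)" by (rule self_adjoint_diff[OF saP saQ])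
  have fixB: "P \<cdot> b = b" "Q \<cdot> b = b" if "b \<in> B" for b
  proof -
    have "b \<in> range (blinfun_apply P)" "b \<in> range (blinfun_apply Q)" using B(1) that by blast+
    then obtain v w where vw: "b = P \<cdot> v" "b = Q \<cdot> w" by (elim rangeE)
    show "P \<cdot> b = b" unfolding vw(1) by (rule projections_idem[OF P])
    show "Q \<cdot> b = b" unfolding vw(2) by (rule projections_idem[OF Q])
  qed
  have "card (B <+> T) \<le> card X"
  proof (rule complex_vector.card_le_of_independent_family[of _ _ "case_sum id (blinfun_apply P)"])
    show "finite (B <+> T)" "finite X" using finB T X by simp_all
    show "case_sum id (blinfun_apply P) ` (B <+> T) \<subseteq> complex_vector.span X"
      using rP \<open>B \<subseteq> cspan X\<close> unfolding cspan_def by auto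
    fix c :: "'a + 'a \<Rightarrow> complex"
    assume c: "(\<Sum>i\<in>B <+> T. c i *\<^sub>C case_sum id (blinfun_apply P) i) = 0"
    define s where "s = (\<Sum>b\<in>B. c (Inl b) *\<^sub>C b)"
    define x where "x = (\<Sum>t\<in>T. c (Inr t) *\<^sub>C t)"
    have Px: "P \<cdot> x = (\<Sum>t\<in>T. c (Inr t) *\<^sub>C P \<cdot> t)"
      by (simp add: x_def blinfun.sum_right self_adjoint_scaleC[OF saP])
    have sP: "s + P \<cdot> x = 0"
      using c finB T(1) by (simp add: sum.Plus s_def Px)
    have ps: "P \<cdot> s = s" "Q \<cdot> s = s"
      by (simp_all add: s_def blinfun.sum_right self_adjoint_scaleC[OF saP] self_adjoint_scaleC[OF saQ] fixB cong: sum.cong)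
    have ts: "cinner t s = 0" if "t \<in> T" for t
    proof -
      have "complex_of_real (r t) * cinner t s = cinner ((P - Q) \<cdot> t) s"
        by (simp add: r(2)[OF that] cinner_scaleC_left)
      also have "\<dots> = cinner t ((P - Q) \<cdot> s)" by (rule self_adjointD[OF saD])
      also have "\<dots> = 0" by (simp add: blinfun.diff_left ps)
      finally show ?thesis using r(1)[OF that] by simp
    qed
    have "cinner x s = 0" by (simp add: x_def cinner_sum_left cinner_scaleC_left ts)
    then have "cinner (P \<cdot> x) s = 0" by (simp add: self_adjointD[OF saP] ps)
    then have "cinner s s = 0" using sP
      by (metis add_eq_0_iff cinner_minus_left neg_equal_0_iff_equal)
    then have s0: "s = 0" by simp
    then have Px0: "P \<cdot> x = 0" using sP by simp
    have cB: "c (Inl b) = 0" if "b \<in> B" for b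
    proof (rule ccontr)
      assume "c (Inl b) \<noteq> 0"
      then have "complex_vector.dependent B"
        unfolding complex_vector.dependent_finite[OF finB]
        using s0 that by (intro exI[of _ "\<lambda>b. c (Inl b)"]) (auto simp: s_def)
      then show False using B(2) by blast
    qed
    have "(P - Q) \<cdot> x = (\<Sum>t\<in>T. (c (Inr t) * complex_of_real (r t)) *\<^sub>C t)"
      by (simp add: x_def blinfun.sum_right self_adjoint_scaleC[OF saD] r(2) scaleC_scaleC cong: sum.cong)
    then have "cinner ((P - Q) \<cdot> x) x = (\<Sum>t\<in>T. (c (Inr t) * complex_of_real (r t)) * cinner t x)"
      by (simp add: cinner_sum_left cinner_scaleC_left)
    also have "\<dots> = (\<Sum>t\<in>T. (c (Inr t) * complex_of_real (r t)) * cnj (c (Inr t)))"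
    proof (rule sum.cong[OF refl])
      fix t assume "t \<in> T"
      then have "cinner x t = c (Inr t)" unfolding x_def by (rule orthonormal_coeff[OF T(2,1)])
      then have "cinner t x = cnj (c (Inr t))" by (metis cinner_commute)
      then show "(c (Inr t) * complex_of_real (r t)) * cinner t x = (c (Inr t) * complex_of_real (r t)) * cnj (c (Inr t))" by simp
    qed
    also have "\<dots> = complex_of_real (\<Sum>t\<in>T. r t * (cmod (c (Inr t)))\<^sup>2)"
      by (simp add: complex_norm_square mult_ac del: of_real_power)
    finally have 1: "cinner ((P - Q) \<cdot> x) x = complex_of_real (\<Sum>t\<in>T. r t * (cmod (c (Inr t)))\<^sup>2)" .
    have "cinner (Q \<cdot> x) x = cinner (Q \<cdot> (Q \<cdot> x)) x"
      by (simp add: projections_idem[OF Q])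
    also have "\<dots> = cinner (Q \<cdot> x) (Q \<cdot> x)" by (rule self_adjointD[OF saQ])
    finally have 2: "cinner ((P - Q) \<cdot> x) x = complex_of_real (- (norm (Q \<cdot> x))\<^sup>2)"
      by (simp add: blinfun.diff_left Px0 cinner_self)
    have "(\<Sum>t\<in>T. r t * (cmod (c (Inr t)))\<^sup>2) \<le> 0"
    proof -
      have "(\<Sum>t\<in>T. r t * (cmod (c (Inr t)))\<^sup>2) = - (norm (Q \<cdot> x))\<^sup>2"
        using 1 2 by (metis of_real_eq_iff)
      also have "\<dots> \<le> 0" by simp
      finally show ?thesis .
    qed
    moreover have nn: "0 \<le> r t * (cmod (c (Inr t)))\<^sup>2" if "t \<in> T" for t
      using r(1)[OF that] by (simp add: order.strict_implies_order)
    ultimately have "(\<Sum>t\<in>T. r t * (cmod (c (Inr t)))\<^sup>2) = 0"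
      using sum_nonneg[of T "\<lambda>t. r t * (cmod (c (Inr t)))\<^sup>2"] by simp
    then have "r t * (cmod (c (Inr t)))\<^sup>2 = 0" if "t \<in> T" for t
      using sum_nonneg_eq_0_iff[OF T(1), of "\<lambda>t. r t * (cmod (c (Inr t)))\<^sup>2"] nn that by blast
    then have cT: "c (Inr t) = 0" if "t \<in> T" for t
      using r(1)[OF that] that by fastforce
    show "\<forall>i\<in>B <+> T. c i = 0" using cB cT by (metis PlusE)
  qed
  then have "card B + card T \<le> m" using finB T(1) X(2) by (simp add: card_Plus)
  then show ?thesis using B(3) dimZ km by simp
qed

text \<open>The hypotheses say that \<open>b, c, d\<close> are pairwise orthogonal vectors of the real plane.\<close>

lemma complex_orthogonal_triple:
  fixes b c d :: complex
  assumes "b \<noteq> 0" "c \<noteq> 0" "c * cnj b + b * cnj c = 0" "d * cnj b + b * cnj d = 0" "d * cnj c + c * cnj d = 0"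
  shows "d = 0"
proof -
  have 1: "Re b * Re c + Im b * Im c = 0" and 2: "Re b * Re d + Im b * Im d = 0"
    and 3: "Re c * Re d + Im c * Im d = 0"
    using assms(3-5) by (auto simp: complex_eq_iff algebra_simps)
  have "Re b * (Re c * Im d - Im c * Re d) = 0" "Im b * (Re c * Im d - Im c * Re d) = 0"
    using 1 2 by algebra+
  then have 4: "Re c * Im d - Im c * Re d = 0" using assms(1) by (auto simp: complex_eq_iff)
  have "(Re c * Re c + Im c * Im c) * Re d = 0" "(Re c * Re c + Im c * Im c) * Im d = 0"
    using 3 4 by algebra+
  moreover have "Re c * Re c + Im c * Im c \<noteq> 0" using assms(2) by (simp add: complex_eq_iff sum_squares_eq_zero_iff)
  ultimately have "Re d = 0" "Im d = 0" by (metis mult_eq_0_iff)+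
  then show ?thesis by (simp add: complex_eq_iff)
qed

text \<open>The additional hypotheses of the second part.\<close>

locale adjacent_projection_map = projection_map L k m
  for L :: "('a::chilbert_space \<Rightarrow>\<^sub>L 'a) \<Rightarrow> ('b::chilbert_space \<Rightarrow>\<^sub>L 'b)" and k m +
  assumes infinite_dim: "ecdim (UNIV :: 'a set) = \<infinity>"
    and meet: "P \<in> projections k \<Longrightarrow> Q \<in> projections k \<Longrightarrow>
      enat (m - k) \<le> ecdim (range (blinfun_apply (L P)) \<inter> range (blinfun_apply (L Q)))"
begin

lemma k_le_m: "k \<le> m"
  by (rule rank_inequality) (simp add: infinite_dim)

text \<open>If \<open>dd x y\<close> had two positive eigenvectors, then \<open>k - 1\<close> further pairs whose operators are
  orthogonal to \<open>dd x y\<close> and to each other would give a difference of two images with \<open>k + 1\<close>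
  positive eigenvectors.\<close>

lemma positive_eigenvector_unique:
  assumes xy: "norm x = 1" "norm y = 1" "cinner x y = 0"
    and u: "norm u = 1" "r > 0" "dd x y \<cdot> u = complex_of_real r *\<^sub>C u"
    and u': "norm u' = 1" "r' > 0" "dd x y \<cdot> u' = complex_of_real r' *\<^sub>C u'"
    and uu': "cinner u u' = 0"
  shows False
proof -
  obtain e :: "nat \<Rightarrow> 'a" where e: "inj e" "range e \<inter> {x, y} = {}" "orthonormal ({x, y} \<union> range e)"
    using infinite_orthonormal_sequence[OF infinite_dim _ orthonormal_pair[OF xy]] by blast
  have xny: "x \<noteq> y" by (rule orthonormal_pair_neq[OF xy(1,3)])
  \<comment> \<open>The given pair is number \<open>0\<close> of a sequence of mutually orthogonal pairs.\<close>
  define a where "a n = (if n = 0 then x else e (2 * n))" for n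
  define b where "b n = (if n = 0 then y else e (2 * n + 1))" for n
  have ein: "e i = e j \<longleftrightarrow> i = j" for i j using e(1) by (simp add: inj_eq)
  have exy: "e i \<noteq> x" "e i \<noteq> y" "x \<noteq> e i" "y \<noteq> e i" for i using e(2) by blast+
  have neq: "a i \<noteq> b j" "i \<noteq> j \<Longrightarrow> a i \<noteq> a j" "i \<noteq> j \<Longrightarrow> b i \<noteq> b j" for i j
    using xny exy by (simp_all add: a_def b_def ein) presburger+
  have mem: "a i \<in> {x, y} \<union> range e" "b i \<in> {x, y} \<union> range e" for i by (simp_all add: a_def b_def)
  have on: "norm (a i) = 1" "norm (b i) = 1" "cinner (a i) (b i) = 0" for i
    using orthonormal_norm[OF e(3)] orthonormalD[OF e(3) mem(1) mem(2)] mem neq by auto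
  define X where "X n = dd (a n) (b n)" for n
  have sX: "self_adjoint (X n)" for n unfolding X_def by (rule dd_self_adjoint)
  \<comment> \<open>For \<open>k = 1\<close> no further pair is wanted, and the anticommutation relations are not available.\<close>
  have "\<exists>S. finite S \<and> card S = k \<and> 0 \<in> S \<and> (\<forall>i\<in>S. \<forall>j\<in>S. i \<noteq> j \<longrightarrow> X i o\<^sub>L X j = 0)"
  proof (cases "k = 1")
    case True
    then show ?thesis by (intro exI[of _ "{0}"]) simp
  next
    case False
    then have k2: "2 \<le> k" using k_pos by simp
    have anti: "acomm (X i) (X j) = 0" if "i \<noteq> j" for i j
      unfolding X_def
    proof (rule acomm_disjoint_pairs[OF _ _ k2])
      show "orthonormal {a i, b i, a j, b j}" by (rule orthonormal_subset[OF e(3)]) (use mem in blast)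
      show "card {a i, b i, a j, b j} = 4" using neq neq(1)[symmetric] that by simp
    qed (simp add: infinite_dim)
    have "finite {l. X n o\<^sub>L X l \<noteq> 0}" for n
    proof -
      have "finite {l \<in> - {n}. X n o\<^sub>L X l \<noteq> 0}"
        by (rule finitely_many_anticommuting_overlaps) (use anti sX in \<open>auto simp: X_def\<close>)
      then have "finite (insert n {l \<in> - {n}. X n o\<^sub>L X l \<noteq> 0})" by simp
      then show ?thesis by (rule rev_finite_subset) blast
    qed
    moreover have "X j o\<^sub>L X i \<noteq> 0" if "X i o\<^sub>L X j \<noteq> 0" for i j
    proof (cases "i = j")
      case False
      then have "X i o\<^sub>L X j = - (X j o\<^sub>L X i)" using anti[of i j] by (simp add: acomm_def add_eq_0_iff)
      then show ?thesis using that by auto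
    qed (use that in simp)
    ultimately have "\<exists>S. finite S \<and> card S = Suc (k - 1) \<and> 0 \<in> S \<and> (\<forall>i\<in>S. \<forall>j\<in>S. i \<noteq> j \<longrightarrow> \<not> X i o\<^sub>L X j \<noteq> 0)"
      by (intro conflict_free_subset)
    then show ?thesis using k_pos by simp
  qed
  then obtain S where S: "finite S" "card S = k" "0 \<in> S"
    "\<And>i j. i \<in> S \<Longrightarrow> j \<in> S \<Longrightarrow> i \<noteq> j \<Longrightarrow> X i o\<^sub>L X j = 0" by metis
  have XX: "X i \<cdot> (X j \<cdot> v) = 0" if "i \<in> S" "j \<in> S" "i \<noteq> j" for i j v
    using arg_cong[OF S(4)[OF that], of "\<lambda>B. B \<cdot> v"] by simp
  have "\<forall>n. \<exists>t s. norm t = 1 \<and> s > 0 \<and> X n \<cdot> t = complex_of_real s *\<^sub>C t \<and> (n = 0 \<longrightarrow> t = u)"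
  proof
    fix n
    show "\<exists>t s. norm t = 1 \<and> s > 0 \<and> X n \<cdot> t = complex_of_real s *\<^sub>C t \<and> (n = 0 \<longrightarrow> t = u)"
    proof (cases "n = 0")
      case True
      then show ?thesis using u by (intro exI[of _ u] exI[of _ r]) (simp add: X_def a_def b_def)
    next
      case False
      obtain t s where "norm t = 1" "s > 0" "(dd (a n) (b n)) \<cdot> t = complex_of_real s *\<^sub>C t"
        using positive_eigenvector_exists[OF on] by metis
      then show ?thesis using False by (intro exI[of _ t] exI[of _ s]) (simp add: X_def)
    qed
  qed
  then obtain w s where w: "\<And>n. norm (w n) = 1" "\<And>n. s n > 0"
    "\<And>n. X n \<cdot> w n = complex_of_real (s n) *\<^sub>C w n" "w 0 = u"
    by metis
  have kill: "X i \<cdot> t = 0" if "i \<in> S" "j \<in> S" "i \<noteq> j" "q > 0" "X j \<cdot> t = complex_of_real q *\<^sub>C t" for i j q t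
  proof -
    have "t = complex_of_real (1 / q) *\<^sub>C X j \<cdot> t" using that by (simp add: scaleC_simps)
    then have "X i \<cdot> t = complex_of_real (1 / q) *\<^sub>C X i \<cdot> (X j \<cdot> t)"
      by (metis self_adjoint_scaleC[OF sX])
    then show ?thesis using XX[OF that(1-3), of t] by simp
  qed
  have ort: "cinner t t' = 0" if "i \<in> S" "j \<in> S" "i \<noteq> j" "q > 0" "X i \<cdot> t = complex_of_real q *\<^sub>C t"
    "q' > 0" "X j \<cdot> t' = complex_of_real q' *\<^sub>C t'" for i j q q' t t'
  proof -
    have "complex_of_real q * cinner t t' = cinner (X i \<cdot> t) t'"
      by (simp add: that(5) cinner_scaleC_left)
    also have "\<dots> = cinner t (X i \<cdot> t')" by (rule self_adjointD[OF sX])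
    also have "\<dots> = 0" using kill[OF that(1-3) that(6,7)] by simp
    finally show ?thesis using that(4) by simp
  qed
  have X0: "X 0 \<cdot> u' = complex_of_real r' *\<^sub>C u'" using u'(3) by (simp add: X_def a_def b_def)
  have wort: "cinner (w i) (w j) = 0" if "i \<in> S" "j \<in> S" "i \<noteq> j" for i j
    using ort[OF that w(2,3) w(2,3)] .
  have u'w: "cinner u' (w i) = 0" if "i \<in> S" for i
  proof (cases "i = 0")
    case True
    then show ?thesis using uu' w(4) by (simp add: cinner_sym_0[of u'])
  next
    case False
    then show ?thesis using ort[OF S(3) that _ u'(2) X0 w(2,3)] by simp
  qed
  have onw: "orthonormal (w ` S)" unfolding orthonormal_def
    using wort w(1) by (auto simp: norm_eq_1_iff_cinner)
  have wneq: "w i \<noteq> w j" if "i \<in> S" "j \<in> S" "i \<noteq> j" for i j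
    using wort[OF that] w(1)[of j] by (auto simp: norm_eq_1_iff_cinner)
  then have injw: "inj_on w S" by (intro inj_onI) metis
  have u'n: "u' \<notin> w ` S" using u'w u'(1) by (auto simp: norm_eq_1_iff_cinner)
  let ?T = "insert u' (w ` S)"
  have onT: "orthonormal ?T" using onw u'(1) u'w by (intro orthonormal_insert) auto
  have cT: "card ?T = Suc k" using u'n S(1,2) injw by (simp add: card_image)
  define P where "P = (\<Sum>z\<in>a ` S. dyad z)"
  define Q where "Q = (\<Sum>z\<in>b ` S. dyad z)"
  have inja: "inj_on a S" "inj_on b S" using neq(2,3) by (metis inj_onI)+
  have P: "P \<in> projections k" and Q: "Q \<in> projections k"
  proof -
    have "orthonormal (a ` S)" "orthonormal (b ` S)" by (rule orthonormal_subset[OF e(3)]; use mem in blast)+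
    then show "P \<in> projections k" "Q \<in> projections k"
      using sum_dyads_in_projections[of "a ` S"] sum_dyads_in_projections[of "b ` S"] S(1,2) inja
      by (simp_all add: P_def Q_def card_image)
  qed
  have LPQ: "L P - L Q = (\<Sum>i\<in>S. X i)"
    unfolding P_def Q_def L_sum_dyads X_def using inja by (simp add: sum.reindex sum_subtractf)
  have eig: "\<exists>q>0. (L P - L Q) \<cdot> t = complex_of_real q *\<^sub>C t" if t: "t \<in> ?T" for t
  proof -
    obtain i q where iq: "i \<in> S" "q > 0" "X i \<cdot> t = complex_of_real q *\<^sub>C t"
    proof (cases "t = u'")
      case True
      then show ?thesis using that[of 0 r'] S(3) u'(2) X0 by simp
    next
      case False
      then obtain i where "i \<in> S" "t = w i" using t by blast
      then show ?thesis using that[of i "s i"] w by simp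
    qed
    have "(L P - L Q) \<cdot> t = (\<Sum>j\<in>S. X j \<cdot> t)"
      by (simp add: LPQ blinfun.sum_left)
    also have "\<dots> = (\<Sum>j\<in>{i}. X j \<cdot> t)"
      using S(1) iq kill by (intro sum.mono_neutral_right) auto
    finally show ?thesis using iq by auto
  qed
  then obtain q where q: "\<And>t. t \<in> ?T \<Longrightarrow> q t > 0"
    "\<And>t. t \<in> ?T \<Longrightarrow> (L P - L Q) \<cdot> t = complex_of_real (q t) *\<^sub>C t" by metis
  have LP: "L P \<in> projections m" "L Q \<in> projections m" using L_proj P Q by blast+
  have "card ?T \<le> k"
    using positive_eigenvectors_bound[OF LP k_le_m meet[OF P Q] _ onT q] S(1) by simp
  then show False using cT by simp
qed

text \<open>There is one positive and one negative eigenvalue, and the set of eigenvalues is symmetric.\<close>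

lemma dd_rank_two:
  assumes xy: "norm x = 1" "norm y = 1" "cinner x y = 0"
  obtains u v r where "norm u = 1" "norm v = 1" "cinner u v = 0" "r > 0"
    "dd x y = r *\<^sub>R dyad u + (- r) *\<^sub>R dyad v"
proof -
  have "dd x y \<in> fin_rank_sa" by simp
  then obtain X a where X: "finite X" "orthonormal X" "\<And>t. t \<in> X \<Longrightarrow> a t \<noteq> 0" "dd x y = (\<Sum>t\<in>X. a t *\<^sub>R dyad t)"
    using spectral_decomposition by metis
  obtain u v where uv: "u \<in> X" "v \<in> X" "a u > 0" "a v < 0"
    using eigenvalue_pair_exists[OF xy X] by metis
  have e: "dd x y \<cdot> s = complex_of_real (a s) *\<^sub>C s" if "s \<in> X" for s
    unfolding X(4) by (rule sum_dyads_eigen[OF X(2,1) that])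
  have e': "dd y x \<cdot> s = complex_of_real (- a s) *\<^sub>C s" if "s \<in> X" for s
  proof -
    have "dd y x = - dd x y" by simp
    then have "dd y x \<cdot> s = - dd x y \<cdot> s" by (metis blinfun.minus_left)
    then show ?thesis unfolding e[OF that] by simp
  qed
  have yx: "cinner y x = 0" using xy(3) by (simp add: cinner_sym_0[of y])
  have pos: "s = t" if "s \<in> X" "t \<in> X" "a s > 0" "a t > 0" for s t
  proof (rule ccontr)
    assume "s \<noteq> t"
    then have "cinner s t = 0" using orthonormalD[OF X(2) that(1,2)] by simp
    then show False using positive_eigenvector_unique[OF xy _ that(3) e _ that(4) e]
      orthonormal_norm[OF X(2)] that by blast
  qed
  have neg: "s = t" if "s \<in> X" "t \<in> X" "a s < 0" "a t < 0" for s t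
  proof (rule ccontr)
    assume "s \<noteq> t"
    then have "cinner s t = 0" using orthonormalD[OF X(2) that(1,2)] by simp
    moreover have "- a s > 0" "- a t > 0" using that by simp_all
    ultimately show False using positive_eigenvector_unique[OF xy(2,1) yx _ _ e' _ _ e']
      orthonormal_norm[OF X(2)] that by blast
  qed
  have "s \<in> {u, v}" if "s \<in> X" for s
    using pos[OF that uv(1) _ uv(3)] neg[OF that uv(2) _ uv(4)] X(3)[OF that] by (cases "a s > 0") auto
  then have "X = {u, v}" using uv(1,2) by blast
  moreover have uvn: "u \<noteq> v" using uv by auto
  ultimately have D: "dd x y = a u *\<^sub>R dyad u + a v *\<^sub>R dyad v" using X(4) by simp
  have n: "norm u = 1" "norm v = 1" "cinner u v = 0"
    using orthonormal_norm[OF X(2)] orthonormalD[OF X(2) uv(1,2)] uv uvn by auto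
  have u0: "u \<noteq> 0" using n by auto
  define w where "w = (L (sdyad x y)) \<cdot> u"
  have w: "dd x y \<cdot> w = complex_of_real (- a u) *\<^sub>C w" "w \<noteq> 0"
    using eigenvalue_flip[OF xy e[OF uv(1)] u0 X(3)[OF uv(1)]] by (simp_all add: w_def)
  have "complex_of_real (a u) * cinner w u = cinner w (dd x y \<cdot> u)"
    by (simp only: e[OF uv(1)] cinner_scaleC_right complex_cnj_complex_of_real)
  also have "\<dots> = cinner (dd x y \<cdot> w) u" by (rule self_adjointD[OF dd_self_adjoint, symmetric])
  also have "\<dots> = complex_of_real (- a u) * cinner w u" by (simp only: w(1) cinner_scaleC_left)
  finally have wu: "cinner w u = 0" using uv(3) by (simp add: equal_neg_zero)
  have "complex_of_real (a v) * cinner w v = cinner w (dd x y \<cdot> v)"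
    by (simp only: e[OF uv(2)] cinner_scaleC_right complex_cnj_complex_of_real)
  also have "\<dots> = cinner (dd x y \<cdot> w) v" by (rule self_adjointD[OF dd_self_adjoint, symmetric])
  also have "\<dots> = complex_of_real (- a u) * cinner w v" by (simp only: w(1) cinner_scaleC_left)
  finally have "cinner w v = 0 \<or> a v = - a u" by (metis mult_right_cancel of_real_eq_iff)
  moreover have "cinner w v \<noteq> 0"
  proof
    assume "cinner w v = 0"
    then have "dd x y \<cdot> w = 0" using wu
      by (simp add: D blinfun.add_left blinfun.scaleR_left)
    then show False using w uv(3) by (simp add: complex_vector.scale_eq_0_iff)
  qed
  ultimately have "a v = - a u" by blast
  then show thesis using that[OF n uv(3)] D by simp
qed

text \<open>For a frame that is completed by \<open>x\<close> or by \<open>y\<close>, let \<open>p, q\<close> be the two projections. On the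
  two-dimensional range of \<open>p - q\<close>, the operator \<open>p + q - 1\<close> anticommutes with the images of the three
  Pauli matrices, so it vanishes there: \<open>p\<close> and \<open>q\<close> commute and differ in one dimension each.\<close>

lemma frame_structure:
  assumes xy: "norm x = 1" "norm y = 1" "cinner x y = 0"
    and R: "finite R" "card R = k - 1" "x \<notin> R" "y \<notin> R" "orthonormal (insert x (insert y R))"
  defines "p \<equiv> (\<Sum>z\<in>R. L (dyad z)) + L (dyad x)" and "q \<equiv> (\<Sum>z\<in>R. L (dyad z)) + L (dyad y)"
  obtains u v where "norm u = 1" "norm v = 1" "cinner u v = 0" "dd x y = dyad u - dyad v"
    "p \<cdot> u = u" "p \<cdot> v = 0" "q \<cdot> u = 0" "q \<cdot> v = v"
proof -
  have xny: "x \<noteq> y" by (rule orthonormal_pair_neq[OF xy(1,3)])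
  obtain u v r where uv: "norm u = 1" "norm v = 1" "cinner u v = 0" and r: "r > 0"
    and D: "dd x y = r *\<^sub>R dyad u + (- r) *\<^sub>R dyad v"
    using dd_rank_two[OF xy] by metis
  have uu: "cinner u u = 1" "cinner v v = 1" "cinner v u = 0"
    using uv by (simp_all add: norm_eq_1_iff_cinner cinner_sym_0[of v])
  have Dap: "dd x y \<cdot> w = complex_of_real r *\<^sub>C (cinner w u *\<^sub>C u - cinner w v *\<^sub>C v)" for w
    unfolding D by (simp add: blinfun.add_left blinfun.diff_left blinfun.scaleR_left blinfun.minus_left scaleR_scaleC scaleC_simps)
  have Du: "dd x y \<cdot> u = complex_of_real r *\<^sub>C u"
    and Dv: "dd x y \<cdot> v = complex_of_real (- r) *\<^sub>C v"
    unfolding Dap using uu uv by (simp_all add: scaleC_one)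
  have cancel: "a = b" if "complex_of_real r *\<^sub>C a = complex_of_real r *\<^sub>C b" for a b :: 'b
    using complex_vector.scale_left_imp_eq[OF _ that] r by simp
  have eigm: "w = cinner w v *\<^sub>C v" if "dd x y \<cdot> w = complex_of_real (- r) *\<^sub>C w" for w
  proof -
    have "complex_of_real r *\<^sub>C (cinner w u *\<^sub>C u - cinner w v *\<^sub>C v) = complex_of_real r *\<^sub>C (- w)"
      using that unfolding Dap by simp
    then have e: "cinner w u *\<^sub>C u - cinner w v *\<^sub>C v = - w" by (rule cancel)
    then have "cinner (cinner w u *\<^sub>C u - cinner w v *\<^sub>C v) u = - cinner w u" by simp
    then have "cinner w u = 0" using uu uv by (simp add: cinner_simps equal_neg_zero)
    then show ?thesis using e by simp
  qed
  have eigp: "w = cinner w u *\<^sub>C u" if "dd x y \<cdot> w = complex_of_real r *\<^sub>C w" for w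
  proof -
    have "complex_of_real r *\<^sub>C (cinner w u *\<^sub>C u - cinner w v *\<^sub>C v) = complex_of_real r *\<^sub>C w"
      using that unfolding Dap by simp
    then have e: "cinner w u *\<^sub>C u - cinner w v *\<^sub>C v = w" by (rule cancel)
    then have "cinner (cinner w u *\<^sub>C u - cinner w v *\<^sub>C v) v = cinner w v" by simp
    then have "cinner w v = 0" using uu uv by (simp add: cinner_simps equal_neg_zero)
    then show ?thesis using e by simp
  qed
  define S where "S = 2 *\<^sub>R (\<Sum>z\<in>R. L (dyad z)) + (L (dyad x) + L (dyad y))"
  have saS: "self_adjoint S"
    unfolding S_def by (intro self_adjoint_add self_adjoint_scaleR self_adjoint_sum L_self_adjoint) simp_all
  note plane = plane_identities(1)[OF R(5) xny R(3,4,1,2), folded S_def]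
  define M where "M = L (sdyad x y)"
  define N where "N = L (sdyad (\<i> *\<^sub>C x) y)"
  have ix: "norm (\<i> *\<^sub>C x) = 1" "cinner (\<i> *\<^sub>C x) y = 0" using xy by (simp_all add: cinner_scaleC_left)
  have dix: "dyad (\<i> *\<^sub>C x) = dyad x" by (simp add: dyad_scaleC)
  have SD: "acomm S (dd x y) = 2 *\<^sub>R dd x y" by (rule plane[OF xy refl])
  have SM: "acomm S M = 2 *\<^sub>R M"
    unfolding M_def pauli_off_diagonal[OF xy] using rotated_pair[OF xy] by (intro plane)
  have SN: "acomm S N = 2 *\<^sub>R N"
    unfolding N_def pauli_off_diagonal[OF ix(1) xy(2) ix(2)] using rotated_pair[OF ix(1) xy(2) ix(2), unfolded dix]
    by (intro plane)
  have MN: "acomm M N = 0" unfolding M_def N_def by (rule pauli_anticommute_off_diagonal[OF xy])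
  have sa: "self_adjoint M" "self_adjoint N" by (simp_all add: M_def N_def L_self_adjoint)
  have sw: "S \<cdot> (A \<cdot> w) + A \<cdot> (S \<cdot> w) = 2 *\<^sub>R A \<cdot> w"
    if "acomm S A = 2 *\<^sub>R A" for A w
    using arg_cong[OF that, of "\<lambda>B. B \<cdot> w"] by (simp add: acomm_apply blinfun.scaleR_left)
  \<comment> \<open>Both off-diagonal operators exchange the lines of \<open>u\<close> and \<open>v\<close>.\<close>
  have flip: "\<exists>b. b \<noteq> 0 \<and> A \<cdot> u = b *\<^sub>C v \<and> A \<cdot> v = cnj b *\<^sub>C u"
    if A: "self_adjoint A" "acomm (dd x y) A = 0" "A \<cdot> u \<noteq> 0" for A
  proof -
    have "dd x y \<cdot> (A \<cdot> u) = complex_of_real (- r) *\<^sub>C A \<cdot> u"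
      unfolding acomm_0_apply[OF A(2)] Du by (simp add: self_adjoint_scaleC[OF A(1)])
    then have 1: "A \<cdot> u = cinner (A \<cdot> u) v *\<^sub>C v" by (rule eigm)
    have "dd x y \<cdot> (A \<cdot> v) = complex_of_real r *\<^sub>C A \<cdot> v"
      unfolding acomm_0_apply[OF A(2)] Dv by (simp add: self_adjoint_scaleC[OF A(1)] del: of_real_minus) simp
    then have 2: "A \<cdot> v = cinner (A \<cdot> v) u *\<^sub>C u" by (rule eigp)
    have 3: "cinner (A \<cdot> v) u = cnj (cinner (A \<cdot> u) v)"
      by (metis cinner_commute self_adjointD[OF A(1)])
    have "cinner (A \<cdot> u) v \<noteq> 0" using 1 A(3) by auto
    then show ?thesis using 1 2 3 by (metis (no_types))
  qed
  have u0: "u \<noteq> 0" using uv by auto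
  have r0: "r \<noteq> 0" using r by simp
  obtain b where b: "b \<noteq> 0" "M \<cdot> u = b *\<^sub>C v" "M \<cdot> v = cnj b *\<^sub>C u"
    using flip[OF sa(1)] pauli_anticommute_diagonal[OF xy] eigenvalue_flip(2)[OF xy Du u0 r0]
    by (auto simp: M_def)
  obtain c where c: "c \<noteq> 0" "N \<cdot> u = c *\<^sub>C v" "N \<cdot> v = cnj c *\<^sub>C u"
    using flip[OF sa(2)] pauli_anticommute_diagonal[OF ix(1) xy(2) ix(2)]
      eigenvalue_flip(2)[OF ix(1) xy(2) ix(2), unfolded dix, OF Du u0 r0]
    by (auto simp: N_def dix)
  have coeff_u: "a = 0" if "a *\<^sub>C u = 0" for a using that u0 by (simp add: complex_vector.scale_eq_0_iff)
  have bc: "c * cnj b + b * cnj c = 0"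
  proof (rule coeff_u)
    have "M \<cdot> (N \<cdot> u) + N \<cdot> (M \<cdot> u) = 0"
      using acomm_0_apply[OF MN, of u] by simp
    then show "(c * cnj b + b * cnj c) *\<^sub>C u = 0"
      unfolding b c self_adjoint_scaleC[OF sa(1)] self_adjoint_scaleC[OF sa(2)] by (simp add: scaleC_simps)
  qed
  \<comment> \<open>Likewise \<open>S - 1\<close> maps each of the two lines to the other one, by a coefficient \<open>d\<close> that is
    orthogonal to \<open>b\<close> and \<open>c\<close> in the real plane.\<close>
  define d where "d = cinner (S \<cdot> u - u) v"
  have Su: "S \<cdot> u = u + d *\<^sub>C v"
  proof -
    have "dd x y \<cdot> (S \<cdot> u) = 2 *\<^sub>R (complex_of_real r *\<^sub>C u) - complex_of_real r *\<^sub>C S \<cdot> u"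
      using sw[OF SD, of u] unfolding Du self_adjoint_scaleC[OF saS] by (simp add: algebra_simps)
    then have "dd x y \<cdot> (S \<cdot> u - u) = complex_of_real (- r) *\<^sub>C (S \<cdot> u - u)"
      unfolding blinfun.diff_right Du by (simp add: scaleC_simps scaleR_2)
    then have "S \<cdot> u - u = d *\<^sub>C v" unfolding d_def by (rule eigm)
    then show ?thesis by (simp add: algebra_simps)
  qed
  have Sv: "S \<cdot> v = v + cnj d *\<^sub>C u"
  proof -
    have "dd x y \<cdot> (S \<cdot> v) = 2 *\<^sub>R (complex_of_real (- r) *\<^sub>C v) - complex_of_real (- r) *\<^sub>C S \<cdot> v"
      using sw[OF SD, of v] unfolding Dv self_adjoint_scaleC[OF saS] by (simp add: algebra_simps)
    then have "dd x y \<cdot> (S \<cdot> v - v) = complex_of_real r *\<^sub>C (S \<cdot> v - v)"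
      unfolding blinfun.diff_right Dv by (simp add: scaleC_simps scaleR_2)
    then have 1: "S \<cdot> v - v = cinner (S \<cdot> v - v) u *\<^sub>C u" by (rule eigp)
    have "cinner (S \<cdot> v - v) u = cinner v (S \<cdot> u)"
      using uu by (simp add: cinner_diff_left self_adjointD[OF saS])
    also have "\<dots> = cnj d" using uu uv by (simp add: Su cinner_simps)
    finally show ?thesis using 1 by (simp add: algebra_simps)
  qed
  have dA: "d * cnj a + a * cnj d = 0"
    if A: "self_adjoint A" "acomm S A = 2 *\<^sub>R A" "A \<cdot> u = a *\<^sub>C v" "A \<cdot> v = cnj a *\<^sub>C u" for A a
  proof (rule coeff_u)
    have "a *\<^sub>C (v + cnj d *\<^sub>C u) + (a *\<^sub>C v + d *\<^sub>C (cnj a *\<^sub>C u)) = 2 *\<^sub>R (a *\<^sub>C v)"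
      using sw[OF A(2), of u] unfolding A(3) self_adjoint_scaleC[OF saS] Su Sv blinfun.add_right
        self_adjoint_scaleC[OF A(1)] A(3,4) .
    then show "(d * cnj a + a * cnj d) *\<^sub>C u = 0" by (simp add: scaleC_simps scaleR_2 algebra_simps)
  qed
  have d0: "d = 0"
    using complex_orthogonal_triple[OF b(1) c(1) bc dA[OF sa(1) SM b(2,3)] dA[OF sa(2) SN c(2,3)]] .
  have S: "S = p + q" by (simp add: S_def p_def q_def scaleR_2 algebra_simps)
  have Dpq: "dd x y = p - q" by (simp add: p_def q_def)
  have ap: "p \<cdot> w = (1/2) *\<^sub>R (S \<cdot> w + dd x y \<cdot> w)"
    "q \<cdot> w = (1/2) *\<^sub>R (S \<cdot> w - dd x y \<cdot> w)" for w
    by (simp_all add: S Dpq blinfun.add_left blinfun.diff_left flip: scaleR_2)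
  have pu: "p \<cdot> u = complex_of_real ((1 + r) / 2) *\<^sub>C u"
  proof -
    have "p \<cdot> u = (1/2) *\<^sub>R (complex_of_real (1 + r) *\<^sub>C u)"
      unfolding ap Su Du d0 of_real_add scaleC_add_left by (simp add: scaleC_one)
    also have "\<dots> = complex_of_real (1 / 2 * (1 + r)) *\<^sub>C u"
      unfolding scaleR_scaleC scaleC_scaleC of_real_mult ..
    finally show ?thesis by simp
  qed
  have onR: "orthonormal (insert x R)" by (rule orthonormal_subset[OF R(5)]) auto
  have "(\<Sum>z\<in>insert x R. L (dyad z)) \<in> projections m"
    using R k_pos onR by (intro frame_projection) auto
  then have pP: "p \<in> projections m" using R by (simp add: p_def add.commute)
  have "(complex_of_real ((1 + r) / 2) * complex_of_real ((1 + r) / 2) - complex_of_real ((1 + r) / 2)) *\<^sub>C u = 0"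
    using projections_idem[OF pP, of u] unfolding pu self_adjoint_scaleC[OF projections_self_adjoint[OF pP]]
    by (simp only: pu complex_vector.scale_left_diff_distrib scaleC_scaleC) simp
  then have "complex_of_real ((1 + r) / 2 * ((1 + r) / 2) - (1 + r) / 2) = 0"
    by (simp only: of_real_mult of_real_diff coeff_u)
  then have "(1 + r) / 2 * ((1 + r) / 2 - 1) = 0" by (simp only: of_real_eq_0_iff) (simp add: algebra_simps)
  then have r1: "r = 1" using r by simp
  show thesis
  proof (rule that[OF uv])
    show "dd x y = dyad u - dyad v" using D r1 by simp
    show "p \<cdot> u = u" "p \<cdot> v = 0" "q \<cdot> u = 0" "q \<cdot> v = v"
      unfolding ap Su Sv Du Dv d0 r1 by (simp_all add: scaleC_one flip: scaleR_2)
  qed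
qed

section \<open>The line attached to a vector\<close>

text \<open>Consider the projections \<open>p\<^sub>i\<close> of the frames \<open>R \<union> {e\<^sub>i}\<close>. They commute and
  \<open>p\<^sub>0 - p\<^sub>i = u\<^sub>i u\<^sub>i\<^sup>* - v\<^sub>i v\<^sub>i\<^sup>*\<close>. Comparing \<open>p\<^sub>i\<close> with \<open>p\<^sub>j\<close>, exactly one of the following holds: \<open>u\<^sub>i\<close> and
  \<open>u\<^sub>j\<close> span the same line, or \<open>v\<^sub>i\<close> and \<open>v\<^sub>j\<close> do. So either all lines of the \<open>u\<^sub>i\<close> coincide or no two
  of them do, and in the latter case they are infinitely many orthogonal lines in the range of \<open>p\<^sub>0\<close>,
  which has finite dimension.\<close>

lemma common_positive_line:
  fixes e :: "nat \<Rightarrow> 'a"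
  assumes e: "inj e" "range e \<inter> R = {}" "orthonormal (R \<union> range e)" and R: "finite R" "card R = k - 1"
  obtains u where "norm u = 1"
    "\<And>i. i > 0 \<Longrightarrow> \<exists>v. norm v = 1 \<and> cinner u v = 0 \<and> dd (e 0) (e i) = dyad u - dyad v"
proof -
  have ein: "e i = e j \<longleftrightarrow> i = j" for i j using e(1) by (simp add: inj_eq)
  have eR: "e i \<notin> R" for i using e(2) by blast
  have en: "norm (e i) = 1" for i using orthonormal_norm[OF e(3)] by blast
  have eo: "cinner (e i) (e j) = 0" if "i \<noteq> j" for i j
    using orthonormalD[OF e(3), of "e i" "e j"] that ein by simp
  have onR: "orthonormal (insert (e i) (insert (e j) R))" for i j
    by (rule orthonormal_subset[OF e(3)]) auto
  define p where "p i = (\<Sum>z\<in>R. L (dyad z)) + L (dyad (e i))" for i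
  have dp: "dd (e i) (e j) = p i - p j" for i j by (simp add: p_def)
  have fs: "\<exists>u v. norm u = 1 \<and> norm v = 1 \<and> cinner u v = 0 \<and> dd (e i) (e j) = dyad u - dyad v \<and>
      p i \<cdot> u = u \<and> p i \<cdot> v = 0 \<and> p j \<cdot> u = 0 \<and> p j \<cdot> v = v"
    if "i \<noteq> j" for i j
    using frame_structure[OF en en eo[OF that] R eR eR onR] unfolding p_def by metis
  have pP: "p i \<in> projections m" for i
  proof -
    have "orthonormal (insert (e i) R)" by (rule orthonormal_subset[OF e(3)]) auto
    then have "(\<Sum>z\<in>insert (e i) R. L (dyad z)) \<in> projections m"
      using R k_pos eR by (intro frame_projection) auto
    then show ?thesis using R eR by (simp add: p_def add.commute)
  qed
  have pp: "p i \<cdot> (p i \<cdot> w) = p i \<cdot> w" for i w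
    by (rule projections_idem[OF pP])
  have sp: "self_adjoint (p i)" for i by (rule projections_self_adjoint[OF pP])
  have com: "p i \<cdot> (p j \<cdot> w) = p j \<cdot> (p i \<cdot> w)" if ij: "i \<noteq> j" for i j w
  proof -
    obtain a b where ab: "dd (e i) (e j) = dyad a - dyad b" "p i \<cdot> a = a" "p i \<cdot> b = 0"
      using fs[OF ij] by metis
    have D: "p j \<cdot> z = p i \<cdot> z - (cinner z a *\<^sub>C a - cinner z b *\<^sub>C b)" for z
      using arg_cong[OF ab(1)[unfolded dp], of "\<lambda>B. B \<cdot> z"] by (simp add: blinfun.diff_left algebra_simps)
    have "cinner (p i \<cdot> w) a = cinner w a" "cinner (p i \<cdot> w) b = 0"
      by (simp_all add: self_adjointD[OF sp] ab)
    then show ?thesis unfolding D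
      by (simp add: blinfun.diff_right self_adjoint_scaleC[OF sp] ab pp)
  qed
  have "\<forall>i. \<exists>u v. i > 0 \<longrightarrow> norm u = 1 \<and> norm v = 1 \<and> cinner u v = 0 \<and> dd (e 0) (e i) = dyad u - dyad v \<and>
      p 0 \<cdot> u = u \<and> p 0 \<cdot> v = 0"
    using fs[of 0] by (metis less_numeral_extra(3))
  from choice[OF this] obtain u where "\<forall>i. \<exists>v. i > 0 \<longrightarrow> norm (u i) = 1 \<and> norm v = 1 \<and> cinner (u i) v = 0 \<and>
      dd (e 0) (e i) = dyad (u i) - dyad v \<and> p 0 \<cdot> u i = u i \<and> p 0 \<cdot> v = 0"
    by (elim exE)
  from choice[OF this] obtain v where "\<forall>i. i > 0 \<longrightarrow> norm (u i) = 1 \<and> norm (v i) = 1 \<and> cinner (u i) (v i) = 0 \<and>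
      dd (e 0) (e i) = dyad (u i) - dyad (v i) \<and> p 0 \<cdot> u i = u i \<and> p 0 \<cdot> v i = 0"
    by (elim exE)
  then have uv: "norm (u i) = 1" "norm (v i) = 1" "cinner (u i) (v i) = 0"
    "dd (e 0) (e i) = dyad (u i) - dyad (v i)" "p 0 \<cdot> u i = u i" "p 0 \<cdot> v i = 0"
    if "i > 0" for i using that by blast+
  have pi: "p i = p 0 - dyad (u i) + dyad (v i)" if "i > 0" for i
    using uv(4)[OF that] unfolding dp by (simp add: algebra_simps)
  have du: "(dyad (u i)) \<cdot> w = p 0 \<cdot> w - p 0 \<cdot> (p i \<cdot> w)" if i: "i > 0" for i w
    unfolding pi[OF i] by (simp add: blinfun.add_left blinfun.diff_left blinfun.add_right blinfun.diff_right pp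
      self_adjoint_scaleC[OF sp] uv(5,6)[OF i])
  have dv: "(dyad (v i)) \<cdot> w = p i \<cdot> w - p 0 \<cdot> (p i \<cdot> w)" if i: "i > 0" for i w
  proof -
    have "(dyad (v i)) \<cdot> w = p i \<cdot> w - p 0 \<cdot> w + (dyad (u i)) \<cdot> w"
      unfolding pi[OF i] by (simp add: blinfun.add_left blinfun.diff_left)
    then show ?thesis unfolding du[OF i] by simp
  qed
  have c0: "p i \<cdot> (p 0 \<cdot> w) = p 0 \<cdot> (p i \<cdot> w)" if "i > 0" for i w
    using com[of i 0 w] that by simp
  have u_alt: "cinner (u i) (u j) = 0 \<or> dyad (u i) = dyad (u j)" if "i > 0" "j > 0" "i \<noteq> j" for i j
  proof (rule commuting_dyads[OF uv(1)[OF that(1)] uv(1)[OF that(2)]])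
    fix w
    show "(dyad (u i)) \<cdot> ((dyad (u j)) \<cdot> w) = (dyad (u j)) \<cdot> ((dyad (u i)) \<cdot> w)"
      unfolding du[OF that(1)] du[OF that(2)] blinfun.diff_right c0[OF that(1)] c0[OF that(2)] pp com[OF that(3)]
      by (simp add: algebra_simps)
  qed
  have v_alt: "cinner (v i) (v j) = 0 \<or> dyad (v i) = dyad (v j)" if "i > 0" "j > 0" "i \<noteq> j" for i j
  proof (rule commuting_dyads[OF uv(2)[OF that(1)] uv(2)[OF that(2)]])
    fix w
    show "(dyad (v i)) \<cdot> ((dyad (v j)) \<cdot> w) = (dyad (v j)) \<cdot> ((dyad (v i)) \<cdot> w)"
      unfolding dv[OF that(1)] dv[OF that(2)] blinfun.diff_right c0[OF that(1)] c0[OF that(2)] pp com[OF that(3)]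
      by (simp add: algebra_simps)
  qed
  have uv0: "cinner (u i) (v j) = 0" "cinner (v j) (u i) = 0" if "i > 0" "j > 0" for i j
  proof -
    have "cinner (u i) (v j) = cinner (p 0 \<cdot> u i) (v j)" by (simp add: uv(5)[OF that(1)])
    also have "\<dots> = 0" by (simp add: self_adjointD[OF sp] uv(6)[OF that(2)])
    finally show "cinner (u i) (v j) = 0" .
    then show "cinner (v j) (u i) = 0" by (simp add: cinner_sym_0[of "v j"])
  qed
  have exactly_one: "dyad (u i) = dyad (u j) \<longleftrightarrow> dyad (v i) \<noteq> dyad (v j)" if ij: "i > 0" "j > 0" "i \<noteq> j" for i j
  proof
    assume a: "dyad (u i) = dyad (u j)"
    show "dyad (v i) \<noteq> dyad (v j)"
    proof
      assume "dyad (v i) = dyad (v j)"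
      then have "dd (e i) (e j) = 0" unfolding dp pi[OF ij(1)] pi[OF ij(2)] a by simp
      then show False using dd_neq_0[OF en en eo[OF ij(3)]] by blast
    qed
  next
    assume a: "dyad (v i) \<noteq> dyad (v j)"
    show "dyad (u i) = dyad (u j)"
    proof (rule ccontr)
      assume b: "dyad (u i) \<noteq> dyad (u j)"
      have o: "cinner (v i) (v j) = 0" "cinner (u j) (u i) = 0"
        using v_alt[OF ij] u_alt[OF ij] a b by (auto simp: cinner_sym_0[of "u j"])
      have D: "dd (e i) (e j) = dyad (v i) - dyad (u i) + dyad (u j) - dyad (v j)"
        unfolding dp pi[OF ij(1)] pi[OF ij(2)] by simp
      have "(dd (e i) (e j)) \<cdot> v i = complex_of_real 1 *\<^sub>C v i"
        "(dd (e i) (e j)) \<cdot> u j = complex_of_real 1 *\<^sub>C u j"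
        unfolding D using uv(1,2) ij o uv0
        by (simp_all add: blinfun.add_left blinfun.diff_left norm_eq_1_iff_cinner)
      then show False
        using positive_eigenvector_unique[OF en en eo[OF ij(3)] uv(2)[OF ij(1)] _ _ uv(1)[OF ij(2)]] uv0(2)[OF ij(2,1)]
        by (metis zero_less_one)
    qed
  qed
  have all_eq: "dyad (u i) = dyad (u j)" if ij: "i > 0" "j > 0" for i j
  proof (rule ccontr)
    assume ne: "dyad (u i) \<noteq> dyad (u j)"
    have all_ne: "dyad (u l) \<noteq> dyad (u l')" if "l > 0" "l' > 0" "l \<noteq> l'" for l l'
      using exactly_one ne that ij by metis
    obtain X where X: "finite X" "p 0 = (\<Sum>x\<in>X. dyad x)" using projections_decomposition[OF pP] by metis
    have "finite (u ` {0<..})"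
    proof (rule orthonormal_finite_of_span[THEN conjunct1])
      show "orthonormal (u ` {0<..})" unfolding orthonormal_def
      proof (intro ballI)
        fix s t assume "s \<in> u ` {0<..}" "t \<in> u ` {0<..}"
        then obtain l l' where l: "l > 0" "l' > 0" "s = u l" "t = u l'" by auto
        show "cinner s t = (if s = t then 1 else 0)"
        proof (cases "l = l'")
          case True
          then show ?thesis using l uv(1) by (simp add: norm_eq_1_iff_cinner)
        next
          case False
          then have "dyad (u l) \<noteq> dyad (u l')" using all_ne l by blast
          then show ?thesis using u_alt[OF l(1,2) False] l by auto
        qed
      qed
      show "u ` {0<..} \<subseteq> cspan X"
      proof (rule image_subsetI)
        fix l :: nat assume "l \<in> {0<..}"
        then have "u l = p 0 \<cdot> u l" using uv(5)[of l] by simp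
        also have "\<dots> \<in> cspan X" unfolding X(2) blinfun.sum_left dyad_apply
          by (intro complex_vector.span_sum complex_vector.span_scale complex_vector.span_base)
        finally show "u l \<in> cspan X" .
      qed
    qed (rule X(1))
    moreover have "inj_on u {0<..}" using all_ne by (metis greaterThan_iff inj_onI)
    ultimately have "finite {(0::nat)<..}" using finite_imageD by blast
    then show False using infinite_Ioi by blast
  qed
  show thesis
  proof (rule that[of "u 1"])
    show "norm (u 1) = 1" using uv(1) by simp
    fix i :: nat assume i: "i > 0"
    have "dd (e 0) (e i) = dyad (u 1) - dyad (v i)" using uv(4)[OF i] all_eq[OF i, of 1] by simp
    then show "\<exists>v. norm v = 1 \<and> cinner (u 1) v = 0 \<and> dd (e 0) (e i) = dyad (u 1) - dyad v"
      using uv(2)[OF i] uv0(1)[of 1 i] i by (intro exI[of _ "v i"] conjI) simp_all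
  qed
qed

text \<open>Both \<open>y\<close> and \<open>y'\<close> belong to one orthonormal sequence that starts with \<open>x\<close>.\<close>

lemma positive_line_independent_orthogonal:
  assumes x: "norm x = 1" and y: "norm y = 1" "cinner x y = 0" and y': "norm y' = 1" "cinner x y' = 0"
    and yy': "cinner y y' = 0"
    and uv: "norm u = 1" "norm v = 1" "cinner u v = 0" "dd x y = dyad u - dyad v"
    and uv': "norm u' = 1" "norm v' = 1" "cinner u' v' = 0" "dd x y' = dyad u' - dyad v'"
  shows "dyad u = dyad u'"
proof -
  have on: "orthonormal {x, y, y'}"
    using x y y' yy' by (intro orthonormal_insert) auto
  have ne: "x \<noteq> y" "x \<noteq> y'" "y \<noteq> y'" using orthonormal_pair_neq x y y' yy' by metis+
  obtain f :: "nat \<Rightarrow> 'a" where f: "inj f" "range f \<inter> {x, y, y'} = {}" "orthonormal ({x, y, y'} \<union> range f)"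
    using infinite_orthonormal_sequence[OF infinite_dim _ on] by blast
  have fin: "f i = f j \<longleftrightarrow> i = j" for i j using f(1) by (simp add: inj_eq)
  have fx: "f i \<noteq> x" "f i \<noteq> y" "f i \<noteq> y'" "x \<noteq> f i" "y \<noteq> f i" "y' \<noteq> f i" for i using f(2) by blast+
  \<comment> \<open>The vectors \<open>f 0, \<dots>, f (k - 2)\<close> are reserved for the common part \<open>R\<close> of the frames.\<close>
  define e where "e n = (if n = 0 then x else if n = 1 then y else if n = 2 then y' else f (n + k))" for n
  define R where "R = f ` {..<k - 1}"
  have "inj e"
    by (rule injI) (use ne fx in \<open>auto simp: e_def fin split: if_splits\<close>)
  moreover have "range e \<inter> R = {}" using fx by (auto simp: e_def R_def fin split: if_splits)
  moreover have "orthonormal (R \<union> range e)"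
    by (rule orthonormal_subset[OF f(3)]) (auto simp: e_def R_def)
  moreover have "finite R" "card R = k - 1" by (simp_all add: R_def card_image inj_on_def fin)
  ultimately obtain t where t: "norm t = 1"
    "\<And>i. i > 0 \<Longrightarrow> \<exists>v. norm v = 1 \<and> cinner t v = 0 \<and> dd (e 0) (e i) = dyad t - dyad v"
    using common_positive_line by metis
  obtain s where s: "norm s = 1" "cinner t s = 0" "dd x y = dyad t - dyad s"
    using t(2)[of 1] by (auto simp: e_def)
  obtain s' where s': "norm s' = 1" "cinner t s' = 0" "dd x y' = dyad t - dyad s'"
    using t(2)[of 2] by (auto simp: e_def)
  have "dyad u = dyad t" using dyad_difference_unique(1)[OF uv(1-3) t(1) s(1,2)] uv(4) s(3) by simp
  moreover have "dyad u' = dyad t" using dyad_difference_unique(1)[OF uv'(1-3) t(1) s'(1,2)] uv'(4) s'(3) by simp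
  ultimately show ?thesis by simp
qed

lemma dd_split:
  assumes xy: "norm x = 1" "norm y = 1" "cinner x y = 0"
  obtains u v where "norm u = 1" "norm v = 1" "cinner u v = 0" "dd x y = dyad u - dyad v"
proof -
  obtain R where R: "finite R" "card R = k - 1" "x \<notin> R" "y \<notin> R" "orthonormal (insert x (insert y R))"
    using frame_complement_exists[OF xy] by metis
  show thesis by (rule frame_structure[OF xy R], rule that)
qed

text \<open>Vectors \<open>y\<close> and \<open>z\<close> that need not be orthogonal are compared through a vector \<open>y'\<close> orthogonal to both.\<close>

lemma positive_line_exists:
  assumes x: "norm x = 1"
  shows "\<exists>u. norm u = 1 \<and> (\<forall>y. norm y = 1 \<longrightarrow> cinner x y = 0 \<longrightarrow>
    (\<exists>v. norm v = 1 \<and> cinner u v = 0 \<and> dd x y = dyad u - dyad v))"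
proof -
  obtain z where z: "norm z = 1" "cinner x z = 0"
    using unit_vector_orthogonal_to_finite[OF infinite_dim, of "{x}"] by auto
  obtain u s where u: "norm u = 1" "norm s = 1" "cinner u s = 0" "dd x z = dyad u - dyad s"
    using dd_split[OF x z] by metis
  have "\<exists>v. norm v = 1 \<and> cinner u v = 0 \<and> dd x y = dyad u - dyad v" if y: "norm y = 1" "cinner x y = 0" for y
  proof -
    obtain y' where y': "norm y' = 1" "cinner x y' = 0" "cinner y y' = 0" "cinner z y' = 0"
      using unit_vector_orthogonal_to_finite[OF infinite_dim, of "{x, y, z}"] by auto
    obtain a b where ab: "norm a = 1" "norm b = 1" "cinner a b = 0" "dd x y' = dyad a - dyad b"
      using dd_split[OF x y'(1,2)] by metis
    obtain c d where cd: "norm c = 1" "norm d = 1" "cinner c d = 0" "dd x y = dyad c - dyad d"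
      using dd_split[OF x y] by metis
    have "dyad u = dyad a" by (rule positive_line_independent_orthogonal[OF x z y'(1,2) y'(4) u ab])
    moreover have "dyad c = dyad a" by (rule positive_line_independent_orthogonal[OF x y y'(1,2) y'(3) cd ab])
    ultimately have uc: "dyad u = dyad c" by simp
    have "cinner u d = 0" by (subst dyad_eqD[OF u(1) uc]) (simp add: cinner_scaleC_left cd(3))
    then show ?thesis using cd uc by auto
  qed
  then show ?thesis using u(1) by blast
qed

text \<open>A unit vector on the part of the image of \<open>x x\<^sup>*\<close> that varies with \<open>x\<close>. Only its line is determined;
  no coherent choice of phases is made here.\<close>

definition g :: "'a \<Rightarrow> 'b" where
  "g x = (SOME u. norm u = 1 \<and> (\<forall>y. norm y = 1 \<longrightarrow> cinner x y = 0 \<longrightarrow>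
    (\<exists>v. norm v = 1 \<and> cinner u v = 0 \<and> dd x y = dyad u - dyad v)))"

lemma g_props:
  assumes "norm x = 1"
  shows "norm (g x) = 1"
    and "norm y = 1 \<Longrightarrow> cinner x y = 0 \<Longrightarrow> \<exists>v. norm v = 1 \<and> cinner (g x) v = 0 \<and> dd x y = dyad (g x) - dyad v"
  using someI_ex[OF positive_line_exists[OF assms]] unfolding g_def[symmetric] by blast+

lemma dd_eq_g:
  assumes xy: "norm x = 1" "norm y = 1" "cinner x y = 0"
  shows "dd x y = dyad (g x) - dyad (g y)" and "cinner (g x) (g y) = 0"
proof -
  have yx: "cinner y x = 0" using xy(3) by (simp add: cinner_sym_0[of y])
  obtain v where v: "norm v = 1" "cinner (g x) v = 0" "dd x y = dyad (g x) - dyad v"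
    using g_props(2)[OF xy] by blast
  obtain w where w: "norm w = 1" "cinner (g y) w = 0" "dd y x = dyad (g y) - dyad w"
    using g_props(2)[OF xy(2,1) yx] by blast
  have "dyad (g x) - dyad v = dyad w - dyad (g y)"
  proof -
    have "dyad (g x) - dyad v = - dd y x" unfolding v(3)[symmetric] by simp
    then show ?thesis unfolding w(3) by simp
  qed
  moreover have "cinner w (g y) = 0" using w(2) by (simp add: cinner_sym_0[of w])
  ultimately have vg: "dyad v = dyad (g y)"
    using dyad_difference_unique(2)[OF g_props(1)[OF xy(1)] v(1,2) w(1) g_props(1)[OF xy(2)]] by blast
  then show "dd x y = dyad (g x) - dyad (g y)" using v(3) by simp
  show "cinner (g x) (g y) = 0"
    by (subst dyad_eqD[OF g_props(1)[OF xy(2)] vg[symmetric]]) (simp add: cinner_scaleC_right v(2))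
qed

lemma g_frame:
  assumes "finite X" "orthonormal X"
  shows "inj_on g X" and "orthonormal (g ` X)"
proof -
  have n: "norm (g x) = 1" if "x \<in> X" for x
    using g_props(1) orthonormal_norm[OF assms(2) that] by blast
  have o: "cinner (g x) (g y) = 0" if "x \<in> X" "y \<in> X" "x \<noteq> y" for x y
    using dd_eq_g(2) orthonormal_norm[OF assms(2)] orthonormalD[OF assms(2) that(1,2)] that by metis
  then show "inj_on g X" using n by (metis (no_types, lifting) inj_onI orthonormal_pair_neq)
  show "orthonormal (g ` X)" unfolding orthonormal_def
    using n o by (auto simp: norm_eq_1_iff_cinner)
qed

section \<open>The common part of the images\<close>

text \<open>By \<open>L_dyad_unit\<close>, the choice of the unit vector does not matter.\<close>

definition V :: "'b \<Rightarrow>\<^sub>L 'b" where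
  "V = (let x = SOME x. norm x = 1 in L (dyad x) - dyad (g x))"

text \<open>For orthogonal unit vectors this is \<open>dd_eq_g\<close>; any two unit vectors have a common orthogonal one.\<close>

lemma L_dyad_unit:
  assumes x: "norm x = 1"
  shows "L (dyad x) = dyad (g x) + V"
proof -
  define y where "y = (SOME x::'a. norm x = 1)"
  have y: "norm y = 1" unfolding y_def by (rule someI[of "\<lambda>x. norm x = 1", OF x])
  have V: "V = L (dyad y) - dyad (g y)" by (simp add: V_def y_def Let_def)
  obtain z where z: "norm z = 1" "cinner x z = 0" "cinner y z = 0"
    using unit_vector_orthogonal_to_finite[OF infinite_dim, of "{x, y}"] by auto
  have "L (dyad x) - L (dyad y) = dyad (g x) - dyad (g y)"
  proof -
    have "L (dyad x) - L (dyad y) = dd x z - dd y z" by simp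
    then show ?thesis unfolding dd_eq_g(1)[OF x z(1,2)] dd_eq_g(1)[OF y z(1,3)] by simp
  qed
  then show ?thesis unfolding V by (simp add: algebra_simps)
qed

text \<open>The part common to the images of all rank \<open>k\<close> projections.\<close>

definition K :: "'b \<Rightarrow>\<^sub>L 'b" where "K = real k *\<^sub>R V"

lemma L_dyad_unit_K:
  assumes "norm x = 1"
  shows "L (dyad x) = dyad (g x) + (1 / real k) *\<^sub>R K"
  using L_dyad_unit[OF assms] k_pos by (simp add: K_def)

lemma unit_exists: "\<exists>x::'a. norm x = 1"
  using unit_vector_orthogonal_to_finite[OF infinite_dim, of "{}"] by blast

lemma K_fin_rank: "K \<in> fin_rank_sa"
proof -
  obtain x :: 'a where x: "norm x = 1" using unit_exists by blast
  have "V = L (dyad x) - dyad (g x)" using L_dyad_unit[OF x] by simp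
  then show ?thesis by (simp add: K_def)
qed

lemma frame_image:
  assumes X: "finite X" "orthonormal X" "card X = k"
  shows "(\<Sum>y\<in>g ` X. dyad y) + K \<in> projections m"
proof -
  have "(\<Sum>x\<in>X. L (dyad x)) = (\<Sum>x\<in>X. dyad (g x) + V)"
    using L_dyad_unit orthonormal_norm[OF X(2)] by (intro sum.cong) auto
  also have "\<dots> = (\<Sum>y\<in>g ` X. dyad y) + K"
    using X by (simp add: sum.distrib K_def sum_constant_scaleR sum.reindex[OF g_frame(1)])
  finally show ?thesis using frame_projection[OF X] by simp
qed

text \<open>For orthogonal frames the projections \<open>\<Gamma>\<^sub>i\<close> onto the spans of their images under \<open>g\<close> are
  orthogonal, while \<open>(\<Gamma>\<^sub>i + K)\<^sup>2 = \<Gamma>\<^sub>i + K\<close> says that \<open>\<Gamma>\<^sub>i K + K \<Gamma>\<^sub>i\<close> does not depend on \<open>i\<close>. Three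
  frames suffice to conclude that \<open>\<Gamma>\<^sub>0 K = 0\<close>.\<close>

lemma K_frame:
  assumes x: "norm x = 1"
  obtains X where "finite X" "orthonormal X" "card X = k" "x \<in> X"
    "\<And>w. (\<Sum>y\<in>g ` X. dyad y) \<cdot> (K \<cdot> w) = 0"
proof -
  have on: "orthonormal {x}" using x by (simp add: orthonormal_def norm_eq_1_iff_cinner)
  obtain f :: "nat \<Rightarrow> 'a" where f: "inj f" "range f \<inter> {x} = {}" "orthonormal ({x} \<union> range f)"
    using infinite_orthonormal_sequence[OF infinite_dim _ on] by blast
  define e where "e n = (if n = 0 then x else f n)" for n
  have fin: "f i = f j \<longleftrightarrow> i = j" for i j using f(1) by (simp add: inj_eq)
  have fx: "f i \<noteq> x" "x \<noteq> f i" for i using f(2) by blast+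
  have ein: "e i = e j \<longleftrightarrow> i = j" for i j by (simp add: e_def fin fx)
  have one: "orthonormal (e ` I)" for I by (rule orthonormal_subset[OF f(3)]) (auto simp: e_def)
  \<comment> \<open>Consecutive blocks of \<open>k\<close> vectors are mutually orthogonal frames.\<close>
  define X where "X i = e ` {i * k..<Suc i * k}" for i
  have Xf: "finite (X i)" "orthonormal (X i)" "card (X i) = k" for i
    unfolding X_def using one by (simp_all add: card_image inj_on_def ein)
  have Xdisj: "X i \<inter> X j = {}" if "i \<noteq> j" for i j
  proof -
    have "n div k = i" if "n \<in> {i * k..<Suc i * k}" for n i
      using that k_pos by (simp add: div_nat_eqI mult.commute)
    then have "{i * k..<Suc i * k} \<inter> {j * k..<Suc j * k} = {}" using that by blast
    then show ?thesis unfolding X_def by (auto simp: ein)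
  qed
  define G where "G i = (\<Sum>y\<in>g ` X i. dyad y)" for i
  have Gap: "G i \<cdot> w = (\<Sum>y\<in>g ` X i. cinner w y *\<^sub>C y)" for i w
    by (simp add: G_def blinfun.sum_left)
  have GP: "G i \<in> projections k" for i
    using sum_dyads_in_projections[OF _ g_frame(2)[OF Xf(1,2)]] Xf g_frame(1)[OF Xf(1,2)]
    unfolding G_def by (metis card_image finite_imageI)
  have idem: "G i \<cdot> (G i \<cdot> w) = G i \<cdot> w" for i w
    by (rule projections_idem[OF GP])
  have GG: "G i \<cdot> (G j \<cdot> w) = 0" if ij: "i \<noteq> j" for i j w
  proof -
    have "cinner (g b) (g a) = 0" if "a \<in> X i" "b \<in> X j" for a b
    proof (rule dd_eq_g(2))
      show "norm b = 1" "norm a = 1" using orthonormal_norm[OF Xf(2)] that by blast+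
      have "a \<noteq> b" using Xdisj[OF ij] that by blast
      then show "cinner b a = 0" using orthonormalD[OF one[of UNIV], of b a] that by (auto simp: X_def)
    qed
    then have "cinner (G j \<cdot> w) y = 0" if "y \<in> g ` X i" for y
      unfolding Gap using that by (auto simp: cinner_sum_left cinner_scaleC_left intro!: sum.neutral)
    then show ?thesis unfolding Gap[of i] by simp
  qed
  have KG: "acomm (G i) K = K - (1/2) *\<^sub>R acomm K K" for i
  proof -
    have "acomm (G i + K) (G i + K) = (G i + K) + (G i + K)"
      using projections_acomm[OF frame_image[OF Xf]] unfolding G_def .
    then have "2 *\<^sub>R acomm (G i) K + acomm K K = 2 *\<^sub>R K"
      using projections_acomm[OF GP[of i]] by (simp add: acomm_simps acomm_commute[of K "G i"] scaleR_2 algebra_simps)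
    then have "2 *\<^sub>R acomm (G i) K = 2 *\<^sub>R K - acomm K K" by (simp add: algebra_simps)
    then have "(1/2) *\<^sub>R (2 *\<^sub>R acomm (G i) K) = (1/2) *\<^sub>R (2 *\<^sub>R K - acomm K K)" by simp
    then show ?thesis by (simp add: scaleR_diff_right)
  qed
  have sw: "G i \<cdot> (K \<cdot> w) + K \<cdot> (G i \<cdot> w)
      = G j \<cdot> (K \<cdot> w) + K \<cdot> (G j \<cdot> w)" for i j w
    using KG[of i] KG[of j] by (metis acomm_apply)
  \<comment> \<open>Three instances: \<open>\<Gamma>\<^sub>0 K \<Gamma>\<^sub>0\<close>, \<open>\<Gamma>\<^sub>0 K \<Gamma>\<^sub>1\<close> and \<open>\<Gamma>\<^sub>0 K\<close> vanish, one after the other.\<close>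
  have a: "G 0 \<cdot> (K \<cdot> (G 0 \<cdot> w)) = 0" for w
  proof -
    have "2 *\<^sub>R G 0 \<cdot> (K \<cdot> (G 0 \<cdot> w)) = 0"
      using arg_cong[OF sw[of 0 "G 0 \<cdot> w" 1], of "blinfun_apply (G 0)"]
      by (simp add: blinfun.add_right idem GG blinfun.zero_right scaleR_2)
    then show ?thesis by simp
  qed
  have b: "G 0 \<cdot> (K \<cdot> (G 1 \<cdot> w)) = 0" for w
    using arg_cong[OF sw[of 0 "G 1 \<cdot> w" 2], of "blinfun_apply (G 0)"]
    by (simp add: blinfun.add_right idem GG blinfun.zero_right)
  have c: "G 0 \<cdot> (K \<cdot> w) = 0" for w
    using arg_cong[OF sw[of 0 w 1], of "blinfun_apply (G 0)"]
    by (simp add: blinfun.add_right idem GG a b[unfolded One_nat_def] blinfun.zero_right)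
  show thesis
  proof (rule that[OF Xf[of 0]])
    show "x \<in> X 0" using k_pos by (auto simp: X_def e_def intro!: image_eqI[of _ _ 0])
    show "(\<Sum>y\<in>g ` X 0. dyad y) \<cdot> (K \<cdot> w) = 0" for w
      using c unfolding G_def .
  qed
qed

lemma K_self_adjoint: "self_adjoint K"
  by (rule fin_rank_sa_self_adjoint[OF K_fin_rank])

lemma K_g:
  assumes "norm x = 1"
  shows "K \<cdot> g x = 0"
proof -
  obtain X where X: "finite X" "orthonormal X" "card X = k" "x \<in> X"
    "\<And>w. (\<Sum>y\<in>g ` X. dyad y) \<cdot> (K \<cdot> w) = 0"
    using K_frame[OF assms] by metis
  show ?thesis
  proof (rule cinner_ext)
    fix z
    have "cinner (\<Sum>y\<in>g ` X. cinner (K \<cdot> z) y *\<^sub>C y) (g x) = cinner (K \<cdot> z) (g x)"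
      by (rule orthonormal_coeff[OF g_frame(2)[OF X(1,2)]]) (use X in auto)
    moreover have "(\<Sum>y\<in>g ` X. cinner (K \<cdot> z) y *\<^sub>C y) = 0"
      using X(5)[of z] by (simp add: blinfun.sum_left)
    ultimately have "cinner (K \<cdot> z) (g x) = 0" by simp
    then show "cinner (K \<cdot> g x) z = cinner 0 z"
      by (simp add: self_adjointD[OF K_self_adjoint] cinner_sym_0[of "g x"])
  qed
qed

text \<open>With \<open>\<Gamma> K = K \<Gamma> = 0\<close>, idempotence of \<open>\<Gamma> + K\<close> is idempotence of \<open>K\<close>, and the ranks add up to \<open>m\<close>.\<close>

lemma K_projection: "K \<in> projections (m - k)"
proof -
  obtain x :: 'a where x: "norm x = 1" using unit_exists by blast
  obtain X where X: "finite X" "orthonormal X" "card X = k" "x \<in> X"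
    "\<And>w. (\<Sum>y\<in>g ` X. dyad y) \<cdot> (K \<cdot> w) = 0"
    using K_frame[OF x] by metis
  define G where "G = (\<Sum>y\<in>g ` X. dyad y)"
  have gX: "finite (g ` X)" "orthonormal (g ` X)" "card (g ` X) = k"
    using X g_frame[OF X(1,2)] by (simp_all add: card_image)
  have Kg0: "K \<cdot> y = 0" if "y \<in> g ` X" for y
    using that K_g orthonormal_norm[OF X(2)] by auto
  have saK: "self_adjoint K" by (rule K_self_adjoint)
  have KG: "K \<cdot> (G \<cdot> w) = 0" for w
    by (simp add: G_def blinfun.sum_left blinfun.sum_right self_adjoint_scaleC[OF saK] Kg0)
  have GK: "G \<cdot> (K \<cdot> w) = 0" for w using X(5) unfolding G_def .
  have P: "G + K \<in> projections m" unfolding G_def by (rule frame_image[OF X(1-3)])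
  have GP: "G \<in> projections k" using sum_dyads_in_projections[OF gX(1,2)] gX(3) by (simp add: G_def)
  have KK: "K \<cdot> (K \<cdot> w) = K \<cdot> w" for w
    using projections_idem[OF P, of w] projections_idem[OF GP, of w]
    by (simp add: blinfun.add_left blinfun.add_right KG GK)
  obtain j where "ecdim (range (blinfun_apply K)) = enat j"
    using K_fin_rank by (auto simp: fin_rank_sa_def less_infinityE)
  then have Kj: "K \<in> projections j"
    using KK saK by (auto simp: projections_def intro!: blinfun_eqI)
  obtain Y where Y: "finite Y" "orthonormal Y" "card Y = j" "K = (\<Sum>y\<in>Y. dyad y)"
    using projections_decomposition[OF Kj] by metis
  have Kfix: "K \<cdot> y = y" if "y \<in> Y" for y
    using sum_dyads_eigen[OF Y(2,1) that, of "\<lambda>_. 1"] by (simp add: Y(4) scaleC_one)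
  have ort: "cinner z y = 0" if "z \<in> g ` X" "y \<in> Y" for z y
  proof -
    have "cinner z y = cinner (K \<cdot> z) y"
      using Kfix[OF that(2)] by (simp add: self_adjointD[OF saK])
    then show ?thesis using Kg0[OF that(1)] by simp
  qed
  have ne: "z \<noteq> y" if "z \<in> g ` X" "y \<in> Y" for z y
    using ort[OF that] orthonormal_norm[OF Y(2) that(2)] by (auto simp: norm_eq_1_iff_cinner)
  have "orthonormal (g ` X \<union> Y)"
    unfolding orthonormal_def
  proof (intro ballI)
    fix s t assume "s \<in> g ` X \<union> Y" "t \<in> g ` X \<union> Y"
    then show "cinner s t = (if s = t then 1 else 0)"
      using orthonormalD[OF gX(2), of s t] orthonormalD[OF Y(2), of s t] ort[of s t] ort[of t s] ne[of s t] ne[of t s]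
        cinner_sym_0[of s t] by (elim UnE) simp_all
  qed
  moreover have "g ` X \<inter> Y = {}" using ne by blast
  ultimately have "(\<Sum>y\<in>g ` X. dyad y) + (\<Sum>y\<in>Y. dyad y) \<in> projections (k + j)"
    using sum_dyads_in_projections[of "g ` X \<union> Y"] gX Y(1,3)
    by (simp add: card_Un_disjoint sum.union_disjoint)
  then have "G + K \<in> projections (k + j)" by (simp add: G_def Y(4))
  then have "m = k + j" using P by (simp add: projections_def)
  then show ?thesis using Kj by simp
qed

section \<open>A linear form of Wigner's theorem\<close>

text \<open>A base vector and its image; they fix the phases of the isometry.\<close>

definition e0 :: 'a where "e0 = (SOME x. norm x = 1)"

definition f0 :: 'b where "f0 = g e0"

lemma norm_e0: "norm e0 = 1"
  unfolding e0_def by (rule someI_ex[OF unit_exists])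

lemma norm_f0: "norm f0 = 1"
  unfolding f0_def by (rule g_props(1)[OF norm_e0])

text \<open>If \<open>U\<close> is the isometry to be found and \<open>U e\<^sub>0 = f\<^sub>0\<close>, then \<open>x e\<^sub>0\<^sup>* + e\<^sub>0 x\<^sup>*\<close> has to be sent
  to \<open>(U x) f\<^sub>0\<^sup>* + f\<^sub>0 (U x)\<^sup>*\<close>, which determines \<open>U x\<close> for \<open>x\<close> orthogonal to \<open>e\<^sub>0\<close>.\<close>

definition h :: "'a \<Rightarrow> 'b" where "h x = (L (sdyad x e0)) \<cdot> f0"

lemma h_add: "h (x + y) = h x + h y"
  by (simp add: h_def sdyad_commute[of _ e0] sdyad_add_right L_add blinfun.add_left)

lemma h_scaleR: "h (r *\<^sub>R x) = r *\<^sub>R h x"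
  by (simp add: h_def sdyad_commute[of _ e0] sdyad_scaleR_right L_scaleR blinfun.scaleR_left)

text \<open>The image of the off-diagonal Pauli matrix anticommutes with \<open>g(x) g(x)\<^sup>* - f\<^sub>0 f\<^sub>0\<^sup>*\<close> and has the same
  square. So it exchanges the lines of \<open>f\<^sub>0\<close> and \<open>g(x)\<close> isometrically and vanishes on their complement.\<close>

lemma h_unit:
  assumes x: "norm x = 1" "cinner x e0 = 0"
  shows "norm (h x) = 1" and "cinner (h x) f0 = 0" and "dyad (h x) = dyad (g x)"
    and "L (sdyad x e0) = sdyad (h x) f0"
proof -
  note ax = x(1) norm_e0 x(2)
  define M where "M = L (sdyad x e0)"
  have saM: "self_adjoint M" by (simp add: M_def L_self_adjoint)
  have D: "dd x e0 = dyad (g x) - dyad f0" and gf: "cinner (g x) f0 = 0"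
    using dd_eq_g[OF ax] by (simp_all add: f0_def)
  have gg: "cinner (g x) (g x) = 1" "cinner f0 f0 = 1" "cinner f0 (g x) = 0"
    using g_props(1)[OF x(1)] norm_f0 gf by (simp_all add: norm_eq_1_iff_cinner cinner_sym_0[of f0])
  have DM: "dd x e0 \<cdot> (M \<cdot> w) = - M \<cdot> (dd x e0 \<cdot> w)" for w
    unfolding M_def by (rule acomm_0_apply[OF pauli_anticommute_diagonal[OF ax]])
  have MM: "M \<cdot> (M \<cdot> w) = dd x e0 \<cdot> (dd x e0 \<cdot> w)" for w
    unfolding M_def by (rule acomm_square_apply[OF pauli_square[OF ax]])
  have Df: "dd x e0 \<cdot> f0 = - f0" unfolding D by (simp add: blinfun.diff_left gg scaleC_one)
  have hM: "h x = M \<cdot> f0" by (simp add: h_def M_def)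
  have "dd x e0 \<cdot> h x = h x"
    unfolding hM DM Df by (simp add: blinfun.minus_right)
  then have e: "cinner (h x) (g x) *\<^sub>C g x - cinner (h x) f0 *\<^sub>C f0 = h x"
    unfolding D by (simp add: blinfun.diff_left)
  then have "cinner (cinner (h x) (g x) *\<^sub>C g x - cinner (h x) f0 *\<^sub>C f0) f0 = cinner (h x) f0" by simp
  then show hf: "cinner (h x) f0 = 0" by (simp add: cinner_simps gf gg equal_neg_zero)
  have Mh: "M \<cdot> h x = f0"
    unfolding hM MM Df by (simp add: blinfun.minus_right Df)
  have "cinner (h x) (h x) = cinner f0 (M \<cdot> h x)"
    using self_adjointD[OF saM, of f0 "h x"] by (simp only: hM)
  then show nh: "norm (h x) = 1" unfolding Mh by (simp add: norm_eq_1_iff_cinner gg)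
  show dh: "dyad (h x) = dyad (g x)"
    using e hf by (intro dyad_eq_of_scale[OF nh g_props(1)[OF x(1)], of "cinner (h x) (g x)"]) simp
  have D': "dd x e0 = dyad (h x) - dyad f0" using D dh by simp
  have hh: "cinner (h x) (h x) = 1" "cinner f0 (h x) = 0"
    using nh hf by (simp_all add: norm_eq_1_iff_cinner cinner_sym_0[of f0])
  have "M = sdyad (h x) f0"
  proof (rule blinfun_eqI)
    fix z
    define z' where "z' = z - cinner z f0 *\<^sub>C f0 - cinner z (h x) *\<^sub>C h x"
    have "cinner z' f0 = 0" "cinner z' (h x) = 0" by (simp_all add: z'_def cinner_simps gg hh hf)
    then have "dd x e0 \<cdot> z' = 0" unfolding D' by (simp add: blinfun.diff_left)
    then have "M \<cdot> (M \<cdot> z') = 0" unfolding MM by (simp add: blinfun.zero_right)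
    then have "cinner (M \<cdot> z') (M \<cdot> z') = 0" by (simp add: self_adjointD[OF saM])
    then have Mz': "M \<cdot> z' = 0" by simp
    have "z = cinner z f0 *\<^sub>C f0 + cinner z (h x) *\<^sub>C h x + z'" by (simp add: z'_def)
    then have "M \<cdot> z = M \<cdot> (cinner z f0 *\<^sub>C f0 + cinner z (h x) *\<^sub>C h x + z')" by simp
    also have "\<dots> = cinner z f0 *\<^sub>C h x + cinner z (h x) *\<^sub>C f0"
      by (simp add: blinfun.add_right self_adjoint_scaleC[OF saM] Mh Mz' hM[symmetric])
    finally show "M \<cdot> z = (sdyad (h x) f0) \<cdot> z" by (simp add: add.commute)
  qed
  then show "L (sdyad x e0) = sdyad (h x) f0" by (simp add: M_def)
qed

lemma h_0 [simp]: "h 0 = 0"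
  using h_scaleR[of 0 0] by simp

lemma h_orthogonal:
  assumes x: "cinner x e0 = 0"
  shows "norm (h x) = norm x" and "cinner (h x) f0 = 0"
    and "L (sdyad x e0) = sdyad (h x) f0"
    and "L (dyad x) = dyad (h x) + ((norm x)\<^sup>2 / real k) *\<^sub>R K"
    and "h (\<i> *\<^sub>C x) = \<i> *\<^sub>C h x \<or> h (\<i> *\<^sub>C x) = - (\<i> *\<^sub>C h x)"
proof -
  have all: "norm (h x) = norm x \<and> cinner (h x) f0 = 0 \<and> L (sdyad x e0) = sdyad (h x) f0 \<and>
    L (dyad x) = dyad (h x) + ((norm x)\<^sup>2 / real k) *\<^sub>R K \<and>
    (h (\<i> *\<^sub>C x) = \<i> *\<^sub>C h x \<or> h (\<i> *\<^sub>C x) = - (\<i> *\<^sub>C h x))"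
  proof (cases "x = 0")
    case True
    have z: "sdyad 0 y = 0" "dyad 0 = 0" for y :: "'c::chilbert_space"
      by (rule blinfun_eqI, simp)+
    show ?thesis by (simp add: True z)
  next
    case False
    then obtain r u where r: "r > 0" "norm u = 1" "x = r *\<^sub>R u" "r = norm x" using normalize_unit by metis
    have "complex_of_real r * cinner u e0 = cinner x e0" by (subst r(3)) (simp add: cinner_scaleR_left)
    then have ue: "cinner u e0 = 0" using x r(1) by simp
    note hu = h_unit[OF r(2) ue]
    have dr: "dyad (r *\<^sub>R y) = r\<^sup>2 *\<^sub>R dyad y" for y :: "'c::chilbert_space"
      unfolding scaleR_scaleC dyad_scaleC by simp
    have hx: "h x = r *\<^sub>R h u" unfolding r(3) by (rule h_scaleR)
    have s: "L (sdyad x e0) = sdyad (h x) f0"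
      unfolding hx r(3) sdyad_commute[of _ e0] sdyad_commute[of _ f0] sdyad_scaleR_right
      using hu(4) by (simp add: L_scaleR h_scaleR sdyad_scaleR_right sdyad_commute[of _ e0] sdyad_commute[of _ f0])
    have d: "L (dyad x) = dyad (h x) + ((norm x)\<^sup>2 / real k) *\<^sub>R K"
      unfolding hx r(3) dr using hu(3) L_dyad_unit_K[OF r(2)] r(1,2)
      by (simp add: L_scaleR h_scaleR dr scaleR_add_right)
    have iu: "norm (\<i> *\<^sub>C u) = 1" "cinner (\<i> *\<^sub>C u) e0 = 0" using r(2) ue by (simp_all add: cinner_scaleC_left)
    note hiu = h_unit[OF iu]
    \<comment> \<open>The lines of \<open>h u\<close> and \<open>h (i u)\<close> agree, so the two vectors differ by a phase. It is imaginary
      since the corresponding off-diagonal operators anticommute.\<close>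
    have "dyad (g (\<i> *\<^sub>C u)) = dyad (g u)"
      using L_dyad_unit[OF iu(1)] L_dyad_unit[OF r(2)] by (simp add: dyad_scaleC)
    then have "dyad (h (\<i> *\<^sub>C u)) = dyad (h u)" using hiu(3) hu(3) by simp
    then have hb: "h (\<i> *\<^sub>C u) = cinner (h (\<i> *\<^sub>C u)) (h u) *\<^sub>C h u" by (rule dyad_eqD[OF hiu(1)])
    define b where "b = cinner (h (\<i> *\<^sub>C u)) (h u)"
    have b: "h (\<i> *\<^sub>C u) = b *\<^sub>C h u" using hb by (simp add: b_def)
    have nb: "cmod b = 1" using hiu(1) hu(1) by (simp add: b)
    have "acomm (L (sdyad u e0)) (L (sdyad (\<i> *\<^sub>C u) e0)) = 0"
      by (rule pauli_anticommute_off_diagonal[OF r(2) norm_e0 ue])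
    then have "(sdyad (h u) f0) \<cdot> ((sdyad (b *\<^sub>C h u) f0) \<cdot> f0) =
      - (sdyad (b *\<^sub>C h u) f0) \<cdot> ((sdyad (h u) f0) \<cdot> f0)"
      unfolding hu(4) hiu(4) b by (rule acomm_0_apply)
    moreover have "cinner (h u) (h u) = 1" "cinner f0 f0 = 1" "cinner f0 (h u) = 0"
      using hu(1,2) norm_f0 by (simp_all add: norm_eq_1_iff_cinner cinner_sym_0[of f0])
    ultimately have "(b + cnj b) *\<^sub>C f0 = 0"
      using hu(2) by (simp add: cinner_simps scaleC_simps)
    then have "b + cnj b = 0" using norm_f0 by (auto simp: complex_vector.scale_eq_0_iff)
    then have Re: "Re b = 0" by (simp add: complex_eq_iff)
    then have "\<bar>Im b\<bar> = 1" using nb by (simp add: cmod_def)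
    then have "b = \<i> \<or> b = - \<i>" using Re by (auto simp: complex_eq_iff abs_if split: if_splits)
    moreover have "\<i> *\<^sub>C x = r *\<^sub>R (\<i> *\<^sub>C u)" unfolding r(3) by (simp add: scaleR_scaleC scaleC_simps mult.commute)
    then have "h (\<i> *\<^sub>C x) = r *\<^sub>R (b *\<^sub>C h u)" by (simp add: h_scaleR b)
    then have "h (\<i> *\<^sub>C x) = b *\<^sub>C h x" unfolding hx by (simp add: scaleR_scaleC scaleC_simps mult.commute)
    ultimately have i: "h (\<i> *\<^sub>C x) = \<i> *\<^sub>C h x \<or> h (\<i> *\<^sub>C x) = - (\<i> *\<^sub>C h x)" by auto
    have "norm (h x) = norm x" "cinner (h x) f0 = 0" using hu(1,2) r(1) r(4)[symmetric] by (simp_all add: hx cinner_scaleR_left)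
    then show ?thesis using s d i by blast
  qed
  then show "norm (h x) = norm x" "cinner (h x) f0 = 0" "L (sdyad x e0) = sdyad (h x) f0"
    "L (dyad x) = dyad (h x) + ((norm x)\<^sup>2 / real k) *\<^sub>R K"
    "h (\<i> *\<^sub>C x) = \<i> *\<^sub>C h x \<or> h (\<i> *\<^sub>C x) = - (\<i> *\<^sub>C h x)" by blast+
qed

text \<open>The vectors on which \<open>h\<close> commutes with \<open>i\<close> and those on which it anticommutes with \<open>i\<close> form
  two real subspaces whose union is everything, so one of them is everything.\<close>

lemma h_linear_or_conjugate_linear:
  "(\<forall>x. cinner x e0 = 0 \<longrightarrow> h (\<i> *\<^sub>C x) = \<i> *\<^sub>C h x) \<or> (\<forall>x. cinner x e0 = 0 \<longrightarrow> h (\<i> *\<^sub>C x) = - (\<i> *\<^sub>C h x))"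
proof (rule ccontr)
  assume "\<not> ?thesis"
  then obtain x y where x: "cinner x e0 = 0" "h (\<i> *\<^sub>C x) \<noteq> \<i> *\<^sub>C h x"
    and y: "cinner y e0 = 0" "h (\<i> *\<^sub>C y) \<noteq> - (\<i> *\<^sub>C h y)" by blast
  have x': "h (\<i> *\<^sub>C x) = - (\<i> *\<^sub>C h x)" using h_orthogonal(5)[OF x(1)] x(2) by blast
  have y': "h (\<i> *\<^sub>C y) = \<i> *\<^sub>C h y" using h_orthogonal(5)[OF y(1)] y(2) by blast
  have s: "h (\<i> *\<^sub>C (x + y)) = \<i> *\<^sub>C h y - \<i> *\<^sub>C h x"
    by (simp add: scaleC_simps h_add x' y')
  have xy: "cinner (x + y) e0 = 0" using x(1) y(1) by (simp add: cinner_add_left)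
  have two: "a = 0" if "a = - a" for a :: 'b
  proof -
    have "a + a = 0" using that by (metis add.right_inverse)
    then have "2 *\<^sub>R a = 0" by (simp add: scaleR_2)
    then show ?thesis by simp
  qed
  from h_orthogonal(5)[OF xy] show False
  proof
    assume "h (\<i> *\<^sub>C (x + y)) = \<i> *\<^sub>C h (x + y)"
    then have "\<i> *\<^sub>C h x = - (\<i> *\<^sub>C h x)" unfolding s by (simp add: h_add scaleC_simps algebra_simps eq_neg_iff_add_eq_0)
    then show False using two x(2) x' by metis
  next
    assume "h (\<i> *\<^sub>C (x + y)) = - (\<i> *\<^sub>C h (x + y))"
    then have "\<i> *\<^sub>C h y = - (\<i> *\<^sub>C h y)" unfolding s by (simp add: h_add scaleC_simps algebra_simps eq_neg_iff_add_eq_0)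
    then show False using two y(2) y' by metis
  qed
qed

end

section \<open>Projections, bases, traces and adjoints in Hilbert spaces\<close>

text \<open>By the parallelogram law a minimizing sequence for the distance to the subspace is Cauchy.\<close>

lemma closed_subspace_projection_exists:
  fixes M :: "'a::chilbert_space set"
  assumes M: "csubspace M" "closed M"
  shows "\<exists>p\<in>M. \<forall>y\<in>M. cinner (z - p) y = 0"
proof -
  have sub: "x + y \<in> M" "c *\<^sub>C x \<in> M" if "x \<in> M" "y \<in> M" for x y c
    using M(1) that
    by (simp_all add: complex_vector.subspace_add complex_vector.subspace_scale)
  have zM: "0 \<in> M" using M(1) by (rule complex_vector.subspace_0)
  define d where "d = Inf ((\<lambda>y. (norm (z - y))\<^sup>2) ` M)"
  have bb: "bdd_below ((\<lambda>y. (norm (z - y))\<^sup>2) ` M)" by (rule bdd_belowI[of _ 0]) auto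
  have d: "d \<le> (norm (z - y))\<^sup>2" if "y \<in> M" for y
    unfolding d_def using bb that by (intro cInf_lower) auto
  have "\<exists>y\<in>M. (norm (z - y))\<^sup>2 < d + inverse (real (Suc n))" for n
  proof -
    have "Inf ((\<lambda>y. (norm (z - y))\<^sup>2) ` M) < d + inverse (real (Suc n))" by (simp add: d_def)
    then show ?thesis using cInf_less_iff[OF _ bb] zM by auto
  qed
  then obtain s where s: "\<And>n. s n \<in> M" "\<And>n. (norm (z - s n))\<^sup>2 < d + inverse (real (Suc n))"
    by metis
  have diff: "(norm (s a - s b))\<^sup>2 \<le> 2 * inverse (real (Suc a)) + 2 * inverse (real (Suc b))" for a b
  proof -
    let ?mid = "complex_of_real (1/2) *\<^sub>C (s a + s b)"
    have mid: "?mid \<in> M" using sub s(1) by blast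
    have "(z - s a) + (z - s b) = complex_of_real 2 *\<^sub>C (z - ?mid)"
      by (simp add: complex_vector.scale_right_diff_distrib scaleC_scaleC scaleC_one)
        (simp add: scaleR_scaleC[of 2, symmetric, simplified] scaleR_2)
    then have "(norm ((z - s a) + (z - s b)))\<^sup>2 = 4 * (norm (z - ?mid))\<^sup>2"
      by (simp add: power_mult_distrib)
    moreover have "norm ((z - s a) - (z - s b)) = norm (s a - s b)"
      by (simp add: norm_minus_commute)
    ultimately have "4 * (norm (z - ?mid))\<^sup>2 + (norm (s a - s b))\<^sup>2 = 2 * (norm (z - s a))\<^sup>2 + 2 * (norm (z - s b))\<^sup>2"
      using parallelogram[of "z - s a" "z - s b"] by simp
    then show ?thesis using d[OF mid] s(2)[of a] s(2)[of b] by linarith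
  qed
  have "Cauchy s"
  proof (rule CauchyI)
    fix e :: real assume e: "e > 0"
    then obtain N where N: "inverse (real (Suc N)) < e\<^sup>2 / 4" using reals_Archimedean[of "e\<^sup>2 / 4"] by auto
    have "norm (s a - s b) < e" if "a \<ge> N" "b \<ge> N" for a b
    proof -
      have "inverse (real (Suc a)) \<le> inverse (real (Suc N))" "inverse (real (Suc b)) \<le> inverse (real (Suc N))"
        using that by (auto intro!: le_imp_inverse_le)
      then have "(norm (s a - s b))\<^sup>2 < e\<^sup>2" using diff[of a b] N by linarith
      then show ?thesis using e by (simp add: power2_less_imp_less)
    qed
    then show "\<exists>N. \<forall>a\<ge>N. \<forall>b\<ge>N. norm (s a - s b) < e" by blast
  qed
  then obtain p where p: "s \<longlonglongrightarrow> p" using Cauchy_convergent convergent_def by blast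
  have pM: "p \<in> M" using closed_sequentially[OF M(2) _ p] s(1) by blast
  have "(\<lambda>n. (norm (z - s n))\<^sup>2) \<longlonglongrightarrow> (norm (z - p))\<^sup>2"
    by (intro tendsto_intros p)
  moreover have "(\<lambda>n. d + inverse (real (Suc n))) \<longlonglongrightarrow> d + 0"
    by (intro tendsto_intros LIMSEQ_inverse_real_of_nat)
  ultimately have "(norm (z - p))\<^sup>2 \<le> d + 0"
    by (rule LIMSEQ_le) (use s(2) in \<open>auto intro: less_imp_le\<close>)
  then have pd: "(norm (z - p))\<^sup>2 \<le> d" by simp
  have "cinner (z - p) y = 0" if y: "y \<in> M" for y
  proof (cases "y = 0")
    case False
    define t where "t = cinner (z - p) y / cinner y y"
    have yy: "cinner y y \<noteq> 0" using False by simp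
    have o: "cinner (z - p - t *\<^sub>C y) (t *\<^sub>C y) = 0"
      using yy by (simp add: cinner_diff_left[of "z - p"] cinner_scaleC_left cinner_scaleC_right t_def)
    have "(norm (z - p))\<^sup>2 = (norm (z - p - t *\<^sub>C y))\<^sup>2 + (norm (t *\<^sub>C y))\<^sup>2"
      using norm_add_sq_orth[OF o] by simp
    moreover have "d \<le> (norm (z - p - t *\<^sub>C y))\<^sup>2"
      using d[of "p + t *\<^sub>C y"] sub[OF pM sub(2)[OF y y]] by (simp add: diff_diff_eq)
    ultimately have "(norm (t *\<^sub>C y))\<^sup>2 \<le> 0" using pd by linarith
    then have "t *\<^sub>C y = 0" by simp
    then have "t = 0" using False by (simp add: complex_vector.scale_eq_0_iff)
    then show ?thesis using yy by (simp add: t_def)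
  qed simp
  then show ?thesis using pM by blast
qed

lemma csubspace_closure:
  fixes S :: "'a::chilbert_space set"
  assumes "csubspace S"
  shows "csubspace (closure S)"
proof -
  have S: "0 \<in> S" "\<And>x y. x \<in> S \<Longrightarrow> y \<in> S \<Longrightarrow> x + y \<in> S" "\<And>c x. x \<in> S \<Longrightarrow> c *\<^sub>C x \<in> S"
    using assms
    by (simp_all add: complex_vector.subspace_0 complex_vector.subspace_add complex_vector.subspace_scale)
  have "x + y \<in> closure S" if xy: "x \<in> closure S" "y \<in> closure S" for x y
  proof -
    obtain f g where "\<And>n. f n \<in> S" "f \<longlonglongrightarrow> x" "\<And>n. g n \<in> S" "g \<longlonglongrightarrow> y"
      using xy unfolding closure_sequential by metis
    then have "(\<lambda>n. f n + g n) \<longlonglongrightarrow> x + y" "\<And>n. f n + g n \<in> S"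
      using S(2) by (auto intro: tendsto_add)
    then show ?thesis unfolding closure_sequential by (intro exI[of _ "\<lambda>n. f n + g n"]) simp
  qed
  moreover have "c *\<^sub>C x \<in> closure S" if x: "x \<in> closure S" for c x
  proof -
    obtain f where f: "\<And>n. f n \<in> S" "f \<longlonglongrightarrow> x" using x unfolding closure_sequential by metis
    have "bounded_linear (\<lambda>y::'a. c *\<^sub>C y)"
      by (rule bounded_linear_intro[where K = "cmod c"])
        (simp_all add: scaleC_simps scaleR_scaleC mult.commute)
    then have "(\<lambda>n. c *\<^sub>C f n) \<longlonglongrightarrow> c *\<^sub>C x" using f(2) by (rule bounded_linear.tendsto)
    then show ?thesis unfolding closure_sequential
      using f(1) S(3) by (intro exI[of _ "\<lambda>n. c *\<^sub>C f n"]) simp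
  qed
  moreover have "0 \<in> closure S" using S(1) closure_subset by blast
  ultimately show ?thesis by (simp add: complex_vector.subspace_def)
qed

text \<open>A vector outside the closed span of a maximal family would leave, after subtraction of its projection,
  a vector that extends the family.\<close>

lemma orthonormal_basis_exists: "\<exists>B :: 'a::chilbert_space set. orthonormal_basis B"
proof -
  obtain B :: "'a set" where B: "orthonormal B" "\<And>x. orthonormal (insert x B) \<Longrightarrow> x \<in> B"
    using maximal_orthonormal_exists[OF orthonormal_empty] by metis
  have "csubspace (cspan B)" by (rule complex_vector.subspace_span)
  then have cl: "csubspace (closure (cspan B))" by (rule csubspace_closure)
  have "z \<in> closure (cspan B)" for z
  proof (rule ccontr)
    assume z: "z \<notin> closure (cspan B)"
    obtain p where p: "p \<in> closure (cspan B)" "\<And>y. y \<in> closure (cspan B) \<Longrightarrow> cinner (z - p) y = 0"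
      using closed_subspace_projection_exists[OF cl closed_closure] by blast
    have ne: "z - p \<noteq> 0" using z p(1) by auto
    define x where "x = complex_of_real (1 / norm (z - p)) *\<^sub>C (z - p)"
    have BC: "y \<in> closure (cspan B)" if "y \<in> B" for y
      using that closure_subset complex_vector.span_base by blast
    have nx: "norm x = 1" using ne by (simp add: x_def norm_divide)
    have xo: "cinner x y = 0" if "y \<in> B" for y
      using p(2)[OF BC[OF that]] by (simp add: x_def cinner_scaleC_left)
    have "x \<in> B" using B(1) nx xo by (intro B(2) orthonormal_insert)
    then have "cinner x x = 0" by (rule xo)
    then show False using nx by auto
  qed
  then show ?thesis using B(1) unfolding orthonormal_basis_def orthonormal_def by blast
qed

text \<open>If \<open>F\<close> is large enough, then some vector in its span is close to \<open>x\<close>; the orthogonal projection to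
  this span is at least as close, and its squared distance to \<open>x\<close> is the defect of the partial sum.\<close>

lemma parseval_has_sum:
  fixes B :: "'a::chilbert_space set"
  assumes B: "orthonormal_basis B"
  shows "((\<lambda>e. cinner (dyad x \<cdot> e) e) has_sum cinner x x) B"
  unfolding has_sum_def tendsto_iff eventually_finite_subsets_at_top
proof (intro allI impI)
  fix \<epsilon> :: real assume \<epsilon>: "\<epsilon> > 0"
  have on: "orthonormal B" and cl: "closure (cspan B) = UNIV"
    using B unfolding orthonormal_basis_def orthonormal_def by blast+
  obtain y where y: "y \<in> cspan B" "dist y x < sqrt \<epsilon>"
  proof -
    have "\<exists>y\<in>cspan B. dist y x < sqrt \<epsilon>"
      using closure_approachable[of x "cspan B"] cl \<epsilon> by simp
    then show ?thesis using that by blast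
  qed
  obtain F0 where F0: "finite F0" "F0 \<subseteq> B" "y \<in> cspan F0"
    using y(1) unfolding complex_vector.span_explicit by blast
  have "dist (\<Sum>e\<in>F. cinner (dyad x \<cdot> e) e) (cinner x x) < \<epsilon>"
    if F: "finite F" "F0 \<subseteq> F" "F \<subseteq> B" for F
  proof -
    have onF: "orthonormal F" by (rule orthonormal_subset[OF on F(3)])
    define s where "s = (\<Sum>e\<in>F. cinner x e *\<^sub>C e)"
    have xs: "cinner (x - s) e = 0" if "e \<in> F" for e
      unfolding s_def by (rule orthogonal_remainder[OF onF F(1) that])
    have span0: "cinner (x - s) w = 0" if "w \<in> cspan F" for w
      by (subst orthonormal_expand[OF onF F(1) that]) (simp add: cinner_sum_right cinner_scaleC_right xs)
    have sF: "s \<in> cspan F" unfolding s_def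
      by (intro complex_vector.span_sum complex_vector.span_scale complex_vector.span_base)
    have yF: "y \<in> cspan F" using F0(3) F(2) complex_vector.span_mono by blast
    have "s - y \<in> cspan F" using sF yF by (rule complex_vector.span_diff)
    then have "(norm ((x - s) + (s - y)))\<^sup>2 = (norm (x - s))\<^sup>2 + (norm (s - y))\<^sup>2"
      by (intro norm_add_sq_orth span0)
    then have "(norm (x - s))\<^sup>2 \<le> (norm (x - y))\<^sup>2" by simp
    also have "\<dots> < (sqrt \<epsilon>)\<^sup>2"
      using y(2) \<epsilon> by (intro power_strict_mono) (simp_all add: dist_norm norm_minus_commute)
    finally have small: "(norm (x - s))\<^sup>2 < \<epsilon>" using \<epsilon> by simp
    have "(\<Sum>e\<in>F. cinner (dyad x \<cdot> e) e) = cinner s x"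
      by (simp add: s_def cinner_sum_left cinner_scaleC_left mult.commute)
    moreover have "cinner (x - s) (x - s) = cinner x x - cinner s x"
    proof -
      have "cinner (x - s) (x - s) = cinner (x - s) x - cinner (x - s) s" by (rule cinner_diff_right)
      then show ?thesis using span0[OF sF] by (simp add: cinner_diff_left[of x s x])
    qed
    ultimately have "cinner x x - (\<Sum>e\<in>F. cinner (dyad x \<cdot> e) e) = complex_of_real ((norm (x - s))\<^sup>2)"
      by (simp add: cinner_self)
    then have "dist (\<Sum>e\<in>F. cinner (dyad x \<cdot> e) e) (cinner x x) = (norm (x - s))\<^sup>2"
      by (simp only: dist_norm norm_minus_commute[of "sum _ _"] norm_of_real) simp
    then show ?thesis using small by simp
  qed
  then show "\<exists>X. finite X \<and> X \<subseteq> B \<and> (\<forall>Y. finite Y \<and> X \<subseteq> Y \<and> Y \<subseteq> B \<longrightarrow>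
      dist (\<Sum>e\<in>Y. cinner (dyad x \<cdot> e) e) (cinner x x) < \<epsilon>)"
    using F0 by blast
qed

lemma op_trace_sum_dyads:
  fixes X :: "'a::chilbert_space set"
  assumes "finite X" "orthonormal X"
  shows "op_trace (\<Sum>x\<in>X. a x *\<^sub>R dyad x) = complex_of_real (\<Sum>x\<in>X. a x)"
proof -
  define B :: "'a set" where "B = (SOME B. orthonormal_basis B)"
  have B: "orthonormal_basis B" unfolding B_def by (rule someI_ex[OF orthonormal_basis_exists])
  have "((\<lambda>e. cinner ((\<Sum>x\<in>Y. a x *\<^sub>R dyad x) \<cdot> e) e) has_sum (\<Sum>x\<in>Y. complex_of_real (a x) * cinner x x)) B"
    if "finite Y" for Y
    using that
  proof (induction Y)
    case empty
    show ?case by simp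
  next
    case (insert x Y)
    have "((\<lambda>e. complex_of_real (a x) * cinner (dyad x \<cdot> e) e) has_sum complex_of_real (a x) * cinner x x) B"
      by (rule has_sum_cmult_right[OF parseval_has_sum[OF B]])
    from has_sum_add[OF this insert.IH] show ?case
      using insert.hyps by (simp add: blinfun.add_left blinfun.scaleR_left cinner_add_left cinner_scaleR_left cinner_scaleC_left)
  qed
  from this[OF assms(1)] have "op_trace (\<Sum>x\<in>X. a x *\<^sub>R dyad x) = (\<Sum>x\<in>X. complex_of_real (a x) * cinner x x)"
    unfolding op_trace_def B_def[symmetric] by (rule infsumI)
  also have "\<dots> = (\<Sum>x\<in>X. complex_of_real (a x))"
    using orthonormalD[OF assms(2)] by (intro sum.cong) auto
  finally show ?thesis by simp
qed

lemma orth_projI: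
  assumes "z \<in> Z" "x - z \<in> orth_compl Z"
    and diff: "\<And>u v. u \<in> Z \<Longrightarrow> v \<in> Z \<Longrightarrow> u - v \<in> Z"
  shows "orth_proj Z (x::'a::chilbert_space) = z"
  unfolding orth_proj_def
proof (rule the_equality)
  fix w assume w: "w \<in> Z \<and> x - w \<in> orth_compl Z"
  have d: "z - w \<in> Z" using assms(1) w diff by blast
  have "cinner (x - w) (z - w) = 0" "cinner (x - z) (z - w) = 0"
    using w assms(2) d unfolding orth_compl_def by blast+
  then have "cinner ((x - w) - (x - z)) (z - w) = 0" by (simp only: cinner_diff_left) simp
  then have "cinner (z - w) (z - w) = 0" by simp
  then show "w = z" by (simp only: cinner_self_eq_0) simp
qed (use assms in blast)

lemma isometry_op_scaleR:
  assumes "isometry_op U"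
  shows "U (r *\<^sub>R x) = r *\<^sub>R U x" and "U (x + y) = U x + U y"
proof -
  from assms consider "clinear U" | "conj_linear U" unfolding isometry_op_def by blast
  then have "U (r *\<^sub>R x) = r *\<^sub>R U x \<and> U (x + y) = U x + U y"
  proof cases
    case 1
    then interpret Vector_Spaces.linear scaleC scaleC U .
    show ?thesis by (simp add: scaleR_scaleC scale add)
  next
    case 2
    then show ?thesis by (simp add: conj_linear_def scaleR_scaleC)
  qed
  then show "U (r *\<^sub>R x) = r *\<^sub>R U x" "U (x + y) = U x + U y" by blast+
qed

lemma isometry_op_i:
  assumes "isometry_op U"
  shows "U (\<i> *\<^sub>C x) = (if clinear U then \<i> else - \<i>) *\<^sub>C U x"
proof (cases "clinear U")
  case True
  then interpret Vector_Spaces.linear scaleC scaleC U .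
  show ?thesis using True by (simp add: scale)
next
  case False
  then have "conj_linear U" using assms unfolding isometry_op_def by blast
  then show ?thesis using False by (simp add: conj_linear_def)
qed

text \<open>By polarization for the real part; the imaginary part is the real part for \<open>i y\<close>.\<close>

lemma isometry_op_cinner:
  fixes U :: "'a::chilbert_space \<Rightarrow> 'b::chilbert_space"
  assumes U: "isometry_op U"
  shows "cinner (U x) (U y) = (if clinear U then cinner x y else cnj (cinner x y))"
proof -
  have nU: "norm (U z) = norm z" for z using U by (simp add: isometry_op_def)
  have pol: "2 * Re (cinner x y) = (norm (x + y))\<^sup>2 - (norm x)\<^sup>2 - (norm y)\<^sup>2" for x y :: "'c::chilbert_space"
  proof -
    have "cinner (x + y) (x + y) = cinner x x + cinner y y + (cinner x y + cnj (cinner x y))"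
      by (simp add: cinner_simps cinner_commute[symmetric])
    then have "Re (cinner (x + y) (x + y)) = Re (cinner x x) + Re (cinner y y) + 2 * Re (cinner x y)" by simp
    then show ?thesis by (simp add: cinner_self)
  qed
  have re: "Re (cinner (U x) (U y)) = Re (cinner x y)" for x y
    using pol[of "U x" "U y"] pol[of x y] by (simp add: nU flip: isometry_op_scaleR(2)[OF U])
  have "Re (cinner (U x) (U (\<i> *\<^sub>C y))) = Re (cinner x (\<i> *\<^sub>C y))" by (rule re)
  then have "Im (cinner (U x) (U y)) = (if clinear U then 1 else -1) * Im (cinner x y)"
    unfolding isometry_op_i[OF U] by (simp add: cinner_scaleC_right split: if_splits)
  then show ?thesis using re[of x y] by (simp add: complex_eq_iff)
qed

text \<open>The range of an isometry is complete, so \<open>y\<close> has an orthogonal projection \<open>U z\<close> onto it, and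
  \<open>z\<close> is the value of the adjoint.\<close>

lemma adj_isometry:
  fixes U :: "'a::chilbert_space \<Rightarrow> 'b::chilbert_space"
  assumes U: "isometry_op U"
  shows "cinner (U x) y = (if clinear U then cinner x (adj U y) else cnj (cinner x (adj U y)))"
proof -
  have nU: "norm (U z) = norm z" for z using U by (simp add: isometry_op_def)
  have "bounded_linear U"
    by (rule bounded_linear_intro[where K = 1]) (simp_all add: isometry_op_scaleR[OF U] nU)
  then have "complete (U ` UNIV)"
    by (intro complete_isometric_image[of 1]) (simp_all add: nU complete_UNIV)
  then have cl: "closed (range U)" by (rule complete_imp_closed)
  have cs: "csubspace (range U)"
  proof (rule complex_vector.subspaceI)
    have "U 0 = 0" using isometry_op_scaleR(1)[OF U, of 0 0] by simp
    then show "0 \<in> range U" by (metis rangeI)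
    show "a + b \<in> range U" if "a \<in> range U" "b \<in> range U" for a b
      using that by (auto simp flip: isometry_op_scaleR(2)[OF U])
    show "c *\<^sub>C a \<in> range U" if a: "a \<in> range U" for c a
    proof -
      obtain w where w: "a = U w" using a by auto
      show ?thesis
      proof (cases "clinear U")
        case True
        then interpret Vector_Spaces.linear scaleC scaleC U .
        show ?thesis unfolding w by (metis scale rangeI)
      next
        case False
        then have "conj_linear U" using U unfolding isometry_op_def by blast
        then have "U (cnj c *\<^sub>C w) = c *\<^sub>C U w" by (simp add: conj_linear_def)
        then show ?thesis unfolding w by (metis rangeI)
      qed
    qed
  qed
  obtain p where p: "p \<in> range U" "\<And>w. w \<in> range U \<Longrightarrow> cinner (y - p) w = 0"
    using closed_subspace_projection_exists[OF cs cl] by blast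
  then obtain z where z: "p = U z" by auto
  let ?Q = "\<lambda>z. \<forall>x. cinner (U x) y = (if clinear U then cinner x z else cnj (cinner x z))"
  have Qz: "?Q z"
  proof
    fix x
    have "cinner (y - p) (U x) = 0" by (rule p(2)) simp
    then have "cinner (U x) (y - p) = 0" by (simp add: cinner_sym_0[of "U x"])
    then have "cinner (U x) y = cinner (U x) (U z)" by (simp add: cinner_diff_right z)
    then show "cinner (U x) y = (if clinear U then cinner x z else cnj (cinner x z))"
      unfolding isometry_op_cinner[OF U] .
  qed
  have uniq: "z' = z" if Q: "?Q z'" for z'
  proof (rule cinner_ext)
    fix w
    have "cinner w z' = cinner w z"
      using Q[rule_format, of w] Qz[rule_format, of w] by (cases "clinear U") simp_all
    then show "cinner z' w = cinner z w" by (metis cinner_commute)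
  qed
  have "?Q (adj U y)" unfolding adj_def
  proof (rule theI)
    show "?Q z" by (rule Qz)
    show "z' = z" if "?Q z'" for z' by (rule uniq[OF that])
  qed
  then show ?thesis by blast
qed

text \<open>\<open>U x x\<^sup>* U\<^sup>* = (U x) (U x)\<^sup>*\<close>, also for conjugate-linear \<open>U\<close>.\<close>

lemma isometry_conjugated_dyad:
  fixes U :: "'a::chilbert_space \<Rightarrow> 'b::chilbert_space"
  assumes U: "isometry_op U"
  shows "U (dyad x \<cdot> adj U y) = (dyad (U x)) \<cdot> y"
proof (cases "clinear U")
  case True
  then interpret Vector_Spaces.linear scaleC scaleC U .
  have "cinner (adj U y) x = cinner y (U x)"
    using adj_isometry[OF U, of x y] True by (metis cinner_commute)
  then show ?thesis by (simp add: scale)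
next
  case False
  then have cl: "conj_linear U" using U unfolding isometry_op_def by blast
  have "cnj (cinner (adj U y) x) = cinner y (U x)"
    using adj_isometry[OF U, of x y] False by (metis cinner_commute)
  then show ?thesis using cl by (simp add: conj_linear_def)
qed

section \<open>The form of the map\<close>

context adjacent_projection_map
begin

text \<open>Set \<open>U (\<alpha> e\<^sub>0 + x) = \<kappa>(\<alpha>) f\<^sub>0 + h(x)\<close> for \<open>x\<close> orthogonal to \<open>e\<^sub>0\<close>, where \<open>\<kappa>\<close> is the identity or the
  conjugation according to the behaviour of \<open>h\<close>. Expanding \<open>L (y y\<^sup>*)\<close> with \<open>y = \<alpha> e\<^sub>0 + x\<close> gives
  \<open>(U y) (U y)\<^sup>*\<close> up to a multiple of \<open>K\<close>.\<close>

theorem isometry_exists: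
  obtains U where "isometry_op U"
    "\<And>x. L (dyad x) = dyad (U x) + ((norm x)\<^sup>2 / real k) *\<^sub>R K" "\<And>x. K \<cdot> U x = 0"
proof -
  obtain \<kappa> :: "complex \<Rightarrow> complex" where \<kappa>: "\<kappa> = id \<or> \<kappa> = cnj"
    and hi: "\<And>x. cinner x e0 = 0 \<Longrightarrow> h (\<i> *\<^sub>C x) = \<kappa> \<i> *\<^sub>C h x"
    using h_linear_or_conjugate_linear
  proof
    assume "\<forall>x. cinner x e0 = 0 \<longrightarrow> h (\<i> *\<^sub>C x) = \<i> *\<^sub>C h x"
    then show ?thesis using that[of id] by simp
  next
    assume "\<forall>x. cinner x e0 = 0 \<longrightarrow> h (\<i> *\<^sub>C x) = - (\<i> *\<^sub>C h x)"
    then show ?thesis using that[of cnj] by simp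
  qed
  have \<kappa>_simps: "\<kappa> (a + b) = \<kappa> a + \<kappa> b" "\<kappa> (a * b) = \<kappa> a * \<kappa> b" "cmod (\<kappa> a) = cmod a"
    "\<kappa> (cnj a) = cnj (\<kappa> a)" "\<kappa> (complex_of_real r) = complex_of_real r" for a b r
    using \<kappa> by auto
  have hc: "h (c *\<^sub>C x) = \<kappa> c *\<^sub>C h x" if x: "cinner x e0 = 0" for c x
  proof -
    have "c *\<^sub>C x = Re c *\<^sub>R x + Im c *\<^sub>R (\<i> *\<^sub>C x)"
      by (subst complex_eq[of c]) (simp add: scaleC_simps scaleR_scaleC mult.commute)
    then have "h (c *\<^sub>C x) = Re c *\<^sub>R h x + Im c *\<^sub>R (\<kappa> \<i> *\<^sub>C h x)"
      by (simp add: h_add h_scaleR hi[OF x])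
    also have "\<dots> = (complex_of_real (Re c) + complex_of_real (Im c) * \<kappa> \<i>) *\<^sub>C h x"
      by (simp add: scaleR_scaleC scaleC_simps)
    also have "complex_of_real (Re c) + complex_of_real (Im c) * \<kappa> \<i> = \<kappa> (complex_of_real (Re c) + complex_of_real (Im c) * \<i>)"
      by (simp only: \<kappa>_simps)
    also have "complex_of_real (Re c) + complex_of_real (Im c) * \<i> = c" by (simp add: complex_eq_iff)
    finally show ?thesis .
  qed
  define r where "r y = y - cinner y e0 *\<^sub>C e0" for y
  have e0e0: "cinner e0 e0 = 1" using norm_e0 by (simp add: norm_eq_1_iff_cinner)
  have r0: "cinner (r y) e0 = 0" for y by (simp add: r_def cinner_simps e0e0)
  have y_eq: "y = cinner y e0 *\<^sub>C e0 + r y" for y by (simp add: r_def)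
  have r_add: "r (x + y) = r x + r y" for x y by (simp add: r_def cinner_simps scaleC_simps)
  have r_scale: "r (c *\<^sub>C x) = c *\<^sub>C r x" for c x by (simp add: r_def cinner_simps scaleC_simps)
  define U where "U y = \<kappa> (cinner y e0) *\<^sub>C f0 + h (r y)" for y
  have U_add: "U (x + y) = U x + U y" for x y
    by (simp add: U_def r_add h_add cinner_add_left \<kappa>_simps scaleC_simps)
  have U_scale: "U (c *\<^sub>C x) = \<kappa> c *\<^sub>C U x" for c x
    by (simp add: U_def r_scale hc[OF r0] cinner_scaleC_left \<kappa>_simps scaleC_simps)
  have norms: "(norm (U y))\<^sup>2 = (norm y)\<^sup>2" "(norm y)\<^sup>2 = (cmod (cinner y e0))\<^sup>2 + (norm (r y))\<^sup>2" for y
  proof -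
    have "cinner (cinner y e0 *\<^sub>C e0) (r y) = 0" using r0[of y] by (simp add: cinner_scaleC_left cinner_sym_0[of e0])
    from norm_add_sq_orth[OF this] show 1: "(norm y)\<^sup>2 = (cmod (cinner y e0))\<^sup>2 + (norm (r y))\<^sup>2"
      by (simp add: y_eq[symmetric] norm_e0)
    have "cinner (\<kappa> (cinner y e0) *\<^sub>C f0) (h (r y)) = 0"
      using h_orthogonal(2)[OF r0, of y] by (simp add: cinner_scaleC_left cinner_sym_0[of f0])
    from norm_add_sq_orth[OF this] show "(norm (U y))\<^sup>2 = (norm y)\<^sup>2"
      by (simp add: U_def[symmetric] norm_f0 \<kappa>_simps h_orthogonal(1)[OF r0] 1)
  qed
  have nU: "norm (U y) = norm y" for y using norms(1)[of y] by (simp add: power2_eq_iff_nonneg)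
  have "clinear U \<or> conj_linear U"
  proof (cases "\<kappa> = id")
    case True
    then have "clinear U"
      by unfold_locales (auto simp: U_add U_scale scaleC_simps)
    then show ?thesis ..
  next
    case False
    then have "\<kappa> = cnj" using \<kappa> by blast
    then have "conj_linear U" by (simp add: conj_linear_def U_add U_scale)
    then show ?thesis ..
  qed
  then have iso: "isometry_op U" using nU by (simp add: isometry_op_def)
  have LU: "L (dyad y) = dyad (U y) + ((norm y)\<^sup>2 / real k) *\<^sub>R K" for y
  proof -
    define \<alpha> where "\<alpha> = cinner y e0"
    define x where "x = r y"
    have xo: "cinner x e0 = 0" by (simp add: x_def r0)
    have y: "y = \<alpha> *\<^sub>C e0 + x" unfolding \<alpha>_def x_def by (rule y_eq)
    have Uy: "U y = \<kappa> \<alpha> *\<^sub>C f0 + h x" by (simp add: U_def \<alpha>_def x_def)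
    have s: "sdyad (\<alpha> *\<^sub>C e0) x = sdyad (cnj \<alpha> *\<^sub>C x) e0"
      by (simp add: sdyad_scaleC_shift[of \<alpha>] sdyad_commute[of e0])
    have co: "cinner (cnj \<alpha> *\<^sub>C x) e0 = 0" by (simp add: cinner_scaleC_left xo)
    have Ls: "L (sdyad (\<alpha> *\<^sub>C e0) x) = sdyad (\<kappa> \<alpha> *\<^sub>C f0) (h x)"
      unfolding s h_orthogonal(3)[OF co] hc[OF xo] \<kappa>_simps
      by (simp add: sdyad_scaleC_shift[of "\<kappa> \<alpha>"] sdyad_commute[of _ f0])
    have La: "L (dyad (\<alpha> *\<^sub>C e0)) = dyad (\<kappa> \<alpha> *\<^sub>C f0) + ((cmod \<alpha>)\<^sup>2 / real k) *\<^sub>R K"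
      by (simp add: dyad_scaleC L_scaleR L_dyad_unit_K[OF norm_e0] f0_def \<kappa>_simps scaleR_add_right)
    have "L (dyad y) = L (dyad (\<alpha> *\<^sub>C e0)) + L (dyad x) + L (sdyad (\<alpha> *\<^sub>C e0) x)"
      unfolding y dyad_add by (simp add: L_add)
    also have "\<dots> = dyad (U y) + ((cmod \<alpha>)\<^sup>2 / real k + (norm x)\<^sup>2 / real k) *\<^sub>R K"
      unfolding Uy dyad_add La Ls h_orthogonal(4)[OF xo] by (simp add: algebra_simps)
    also have "(cmod \<alpha>)\<^sup>2 / real k + (norm x)\<^sup>2 / real k = (norm y)\<^sup>2 / real k"
      using norms(2)[of y] by (simp add: \<alpha>_def x_def add_divide_distrib)
    finally show ?thesis .
  qed
  have KU: "K \<cdot> U x = 0" for x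
  proof (cases "x = 0")
    case True
    have "U 0 = 0" using nU[of 0] by simp
    then show ?thesis using True by (simp add: blinfun.zero_right)
  next
    case False
    then obtain s u where su: "norm u = 1" "x = s *\<^sub>R u" using normalize_unit by metis
    have "dyad (U u) = dyad (g u)" using LU[of u] L_dyad_unit_K[OF su(1)] su(1) by simp
    then have "U u = cinner (U u) (g u) *\<^sub>C g u" using nU su(1) by (intro dyad_eqD) simp_all
    then have "K \<cdot> U u = cinner (U u) (g u) *\<^sub>C K \<cdot> g u"
      by (metis self_adjoint_scaleC[OF K_self_adjoint])
    then have "K \<cdot> U u = 0" by (simp add: K_g[OF su(1)])
    then show ?thesis unfolding su(2) isometry_op_scaleR(1)[OF iso] by (simp add: blinfun.scaleR_right)
  qed
  show thesis by (rule that[OF iso LU KU])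
qed

text \<open>Both sides are additive in \<open>A\<close>, so the spectral decomposition reduces the claim to \<open>x x\<^sup>*\<close>.\<close>

theorem map_is_L_op:
  "\<exists>W U. csubspace W \<and> ecdim W = enat (m - k) \<and> isometry_op U \<and> range U \<subseteq> orth_compl W \<and>
    (\<forall>A\<in>fin_rank_sa. blinfun_apply (L A) = L_op k U W A)"
proof -
  obtain U where U: "isometry_op U" "\<And>x. L (dyad x) = dyad (U x) + ((norm x)\<^sup>2 / real k) *\<^sub>R K"
    "\<And>x. K \<cdot> U x = 0"
    using isometry_exists by metis
  define W where "W = range (blinfun_apply K)"
  have saK: "self_adjoint K" by (rule K_self_adjoint)
  have KK: "K \<cdot> (K \<cdot> w) = K \<cdot> w" for w
    by (rule projections_idem[OF K_projection])
  have dimW: "ecdim W = enat (m - k)" using K_projection by (simp add: W_def projections_def)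
  have Wdiff: "a - b \<in> W" if "a \<in> W" "b \<in> W" for a b
    using that by (auto simp: W_def simp flip: blinfun.diff_right)
  have csW: "csubspace W"
  proof (rule complex_vector.subspaceI)
    show "0 \<in> W" unfolding W_def by (metis blinfun.zero_right rangeI)
    show "a + b \<in> W" if "a \<in> W" "b \<in> W" for a b
      using that by (auto simp: W_def simp flip: blinfun.add_right)
    show "c *\<^sub>C a \<in> W" if "a \<in> W" for c a
      using that by (auto simp: W_def simp flip: self_adjoint_scaleC[OF saK])
  qed
  have Wc: "orth_compl W = {x. K \<cdot> x = 0}"
  proof (intro set_eqI iffI; simp)
    fix x assume "x \<in> orth_compl W"
    then have "cinner x (K \<cdot> (K \<cdot> x)) = 0" by (simp add: orth_compl_def W_def)
    then have "cinner (K \<cdot> x) (K \<cdot> x) = 0" by (simp add: self_adjointD[OF saK])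
    then show "K \<cdot> x = 0" by simp
  next
    fix x assume x: "K \<cdot> x = 0"
    have "cinner x (K \<cdot> w) = 0" for w
      using self_adjointD[OF saK, of x w] x by simp
    then show "x \<in> orth_compl W" by (auto simp: orth_compl_def W_def)
  qed
  have P1: "orth_proj W z = K \<cdot> z" for z
  proof (rule orth_projI)
    show "K \<cdot> z \<in> W" by (simp add: W_def)
    show "z - K \<cdot> z \<in> orth_compl W" by (simp add: Wc blinfun.diff_right KK)
  qed (rule Wdiff)
  have P2: "orth_proj (orth_compl W) z = z - K \<cdot> z" for z
  proof (rule orth_projI)
    show "z - K \<cdot> z \<in> orth_compl W" by (simp add: Wc blinfun.diff_right KK)
    show "z - (z - K \<cdot> z) \<in> orth_compl (orth_compl W)"
      using self_adjointD[OF saK] by (simp add: orth_compl_def[of "orth_compl W"]) (simp add: Wc)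
    show "u - v \<in> orth_compl W" if "u \<in> orth_compl W" "v \<in> orth_compl W" for u v
      using that by (simp add: Wc blinfun.diff_right)
  qed
  have "blinfun_apply (L A) = L_op k U W A" if A: "A \<in> fin_rank_sa" for A
  proof
    fix z
    obtain X a where X: "finite X" "orthonormal X" "A = (\<Sum>x\<in>X. a x *\<^sub>R dyad x)"
      using spectral_decomposition[OF A] by metis
    define t where "t = (\<Sum>x\<in>X. a x)"
    have U0: "U 0 = 0" using isometry_op_scaleR(1)[OF U(1), of 0 0] by simp
    have U_sum: "U (\<Sum>x\<in>Y. f x) = (\<Sum>x\<in>Y. U (f x))" for f :: "'a \<Rightarrow> 'a" and Y
      by (induction Y rule: infinite_finite_induct) (simp_all add: U0 isometry_op_scaleR(2)[OF U(1)])
    have KUz: "cinner (K \<cdot> z) (U x) = 0" for x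
      by (simp add: self_adjointD[OF saK] U(3))
    have nX: "norm x = 1" if "x \<in> X" for x by (rule orthonormal_norm[OF X(2) that])
    have "L A = (\<Sum>x\<in>X. a x *\<^sub>R (dyad (U x) + (1 / real k) *\<^sub>R K))"
      unfolding X(3) L_sum_scaled_dyads by (intro sum.cong refl) (simp add: U(2) nX)
    also have "\<dots> = (\<Sum>x\<in>X. a x *\<^sub>R dyad (U x)) + (t / real k) *\<^sub>R K"
      by (simp add: t_def scaleR_add_right sum.distrib scaleR_sum_left sum_divide_distrib)
    finally have 1: "L A \<cdot> z = (\<Sum>x\<in>X. a x *\<^sub>R (dyad (U x)) \<cdot> z) + (t / real k) *\<^sub>R K \<cdot> z"
      by (simp add: blinfun.add_left blinfun.sum_left blinfun.scaleR_left)
    have "U (A \<cdot> (adj U (z - K \<cdot> z)))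
        = (\<Sum>x\<in>X. a x *\<^sub>R U (dyad x \<cdot> (adj U (z - K \<cdot> z))))"
      unfolding X(3) by (simp only: blinfun.sum_left blinfun.scaleR_left U_sum isometry_op_scaleR(1)[OF U(1)])
    also have "\<dots> = (\<Sum>x\<in>X. a x *\<^sub>R (dyad (U x)) \<cdot> z)"
      unfolding isometry_conjugated_dyad[OF U(1)] by (simp add: cinner_diff_left KUz)
    finally have 2: "U (A \<cdot> (adj U (z - K \<cdot> z))) = (\<Sum>x\<in>X. a x *\<^sub>R (dyad (U x)) \<cdot> z)" .
    have 3: "(inverse (of_nat k) * op_trace A) *\<^sub>C K \<cdot> z = (t / real k) *\<^sub>R K \<cdot> z"
      unfolding X(3) op_trace_sum_dyads[OF X(1,2)] t_def[symmetric]
      by (simp add: scaleR_scaleC divide_inverse mult.commute)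
    show "L A \<cdot> z = L_op k U W A z"
      unfolding L_op_def P1 P2 1 2 3 ..
  qed
  moreover have "range U \<subseteq> orth_compl W" using U(3) by (auto simp: Wc)
  ultimately show ?thesis using csW dimW U(1) by blast
qed

end

theorem theorem2:
  fixes L :: "('a::chilbert_space \<Rightarrow>\<^sub>L 'a) \<Rightarrow> ('b::chilbert_space \<Rightarrow>\<^sub>L 'b)"
    and k m :: nat
  assumes "3 \<le> ecdim (UNIV :: 'a set)" and "3 \<le> ecdim (UNIV :: 'b set)"
    and "0 < k" and "enat k < ecdim (UNIV :: 'a set)"
    and "0 < m" and "enat m < ecdim (UNIV :: 'b set)"
    and "L ` fin_rank_sa \<subseteq> fin_rank_sa"
    and "\<And>A B. A \<in> fin_rank_sa \<Longrightarrow> B \<in> fin_rank_sa \<Longrightarrow> L (A + B) = L A + L B"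
    and "\<And>c A. A \<in> fin_rank_sa \<Longrightarrow> L (c *\<^sub>R A) = c *\<^sub>R L A"
    and "L ` projections k \<subseteq> projections m"
    and "inj_on L (projections k)"
  shows "(enat (2 * k) \<le> ecdim (UNIV :: 'a set) \<longrightarrow> k \<le> m) \<and>
    (ecdim (UNIV :: 'a set) = \<infinity> \<and>
     (\<forall>P\<in>projections k. \<forall>Q\<in>projections k.
        enat (m - k) \<le> ecdim (range (blinfun_apply (L P)) \<inter> range (blinfun_apply (L Q)))) \<longrightarrow>
     (\<exists>W U. csubspace W \<and> ecdim W = enat (m - k) \<and>
        isometry_op U \<and> range U \<subseteq> orth_compl W \<and>
        (\<forall>A\<in>fin_rank_sa. blinfun_apply (L A) = L_op k U W A)))"
proof -
  interpret projection_map L k m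
    using assms(3-5,7-11) by unfold_locales
  show ?thesis
  proof (intro conjI impI)
    assume "enat (2 * k) \<le> ecdim (UNIV :: 'a set)"
    then show "k \<le> m" by (rule rank_inequality)
  next
    assume a: "ecdim (UNIV :: 'a set) = \<infinity> \<and>
     (\<forall>P\<in>projections k. \<forall>Q\<in>projections k.
        enat (m - k) \<le> ecdim (range (blinfun_apply (L P)) \<inter> range (blinfun_apply (L Q))))"
    interpret adjacent_projection_map L k m
      using a by unfold_locales blast+
    show "\<exists>W U. csubspace W \<and> ecdim W = enat (m - k) \<and> isometry_op U \<and> range U \<subseteq> orth_compl W \<and>
      (\<forall>A\<in>fin_rank_sa. blinfun_apply (L A) = L_op k U W A)"
      by (rule map_is_L_op)
  qed
qed

end
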